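(* Let $n\ge 1$, let $q,t$ be independent indeterminates and work over $\mathbb{Q}(q,t)$. Let $\Lambda_n$, the Macdonald operators $D_k$, the homomorphism $D$, the points $\widehat\lambda$, the Fourier pairing $\langle g,f\rangle=[D(g)\cdot f](\widehat 0)$, the interpolation polynomials $I_\mu$, the Macdonald polynomials $P_\mu$ and the coefficients $c_{\mu,\nu}$ be as in the context. Then for all partitions $\mu,\nu$ with at most $n$ parts, $$\langle I_\mu,I_\nu\rangle=\delta_{\mu,\nu}\,I_\mu(\widehat\mu)\,P_\mu(\widehat 0)=\delta_{\mu,\nu}\,c_{\mu,\mu}\,I_\mu(\widehat\mu).$$
   Context: $\Lambda_n$ is the algebra of symmetric polynomials in $x_1,\dots,x_n$. For $k=1,\dots,n$, $D_k=t^{k(k-1)/2}\sum_{|S|=k}\prod_{i\in S,j\notin S}\frac{tx_i-x_j}{x_i-x_j}\prod_{i\in S}T_i$, the sum over $k$-subsets $S\subset\{1,\dots,n\}$, with $[T_if](x)=f(x_1,\dots,qx_i,\dots,x_n)$. These commute and preserve $\Lambda_n$, and $D:\Lambda_n\to\operatorname{End}(\Lambda_n)$ is the algebra homomorphism with $D(e_k)=D_k$ ($e_k$ the elementary symmetric polynomials). For a partition $\lambda$ with at most $n$ parts, $\widehat\lambda=(q^{\lambda_1}t^{n-1},q^{\lambda_2}t^{n-2},\dots,q^{\lambda_n})$, so $\widehat 0=(t^{n-1},\dots,t,1)$. $m_\lambda$ is the monomial symmetric polynomial; $\le$ is dominance order ($\mu\le\lambda$ iff all partial sums of $\mu$ are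 at most those of $\lambda$ and $|\mu|=|\lambda|$). The Macdonald polynomial $P_\lambda$ is the unique element of $\Lambda_n$ with $D_kP_\lambda=e_k(\widehat\lambda)P_\lambda$ for all $k$ and $P_\lambda=m_\lambda+\sum_{\mu<\lambda}b_\mu m_\mu$. Fix a total order $\vartriangleleft$ on partitions with at most $n$ parts compatible with size and, within a given size, with dominance; $I_\mu$ is the unique element of $\Lambda_n$ with $I_\mu=m_\mu+\sum_{\lambda\vartriangleleft\mu}a_\lambda m_\lambda$ and $I_\mu(\widehat\lambda)=0$ for all $\lambda\vartriangleleft\mu$. For a partition $\mu$ with at most $n$ parts let $\mu'$ be its conjugate partition and $D_\mu=D_{\mu'_1}D_{\mu'_2}\cdots D_{\mu'_{\mu_1}}$ (all $\mu'_j\le n$). The scalars $c_{\mu,\nu}\in\mathbb{Q}(q,t)$ are the (uniquely determined) coefficients such that for every $f\in\Lambda_n$, $[D_\mu\cdot f](\widehat 0)=\sum_{\nu\le\mu}c_{\mu,\nu}\,f(\widehat\nu)$, the sum over partitions $\nu$ with at most $n$ parts. *)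

theory Defs
  imports Main "HOL-Computational_Algebra.Polynomial" "HOL-Computational_Algebra.Fraction_Field"
    "HOL-Combinatorics.Permutations"
begin

text \<open>The ground field Q(q,t), realised as the fraction field of (Q[q])[t].\<close>
type_synonym K = "rat poly poly fract"

definition qq :: K where "qq = Fract [:[:0, 1:]:] 1"
definition tt :: K where "tt = Fract [:0, 1:] 1"

text \<open>Points of K^n are functions nat => K (only coordinates 0..n-1 matter; the paper's
 x_1..x_n are our x 0 .. x (n-1)).  Partitions with at most n parts are weakly decreasing
 functions nat => nat vanishing from index n on.\<close>
definition Par :: "nat \<Rightarrow> (nat \<Rightarrow> nat) set" where
  "Par n = {la. (\<forall>i j. i \<le> j \<longrightarrow> la j \<le> la i) \<and> (\<forall>i\<ge>n. la i = 0)}"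

definition psize :: "nat \<Rightarrow> (nat \<Rightarrow> nat) \<Rightarrow> nat" where
  "psize n la = (\<Sum>i<n. la i)"

definition dom_le :: "nat \<Rightarrow> (nat \<Rightarrow> nat) \<Rightarrow> (nat \<Rightarrow> nat) \<Rightarrow> bool" where
  "dom_le n mu la \<longleftrightarrow> psize n mu = psize n la \<and> (\<forall>k\<le>n. (\<Sum>i<k. mu i) \<le> (\<Sum>i<k. la i))"

definition zero_part :: "nat \<Rightarrow> nat" where "zero_part = (\<lambda>_. 0)"

definition hat :: "nat \<Rightarrow> (nat \<Rightarrow> nat) \<Rightarrow> nat \<Rightarrow> K" where
  "hat n la = (\<lambda>i. if i < n then qq ^ la i * tt ^ (n - 1 - i) else 0)"

definition rearr :: "nat \<Rightarrow> (nat \<Rightarrow> nat) \<Rightarrow> (nat \<Rightarrow> nat) set" where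
  "rearr n la = {al. \<exists>\<sigma>. \<sigma> permutes {..<n} \<and> al = la \<circ> \<sigma>}"

definition mono :: "nat \<Rightarrow> (nat \<Rightarrow> nat) \<Rightarrow> (nat \<Rightarrow> K) \<Rightarrow> K" where
  "mono n la x = (\<Sum>al\<in>rearr n la. \<Prod>i<n. x i ^ al i)"

text \<open>Lambda_n: the K-span of the m_la (symmetric polynomials, as polynomial functions)\<close>
definition Lam :: "nat \<Rightarrow> ((nat \<Rightarrow> K) \<Rightarrow> K) set" where
  "Lam n = {f. \<exists>F c. finite F \<and> F \<subseteq> Par n \<and> f = (\<lambda>x. \<Sum>la\<in>F. c la * mono n la x)}"

definition epart :: "nat \<Rightarrow> nat \<Rightarrow> nat" where "epart k = (\<lambda>i. if i < k then 1 else 0)"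
definition elem :: "nat \<Rightarrow> nat \<Rightarrow> (nat \<Rightarrow> K) \<Rightarrow> K" where "elem n k = mono n (epart k)"

text \<open>the defining formula of the Macdonald operator D_k (valid at points with distinct coordinates)\<close>
definition Dform :: "nat \<Rightarrow> nat \<Rightarrow> ((nat \<Rightarrow> K) \<Rightarrow> K) \<Rightarrow> (nat \<Rightarrow> K) \<Rightarrow> K" where
  "Dform n k f x = tt ^ (k * (k - 1) div 2) *
     (\<Sum>S\<in>{S. S \<subseteq> {..<n} \<and> card S = k}.
        (\<Prod>i\<in>S. \<Prod>j\<in>{..<n} - S. (tt * x i - x j) / (x i - x j)) *
        f (\<lambda>i. if i \<in> S then qq * x i else x i))"

text \<open>D_k f: the element of Lambda_n given by the formula (as a rational-function identity,
  i.e. agreeing with it at all points with pairwise distinct coordinates)\<close>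
definition Dk :: "nat \<Rightarrow> nat \<Rightarrow> ((nat \<Rightarrow> K) \<Rightarrow> K) \<Rightarrow> (nat \<Rightarrow> K) \<Rightarrow> K" where
  "Dk n k f = (THE g. g \<in> Lam n \<and> (\<forall>x. inj_on x {..<n} \<longrightarrow> g x = Dform n k f x))"

text \<open>the algebra homomorphism D : Lambda_n -> End(Lambda_n) with D(e_k) = D_k
  (made extensional: zero outside Lambda_n)\<close>
definition is_Dhom :: "nat \<Rightarrow> (((nat \<Rightarrow> K) \<Rightarrow> K) \<Rightarrow> ((nat \<Rightarrow> K) \<Rightarrow> K) \<Rightarrow> (nat \<Rightarrow> K) \<Rightarrow> K) \<Rightarrow> bool" where
  "is_Dhom n D \<longleftrightarrow>
     (\<forall>g\<in>Lam n. \<forall>f\<in>Lam n. D g f \<in> Lam n) \<and>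
     (\<forall>g\<in>Lam n. \<forall>f. f \<notin> Lam n \<longrightarrow> D g f = (\<lambda>_. 0)) \<and>
     (\<forall>g. g \<notin> Lam n \<longrightarrow> D g = (\<lambda>_ _. 0)) \<and>
     (\<forall>g\<in>Lam n. \<forall>f\<in>Lam n. \<forall>h\<in>Lam n. D g (\<lambda>x. f x + h x) = (\<lambda>x. D g f x + D g h x)) \<and>
     (\<forall>g\<in>Lam n. \<forall>f\<in>Lam n. \<forall>c. D g (\<lambda>x. c * f x) = (\<lambda>x. c * D g f x)) \<and>
     (\<forall>g1\<in>Lam n. \<forall>g2\<in>Lam n. \<forall>f\<in>Lam n. D (\<lambda>x. g1 x + g2 x) f = (\<lambda>x. D g1 f x + D g2 f x)) \<and>
     (\<forall>g\<in>Lam n. \<forall>f\<in>Lam n. \<forall>c. D (\<lambda>x. c * g x) f = (\<lambda>x. c * D g f x)) \<and>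
     (\<forall>g1\<in>Lam n. \<forall>g2\<in>Lam n. \<forall>f\<in>Lam n. D (\<lambda>x. g1 x * g2 x) f = D g1 (D g2 f)) \<and>
     (\<forall>f\<in>Lam n. D (\<lambda>_. 1) f = f) \<and>
     (\<forall>k\<in>{1..n}. \<forall>f\<in>Lam n. D (elem n k) f = Dk n k f)"

definition Dop :: "nat \<Rightarrow> ((nat \<Rightarrow> K) \<Rightarrow> K) \<Rightarrow> ((nat \<Rightarrow> K) \<Rightarrow> K) \<Rightarrow> (nat \<Rightarrow> K) \<Rightarrow> K" where
  "Dop n = (THE D. is_Dhom n D)"

definition pairing :: "nat \<Rightarrow> ((nat \<Rightarrow> K) \<Rightarrow> K) \<Rightarrow> ((nat \<Rightarrow> K) \<Rightarrow> K) \<Rightarrow> K" where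
  "pairing n g f = Dop n g f (hat n zero_part)"

definition Pmac :: "nat \<Rightarrow> (nat \<Rightarrow> nat) \<Rightarrow> (nat \<Rightarrow> K) \<Rightarrow> K" where
  "Pmac n la = (THE P. P \<in> Lam n \<and>
      (\<forall>k\<in>{1..n}. Dk n k P = (\<lambda>x. elem n k (hat n la) * P x)) \<and>
      (\<exists>b. P = (\<lambda>x. mono n la x +
              (\<Sum>mu\<in>{mu\<in>Par n. dom_le n mu la \<and> mu \<noteq> la}. b mu * mono n mu x))))"

definition Iint :: "nat \<Rightarrow> ((nat \<Rightarrow> nat) \<Rightarrow> (nat \<Rightarrow> nat) \<Rightarrow> bool) \<Rightarrow> (nat \<Rightarrow> nat) \<Rightarrow> (nat \<Rightarrow> K) \<Rightarrow> K" where
  "Iint n lt mu = (THE I. I \<in> Lam n \<and>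
      (\<exists>a. I = (\<lambda>x. mono n mu x + (\<Sum>la\<in>{la\<in>Par n. lt la mu}. a la * mono n la x))) \<and>
      (\<forall>la\<in>Par n. lt la mu \<longrightarrow> I (hat n la) = 0))"

definition conjp :: "(nat \<Rightarrow> nat) \<Rightarrow> nat \<Rightarrow> nat" where
  "conjp mu j = card {i. j < mu i}"

definition Dmu :: "nat \<Rightarrow> (nat \<Rightarrow> nat) \<Rightarrow> ((nat \<Rightarrow> K) \<Rightarrow> K) \<Rightarrow> (nat \<Rightarrow> K) \<Rightarrow> K" where
  "Dmu n mu f = foldr (\<lambda>j h. Dk n (conjp mu j) h) [0..<mu 0] f"

definition ccoef :: "nat \<Rightarrow> (nat \<Rightarrow> nat) \<Rightarrow> (nat \<Rightarrow> nat) \<Rightarrow> K" where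
  "ccoef n mu = (THE c. (\<forall>nu. \<not> (nu \<in> Par n \<and> dom_le n nu mu) \<longrightarrow> c nu = 0) \<and>
      (\<forall>f\<in>Lam n. Dmu n mu f (hat n zero_part) =
          (\<Sum>nu\<in>{nu\<in>Par n. dom_le n nu mu}. c nu * f (hat n nu))))"

definition admissible_order :: "nat \<Rightarrow> ((nat \<Rightarrow> nat) \<Rightarrow> (nat \<Rightarrow> nat) \<Rightarrow> bool) \<Rightarrow> bool" where
  "admissible_order n lt \<longleftrightarrow>
     (\<forall>la\<in>Par n. \<not> lt la la) \<and>
     (\<forall>la\<in>Par n. \<forall>mu\<in>Par n. \<forall>nu\<in>Par n. lt la mu \<longrightarrow> lt mu nu \<longrightarrow> lt la nu) \<and>
     (\<forall>la\<in>Par n. \<forall>mu\<in>Par n. la \<noteq> mu \<longrightarrow> lt la mu \<or> lt mu la) \<and>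
     (\<forall>la\<in>Par n. \<forall>mu\<in>Par n. psize n la < psize n mu \<longrightarrow> lt la mu) \<and>
     (\<forall>la\<in>Par n. \<forall>mu\<in>Par n. dom_le n la mu \<and> la \<noteq> mu \<longrightarrow> lt la mu)"

end

theory Submission
  imports Defs "HOL-Library.Function_Algebras" "HOL-Computational_Algebra.Polynomial_Factorial"
begin

text \<open>
  The operators \<open>D k\<close> are triangular in the monomial basis with respect to dominance and commute with
  \<open>D 1\<close>, whose eigenvalues \<open>e 1 (hat \<lambda>)\<close> are distinct; hence the Macdonald polynomials are a joint
  eigenbasis and \<open>\<langle>g, P \<lambda>\<rangle> = g (hat \<lambda>) P \<lambda> (hat 0)\<close>. Since \<open>I \<nu>\<close> is \<open>P \<nu>\<close> plus a combination of
  \<open>P \<lambda>\<close> with \<open>\<lambda>\<close> below \<open>\<nu>\<close>, and \<open>I \<mu>\<close> vanishes at \<open>hat \<lambda>\<close> for \<open>\<lambda>\<close> below \<open>\<mu>\<close>, this settles the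
  pairing of \<open>I \<mu>\<close> with \<open>I \<nu>\<close> whenever \<open>\<nu>\<close> does not exceed \<open>\<mu>\<close>.
  On the other hand \<open>I \<mu>\<close> is the product of the elementary polynomials indexed by the columns of \<open>\<mu>\<close>
  plus lower such products, and on the lattice of points \<open>hat \<lambda>\<close> the operators \<open>D k\<close> only add
  vertical strips, so \<open>\<langle>I \<mu>, f\<rangle>\<close> is \<open>c \<mu> \<mu> f (hat \<mu>)\<close> plus a combination of values of \<open>f\<close> at
  \<open>hat \<lambda>\<close> with \<open>\<lambda>\<close> below \<open>\<mu>\<close>; this settles the case where \<open>\<mu>\<close> does not exceed \<open>\<nu>\<close>.
  That the conditions defining \<open>I\<close> and \<open>c\<close> determine them uniquely comes down to the
  nonsingularity of the matrices \<open>m \<lambda> (hat \<nu>)\<close>, which is seen from their degrees in \<open>q\<close>.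
\<close>

section \<open>Partitions and their rearrangements\<close>

text \<open>Polynomials are functions on K^n here, and two of them are compared only at the points
  \<open>hat n nu\<close>, whose coordinates are distinct, so the formula with denominators can be
  used directly there. That D_k preserves symmetric polynomials rests on one fact: the power of t
  and the product attached to a subset S are together a ratio of two Vandermonde products, at x
  scaled by t on S and at x. After multiplication by the Vandermonde, D_k acts on exponents through
  e_k of \<open>hat\<close>, and triangularity becomes a statement about sorting exponents.
  Commuting with D_1 is enough because its spectrum is simple: an error term strictly below la that
  has the eigenvalue of la must vanish. D(g) is then realised as the operator multiplying P_la by
  g(hat la), which makes the homomorphism laws pointwise. Both evaluations of the pairing apply when
  mu = nu, and this overlap produces the two forms of the diagonal value.\<close>

lemma ParD: "la \<in> Par n \<Longrightarrow> i \<le> j \<Longrightarrow> la j \<le> la i"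
  by (auto simp: Par_def)

lemma Par_zero: "la \<in> Par n \<Longrightarrow> n \<le> i \<Longrightarrow> la i = 0"
  by (auto simp: Par_def)

text \<open>Peeling off the largest index m of S works because k + 1 distinct naturals have maximum
  at least k, so f m is at most f k.\<close>

lemma antimono_sum_le:
  fixes f :: "nat \<Rightarrow> nat"
  assumes "\<And>i j. i \<le> j \<Longrightarrow> f j \<le> f i" and "finite S"
  shows "sum f S \<le> (\<Sum>i<card S. f i)"
  using assms(2)
proof (induction "card S" arbitrary: S)
  case (Suc k)
  define m where "m = Max S"
  have m: "m \<in> S" using Suc.hyps(2) Suc.prems unfolding m_def
    by (metis Max_in card.empty nat.distinct(1))
  have "S \<subseteq> {..m}" using Suc.prems by (auto simp: m_def)
  then have "card S \<le> Suc m" using card_mono[of "{..m}" S] by simp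
  then have km: "k \<le> m" using Suc.hyps(2) by simp
  have c: "card (S - {m}) = k" using m Suc by simp
  then have "sum f (S - {m}) \<le> (\<Sum>i<k. f i)"
    using Suc.hyps(1)[of "S - {m}"] Suc.prems by simp
  moreover have "sum f S = f m + sum f (S - {m})" using m Suc.prems by (simp add: sum.remove)
  ultimately show ?case using assms(1)[OF km] Suc.hyps(2)[symmetric] by simp
qed simp

lemma rearr_self: "la \<in> rearr n la"
  unfolding rearr_def using permutes_id by fastforce

lemma rearr_comp: "al \<in> rearr n la \<Longrightarrow> \<sigma> permutes {..<n} \<Longrightarrow> al \<circ> \<sigma> \<in> rearr n la"
  unfolding rearr_def mem_Collect_eq by (metis comp_assoc permutes_compose)

lemma finite_rearr: "finite (rearr n la)"
proof -
  have "rearr n la = (\<lambda>\<sigma>. la \<circ> \<sigma>) ` {\<sigma>. \<sigma> permutes {..<n}}"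
    by (auto simp: rearr_def)
  then show ?thesis by (simp add: finite_permutations)
qed

lemma rearr_comp_bij:
  assumes "\<sigma> permutes {..<n}"
  shows "bij_betw (\<lambda>al. al \<circ> \<sigma>) (rearr n la) (rearr n la)"
proof (rule bij_betwI[where g = "\<lambda>al. al \<circ> inv \<sigma>"])
  show "(\<lambda>al. al \<circ> \<sigma>) \<in> rearr n la \<rightarrow> rearr n la"
    "(\<lambda>al. al \<circ> inv \<sigma>) \<in> rearr n la \<rightarrow> rearr n la"
    using assms permutes_inv rearr_comp by blast+
qed (simp_all add: comp_assoc permutes_inv_o[OF assms])

lemma rearr_sym: "al \<in> rearr n la \<Longrightarrow> la \<in> rearr n al"
proof -
  assume "al \<in> rearr n la"
  then obtain \<sigma> where s: "\<sigma> permutes {..<n}" "al = la \<circ> \<sigma>" by (auto simp: rearr_def)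
  then have "la = al \<circ> inv \<sigma>" by (simp add: comp_assoc permutes_inv_o)
  then show ?thesis using s(1) permutes_inv by (auto simp: rearr_def)
qed

lemma rearr_trans: "al \<in> rearr n be \<Longrightarrow> be \<in> rearr n la \<Longrightarrow> al \<in> rearr n la"
  unfolding rearr_def mem_Collect_eq by (metis comp_assoc permutes_compose)

lemma rearr_outside: "al \<in> rearr n la \<Longrightarrow> \<not> i < n \<Longrightarrow> al i = la i"
  unfolding rearr_def by (auto simp: permutes_def)

lemma rearr_sum: "al \<in> rearr n la \<Longrightarrow> (\<Sum>i<n. g (al i)) = (\<Sum>i<n. g (la i))"
proof -
  assume "al \<in> rearr n la"
  then obtain \<sigma> where s: "\<sigma> permutes {..<n}" "al = la \<circ> \<sigma>" by (auto simp: rearr_def)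
  show ?thesis using sum.permute[OF s(1), of "\<lambda>i. g (la i)"] by (simp add: s(2) o_def)
qed

text \<open>The source of the dominance estimates below: entries of a rearrangement at distinct
  places are entries of \<open>la\<close> at distinct places, hence bounded in sum by the first
  ones.\<close>

lemma rearr_sum_le:
  assumes "la \<in> Par n" "al \<in> rearr n la" "S \<subseteq> {..<n}"
  shows "sum al S \<le> (\<Sum>i<card S. la i)"
proof -
  obtain \<sigma> where s: "\<sigma> permutes {..<n}" "al = la \<circ> \<sigma>" using assms by (auto simp: rearr_def)
  have inj: "inj_on \<sigma> S" by (rule inj_on_subset[OF permutes_inj[OF s(1)]]) simp
  have "sum al S = sum la (\<sigma> ` S)" using s(2) sum.reindex[OF inj, of la] by (simp add: o_def)
  also have "\<dots> \<le> (\<Sum>i<card (\<sigma> ` S). la i)"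
    using assms finite_subset[OF assms(3)] by (intro antimono_sum_le) (auto simp: ParD)
  finally show ?thesis by (simp add: card_image inj)
qed

lemma sum_eq_imp_eq:
  fixes f g :: "nat \<Rightarrow> nat"
  assumes "\<And>k. k \<le> n \<Longrightarrow> (\<Sum>i<k. f i) = (\<Sum>i<k. g i)" "i < n"
  shows "f i = g i"
  using assms(1)[of i] assms(1)[of "Suc i"] assms(2) by simp

lemma dom_le_refl: "dom_le n la la"
  by (simp add: dom_le_def)

lemma dom_le_trans: "dom_le n la mu \<Longrightarrow> dom_le n mu nu \<Longrightarrow> dom_le n la nu"
  unfolding dom_le_def by (metis order_trans)

lemma dom_le_antisym:
  assumes "la \<in> Par n" "mu \<in> Par n" "dom_le n la mu" "dom_le n mu la"
  shows "la = mu"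
proof
  fix i
  show "la i = mu i"
  proof (cases "i < n")
    case True
    have "(\<Sum>i<k. la i) = (\<Sum>i<k. mu i)" if "k \<le> n" for k
      using assms(3,4) that by (simp add: dom_le_def le_antisym)
    then show ?thesis using True by (rule sum_eq_imp_eq)
  qed (use assms in \<open>simp add: Par_zero\<close>)
qed

text \<open>Principal dominance ideals. Triangularity will always mean membership in the span of the
  monomial functions of such an ideal.\<close>

definition below :: "nat \<Rightarrow> (nat \<Rightarrow> nat) \<Rightarrow> (nat \<Rightarrow> nat) set" where
  "below n la = {mu \<in> Par n. dom_le n mu la}"

definition sbelow :: "nat \<Rightarrow> (nat \<Rightarrow> nat) \<Rightarrow> (nat \<Rightarrow> nat) set" where
  "sbelow n la = {mu \<in> Par n. dom_le n mu la \<and> mu \<noteq> la}"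

lemma sbelow_subset: "sbelow n la \<subseteq> below n la"
  by (auto simp: below_def sbelow_def)

lemma below_subset_Par: "below n la \<subseteq> Par n"
  by (auto simp: below_def)

lemma sbelow_subset_Par: "sbelow n la \<subseteq> Par n"
  by (auto simp: sbelow_def)

lemma below_eq_insert: "la \<in> Par n \<Longrightarrow> below n la = insert la (sbelow n la)"
  by (auto simp: below_def sbelow_def dom_le_refl)

lemma below_sbelow: "la \<in> Par n \<Longrightarrow> mu \<in> sbelow n la \<Longrightarrow> below n mu \<subseteq> sbelow n la"
  unfolding below_def sbelow_def using dom_le_trans dom_le_antisym by blast

lemma below_mono: "mu \<in> below n la \<Longrightarrow> below n mu \<subseteq> below n la"
  unfolding below_def using dom_le_trans by blast

lemma finite_bounded_parts: "finite {la \<in> Par n. psize n la \<le> d}"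
proof (rule finite_subset)
  show "{la \<in> Par n. psize n la \<le> d} \<subseteq> {la. la ` {..<n} \<subseteq> {..d} \<and> (\<forall>i. i \<notin> {..<n} \<longrightarrow> la i = 0)}"
  proof (safe, goal_cases)
    case (1 la i j)
    have "la j \<le> psize n la" unfolding psize_def using 1 by (intro member_le_sum) auto
    then show ?case using 1 by simp
  next
    case (2 la i)
    then show ?case using Par_zero[of la n i] by (cases "i < n") auto
  qed
  have "{la. la ` {..<n} \<subseteq> {..d} \<and> (\<forall>i. i \<notin> {..<n} \<longrightarrow> la i = (0::nat))}
     = {la. \<forall>i. (i \<in> {..<n} \<longrightarrow> la i \<in> {..d}) \<and> (i \<notin> {..<n} \<longrightarrow> la i = 0)}"
    unfolding image_subset_iff by blast
  then show "finite {la. la ` {..<n} \<subseteq> {..d} \<and> (\<forall>i. i \<notin> {..<n} \<longrightarrow> la i = (0::nat))}"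
    using finite_set_of_finite_funs[of "{..<n}" "{..d}" 0] by simp
qed

lemma finite_below: "finite (below n la)"
  by (rule finite_subset[OF _ finite_bounded_parts[of n "psize n la"]])
    (auto simp: below_def dom_le_def)

lemma finite_sbelow: "finite (sbelow n la)"
  by (rule finite_subset[OF sbelow_subset finite_below])

lemma zero_part_Par: "zero_part \<in> Par n"
  by (simp add: Par_def zero_part_def)

subsection \<open>Conjugation and the rearrangement inequality\<close>

lemma conjp_set:
  assumes "nu \<in> Par n"
  shows "{i. j < nu i} = {..<conjp nu j}" "conjp nu j \<le> n"
proof -
  have sub: "{i. j < nu i} \<subseteq> {..<n}" using Par_zero[OF assms] by (metis lessThan_iff mem_Collect_eq not_less not_less_zero subsetI)
  then have fin: "finite {i. j < nu i}" by (rule finite_subset) simp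
  show "conjp nu j \<le> n" unfolding conjp_def using card_mono[OF _ sub] by simp
  have down: "{..i} \<subseteq> {i. j < nu i}" if "j < nu i" for i
    using that ParD[OF assms] by (auto intro: less_le_trans)
  have "\<exists>k. {i. j < nu i} = {..<k}"
  proof (cases "{i. j < nu i} = {}")
    case False
    define m where "m = Max {i. j < nu i}"
    have "m \<in> {i. j < nu i}" unfolding m_def using fin False by (rule Max_in)
    then have "{i. j < nu i} = {..m}"
      using down[of m] fin by (auto simp: m_def)
    then show ?thesis by (metis lessThan_Suc_atMost)
  qed (auto intro: exI[of _ 0])
  then obtain k where "{i. j < nu i} = {..<k}" ..
  then show "{i. j < nu i} = {..<conjp nu j}" by (simp add: conjp_def)
qed

lemma conjp_less_iff: "nu \<in> Par n \<Longrightarrow> i < conjp nu j \<longleftrightarrow> j < nu i"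
  using conjp_set(1)[of nu n j] by (auto simp: set_eq_iff)

lemma card_less_nu: "nu \<in> Par n \<Longrightarrow> card {j. j < nu 0 \<and> i < conjp nu j} = nu i"
proof -
  assume nu: "nu \<in> Par n"
  have "{j. j < nu 0 \<and> i < conjp nu j} = {..<nu i}"
    using ParD[OF nu, of 0 i] by (auto simp: conjp_less_iff[OF nu])
  then show ?thesis by simp
qed

text \<open>Counting by columns of \<open>nu\<close> instead of rows: scalar products with
  \<open>nu\<close> become sums of partial sums of \<open>al\<close>, to which
  \<open>rearr_sum_le\<close> applies.\<close>

lemma abel_sum:
  assumes "nu \<in> Par n"
  shows "(\<Sum>i<n. al i * nu i) = (\<Sum>j<nu 0. \<Sum>i<conjp nu j. al i)"
proof -
  have "(\<Sum>i<n. al i * nu i) = (\<Sum>i<n. \<Sum>j<nu 0. if i < conjp nu j then al i else 0)"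
  proof (rule sum.cong[OF refl])
    fix i assume "i \<in> {..<n}"
    have "(\<Sum>j<nu 0. if i < conjp nu j then al i else 0) = (\<Sum>j\<in>{j. j < nu 0 \<and> i < conjp nu j}. al i)"
      by (intro sum.mono_neutral_cong_right) auto
    then show "al i * nu i = (\<Sum>j<nu 0. if i < conjp nu j then al i else 0)"
      by (simp add: card_less_nu[OF assms])
  qed
  also have "\<dots> = (\<Sum>j<nu 0. \<Sum>i<n. if i < conjp nu j then al i else 0)" by (rule sum.swap)
  also have "\<dots> = (\<Sum>j<nu 0. \<Sum>i<conjp nu j. al i)"
  proof (rule sum.cong[OF refl])
    fix j
    show "(\<Sum>i<n. if i < conjp nu j then al i else 0) = (\<Sum>i<conjp nu j. al i)"
      using conjp_set(2)[OF assms, of j] by (intro sum.mono_neutral_cong_right) auto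
  qed
  finally show ?thesis .
qed

lemma rearrangement_le:
  assumes "la \<in> Par n" "nu \<in> Par n" "al \<in> rearr n la"
  shows "(\<Sum>i<n. al i * nu i) \<le> (\<Sum>i<n. la i * nu i)"
  unfolding abel_sum[OF assms(2)]
proof (rule sum_mono)
  fix j
  show "(\<Sum>i<conjp nu j. al i) \<le> (\<Sum>i<conjp nu j. la i)"
    using rearr_sum_le[OF assms(1,3), of "{..<conjp nu j}"] conjp_set(2)[OF assms(2), of j] by auto
qed

definition stair :: "nat \<Rightarrow> nat \<Rightarrow> nat" where "stair n = (\<lambda>i. n - 1 - i)"

lemma stair_Par: "stair n \<in> Par n"
  by (auto simp: stair_def Par_def)

text \<open>The equality case of the rearrangement inequality. The columns of \<open>stair n\<close>
  have lengths n - 1, ..., 1, each once, so equality forces every partial sum of \<open>al\<close>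
  to agree with that of \<open>la\<close>.\<close>

lemma rearrangement_stair_eq:
  assumes "la \<in> Par n" "al \<in> rearr n la" "(\<Sum>i<n. al i * stair n i) = (\<Sum>i<n. la i * stair n i)"
  shows "al = la"
proof -
  have le: "(\<Sum>i<k. al i) \<le> (\<Sum>i<k. la i)" if "k \<le> n" for k
    using rearr_sum_le[OF assms(1,2), of "{..<k}"] that by auto
  have cj: "conjp (stair n) j = n - 1 - j" for j
  proof -
    have "{i. j < stair n i} = {..<n - 1 - j}" by (auto simp: stair_def)
    then show ?thesis by (simp add: conjp_def)
  qed
  have *: "(\<Sum>j<n-1. \<Sum>i<n-1-j. al i) = (\<Sum>j<n-1. \<Sum>i<n-1-j. la i)"
    using assms(3) unfolding abel_sum[OF stair_Par] cj by (simp add: stair_def)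
  have eq: "(\<Sum>i<n-1-j. al i) = (\<Sum>i<n-1-j. la i)" if "j < n - 1" for j
  proof (rule ccontr)
    assume "(\<Sum>i<n-1-j. al i) \<noteq> (\<Sum>i<n-1-j. la i)"
    then have "(\<Sum>i<n-1-j. al i) < (\<Sum>i<n-1-j. la i)" using le[of "n-1-j"] by simp
    then have "(\<Sum>j<n-1. \<Sum>i<n-1-j. al i) < (\<Sum>j<n-1. \<Sum>i<n-1-j. la i)"
      using that le by (intro sum_strict_mono_ex1) auto
    with * show False by simp
  qed
  have all: "(\<Sum>i<k. al i) = (\<Sum>i<k. la i)" if "k \<le> n" for k
  proof (cases "k = n \<or> k = 0")
    case True
    \<comment> \<open>The full sum is not a column of \<open>stair n\<close>; it agrees because
      rearranging preserves the size.\<close>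
    then show ?thesis using rearr_sum[OF assms(2), of "\<lambda>x. x"] by auto
  next
    case False
    then show ?thesis using eq[of "n - 1 - k"] that by auto
  qed
  show ?thesis
  proof
    fix i show "al i = la i"
      using sum_eq_imp_eq[of n al la i, OF all] rearr_outside[OF assms(2), of i] by blast
  qed
qed

lemma sorting_permutation:
  fixes f :: "nat \<Rightarrow> nat"
  obtains \<sigma> where "\<sigma> permutes {..<n}" "\<And>i j. i \<le> j \<Longrightarrow> j < n \<Longrightarrow> f (\<sigma> j) \<le> f (\<sigma> i)"
proof -
  define xs where "xs = map f [0..<n]"
  define ys where "ys = rev (sort xs)"
  have "mset ys = mset xs" by (simp add: ys_def)
  then obtain p where p: "p permutes {..<length xs}" "permute_list p xs = ys"
    by (rule mset_eq_permutation)
  have len: "length xs = n" by (simp add: xs_def)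
  have ysi: "ys ! i = f (p i)" if "i < n" for i
    using that permutes_in_image[OF p(1), of i] permute_list_nth[OF p(1), of i]
    by (simp add: p(2) len) (simp add: xs_def)
  have "sorted_wrt (\<ge>) ys" by (simp add: ys_def sorted_wrt_rev)
  then have "ys ! j \<le> ys ! i" if "i \<le> j" "j < n" for i j
    using that sorted_wrt_nth_less[of "(\<ge>)" ys i j] len by (cases "i = j") (auto simp: ys_def)
  then show thesis using that[of p] p len ysi by auto
qed

lemma exists_sorted_rearr:
  assumes "\<And>i. n \<le> i \<Longrightarrow> al i = 0"
  obtains \<sigma> where "\<sigma> permutes {..<n}" "al \<circ> \<sigma> \<in> Par n"
proof -
  obtain \<sigma> where s: "\<sigma> permutes {..<n}" "\<And>i j. i \<le> j \<Longrightarrow> j < n \<Longrightarrow> al (\<sigma> j) \<le> al (\<sigma> i)"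
    using sorting_permutation[of n al] by metis
  have "\<sigma> j = j" if "n \<le> j" for j using s(1) that by (auto simp: permutes_def)
  then have "al (\<sigma> j) = 0" if "n \<le> j" for j using assms that by simp
  moreover from this have "al (\<sigma> j) \<le> al (\<sigma> i)" if "i \<le> j" for i j
    using s(2)[OF that] by (cases "j < n") auto
  ultimately have "al \<circ> \<sigma> \<in> Par n" by (simp add: Par_def)
  then show thesis using that s(1) by blast
qed

lemma rearr_Par_unique:
  assumes "la \<in> Par n" "mu \<in> Par n" "la \<in> rearr n mu"
  shows "la = mu"
proof -
  have "psize n la = psize n mu" using rearr_sum[OF assms(3), of "\<lambda>x. x"] by (simp add: psize_def)
  moreover have "(\<Sum>i<k. la i) \<le> (\<Sum>i<k. mu i)" if "k \<le> n" for k
    using rearr_sum_le[OF assms(2,3), of "{..<k}"] that by auto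
  moreover have "(\<Sum>i<k. mu i) \<le> (\<Sum>i<k. la i)" if "k \<le> n" for k
    using rearr_sum_le[OF assms(1) rearr_sym[OF assms(3)], of "{..<k}"] that by auto
  ultimately show ?thesis by (intro dom_le_antisym[OF assms(1,2)]) (auto simp: dom_le_def)
qed

section \<open>Unisolvence of the points hat\<close>

lemma to_fract_power: "to_fract (x ^ k) = to_fract x ^ k"
  by (induction k) auto

lemma to_fract_prod: "to_fract (prod f A) = (\<Prod>x\<in>A. to_fract (f x))"
  by (induction A rule: infinite_finite_induct) auto

lemma finite_common_denominator:
  fixes a :: "'b \<Rightarrow> 'a::idom fract"
  assumes "finite J"
  obtains S b where "S \<noteq> 0" "\<And>k. k \<in> J \<Longrightarrow> to_fract (b k) = to_fract S * a k"
proof -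
  have "\<exists>S b. S \<noteq> 0 \<and> (\<forall>k\<in>J. to_fract (b k) = to_fract S * a k)"
    using assms
  proof (induction J)
    case empty
    show ?case by (intro exI[of _ 1]) auto
  next
    case (insert j J)
    then obtain S b where S: "S \<noteq> 0" "\<forall>k\<in>J. to_fract (b k) = to_fract S * a k" by blast
    obtain p s where ps: "a j = Fract p s" "s \<noteq> 0" by (cases "a j") auto
    have e: "to_fract s * a j = to_fract p" using ps by (simp add: Fract_conv_to_fract)
    have "\<forall>k\<in>insert j J. to_fract (if k = j then S * p else s * b k) = to_fract (s * S) * a k"
      using S insert.hyps e by (auto simp: mult_ac)
    then show ?case using S ps by (intro exI[of _ "s * S"] exI[of _ "\<lambda>k. if k = j then S * p else s * b k"]) simp
  qed
  then show thesis using that by blast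
qed

text \<open>The outer variable is t, so evaluation at the constant \<open>[:c:]\<close> leaves a
  polynomial in q whose degree can be studied. Positivity of c is what rules out cancellation in
  \<open>coeff_mono_hat_poly\<close>.\<close>

lemma exists_positive_nonroot:
  fixes P :: "rat poly poly"
  assumes "P \<noteq> 0"
  obtains c :: rat where "c > 0" "poly P [:c:] \<noteq> 0"
proof -
  have "finite {x. poly P x = 0}" using assms by (rule poly_roots_finite)
  moreover have "infinite ((\<lambda>c::rat. [:c:]) ` {0<..})"
    using infinite_Ioi[of "0::rat"] by (simp add: finite_image_iff inj_on_def)
  ultimately have "\<not> (\<lambda>c::rat. [:c:]) ` {0<..} \<subseteq> {x. poly P x = 0}"
    using finite_subset by blast
  then show thesis using that by auto
qed

lemma coeff_mult_top:
  fixes p q :: "'a::comm_semiring_0 poly"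
  assumes "degree q \<le> m"
  shows "coeff (p * q) (degree p + m) = coeff p (degree p) * coeff q m"
proof -
  have "coeff (p * q) (degree p + m) = (\<Sum>i\<le>degree p + m. coeff p i * coeff q (degree p + m - i))"
    by (rule coeff_mult)
  also have "\<dots> = (\<Sum>i\<in>{degree p}. coeff p i * coeff q (degree p + m - i))"
  proof (rule sum.mono_neutral_right)
    show "\<forall>i\<in>{..degree p + m} - {degree p}. coeff p i * coeff q (degree p + m - i) = 0"
    proof
      fix i assume "i \<in> {..degree p + m} - {degree p}"
      then consider "i > degree p" | "degree p + m - i > degree q" using assms by force
      then show "coeff p i * coeff q (degree p + m - i) = 0"
        by cases (auto simp: coeff_eq_0)
    qed
  qed auto
  finally show ?thesis by simp
qed

text \<open>At the index maximising \<open>2 deg g + d\<close> the diagonal term strictly dominates the degree in \<open>q\<close>.\<close>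

lemma dominant_diagonal_kernel:
  fixes a :: "'b \<Rightarrow> K" and M :: "'b \<Rightarrow> 'b \<Rightarrow> rat poly poly" and d :: "'b \<Rightarrow> 'b \<Rightarrow> nat"
  assumes fin: "finite J"
    and d: "\<And>k l. k \<in> J \<Longrightarrow> l \<in> J \<Longrightarrow> k \<noteq> l \<Longrightarrow> 2 * d k l < d k k + d l l"
    and deg: "\<And>k l c. k \<in> J \<Longrightarrow> l \<in> J \<Longrightarrow> c > 0 \<Longrightarrow> degree (poly (M k l) [:c:]) \<le> d k l"
    and top: "\<And>k c. k \<in> J \<Longrightarrow> c > 0 \<Longrightarrow> coeff (poly (M k k) [:c:]) (d k k) \<noteq> 0"
    and zero: "\<And>l. l \<in> J \<Longrightarrow> (\<Sum>k\<in>J. a k * to_fract (M k l)) = 0"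
    and k: "k \<in> J"
  shows "a k = 0"
proof (rule ccontr)
  assume ak: "a k \<noteq> 0"
  obtain S b where S: "S \<noteq> 0" and b: "\<And>k. k \<in> J \<Longrightarrow> to_fract (b k) = to_fract S * a k"
    using finite_common_denominator[OF fin] by metis
  define J' where "J' = {k \<in> J. b k \<noteq> 0}"
  have J': "finite J'" "J' \<subseteq> J" using fin by (auto simp: J'_def)
  have "k \<in> J'"
  proof -
    have "to_fract (b k) \<noteq> 0" using b[OF k] S ak by simp
    then show ?thesis using k by (auto simp: J'_def)
  qed
  have z: "(\<Sum>k\<in>J'. b k * M k l) = 0" if "l \<in> J" for l
  proof -
    have "to_fract (\<Sum>k\<in>J. b k * M k l) = to_fract S * (\<Sum>k\<in>J. a k * to_fract (M k l))"
      by (simp add: sum_distrib_left b mult.assoc)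
    also have "\<dots> = 0" using zero[OF that] by simp
    finally have "(\<Sum>k\<in>J. b k * M k l) = 0" by (simp only: to_fract_eq_0_iff)
    then show ?thesis using fin by (subst sum.mono_neutral_left[of J]) (auto simp: J'_def)
  qed
  \<comment> \<open>A single value of t has to keep all surviving coefficients nonzero, hence the
    product.\<close>
  have "(\<Prod>k\<in>J'. b k) \<noteq> 0" using J' by (simp add: J'_def)
  then obtain c :: rat where c: "c > 0" "poly (\<Prod>k\<in>J'. b k) [:c:] \<noteq> 0"
    by (rule exists_positive_nonroot)
  define g where "g k = poly (b k) [:c:]" for k
  have g: "g k \<noteq> 0" if "k \<in> J'" for k
    using c(2) J' that by (simp add: poly_prod g_def)
  define h where "h k = 2 * degree (g k) + d k k" for k
  have "Max (h ` J') \<in> h ` J'" using J'(1) \<open>k \<in> J'\<close> by (intro Max_in) auto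
  then obtain k0 where k0: "k0 \<in> J'" "Max (h ` J') = h k0" by auto
  have max: "h k \<le> h k0" if "k \<in> J'" for k
    using that J'(1) by (simp flip: k0(2))
  define N where "N = degree (g k0) + d k0 k0"
  define G where "G k = poly (M k k0) [:c:]" for k
  have "0 = poly (\<Sum>k\<in>J'. b k * M k k0) [:c:]" using z k0(1) J' by auto
  also have "\<dots> = (\<Sum>k\<in>J'. g k * G k)" by (simp add: poly_sum g_def G_def)
  finally have "0 = coeff (\<Sum>k\<in>J'. g k * G k) N" by simp
  also have "\<dots> = (\<Sum>k\<in>J'. coeff (g k * G k) N)" by (simp add: coeff_sum)
  also have "\<dots> = (\<Sum>k\<in>{k0}. coeff (g k * G k) N)"
  proof (rule sum.mono_neutral_right)
    show "\<forall>k\<in>J' - {k0}. coeff (g k * G k) N = 0"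
    proof
      fix k assume k: "k \<in> J' - {k0}"
      \<comment> \<open>By hypothesis on d, \<open>2 * degree (g k) + 2 * d k k0\<close> is strictly
        below \<open>h k + d k0 k0\<close>, and \<open>h k \<le> h k0\<close> bounds this by
        \<open>h k0 + d k0 k0 = 2 * N\<close>.\<close>
      have "2 * degree (g k * G k) \<le> 2 * (degree (g k) + d k k0)"
        using degree_mult_le[of "g k" "G k"] deg[of k k0 c] k k0(1) J' c by (force simp: G_def)
      also have "\<dots> < 2 * N" using max[of k] d[of k k0] k k0(1) J' by (auto simp: N_def h_def subset_iff)
      finally show "coeff (g k * G k) N = 0" by (simp add: coeff_eq_0)
    qed
  qed (use J' k0(1) in auto)
  also have "\<dots> = lead_coeff (g k0) * coeff (G k0) (d k0 k0)"
    using coeff_mult_top[of "G k0" "d k0 k0" "g k0"] deg[of k0 k0 c] k0(1) J' c by (auto simp: N_def G_def)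
  also have "\<dots> \<noteq> 0" using g[OF k0(1)] top[of k0 c] k0(1) J' c by (auto simp: G_def)
  finally show False by simp
qed

lemma prod_monom: "(\<Prod>i\<in>A. monom (f i) (g i)) = monom (\<Prod>i\<in>A. f i) (\<Sum>i\<in>A. g i)"
  by (induction A rule: infinite_finite_induct) (auto simp: mult_monom)

definition hat_poly :: "nat \<Rightarrow> (nat \<Rightarrow> nat) \<Rightarrow> nat \<Rightarrow> rat poly poly" where
  "hat_poly n la i = [:[:0, 1:]:] ^ la i * [:0, 1:] ^ (n - 1 - i)"

definition mono_hat_poly :: "nat \<Rightarrow> (nat \<Rightarrow> nat) \<Rightarrow> (nat \<Rightarrow> nat) \<Rightarrow> rat poly poly" where
  "mono_hat_poly n la nu = (\<Sum>al\<in>rearr n la. \<Prod>i<n. hat_poly n nu i ^ al i)"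

lemma qq_to_fract: "qq = to_fract [:[:0, 1:]:]" and tt_to_fract: "tt = to_fract [:0, 1:]"
  by (simp_all add: qq_def tt_def to_fract_def)

lemma hat_to_fract: "i < n \<Longrightarrow> hat n la i = to_fract (hat_poly n la i)"
  by (simp add: hat_def hat_poly_def qq_to_fract tt_to_fract to_fract_power)

lemma mono_hat_to_fract: "mono n la (hat n nu) = to_fract (mono_hat_poly n la nu)"
  by (simp add: mono_def mono_hat_poly_def to_fract_power to_fract_prod hat_to_fract)

text \<open>At t = c each rearrangement contributes a single power of q, whose exponent is its
  scalar product with \<open>nu\<close>. The degree bound that follows is therefore the
  rearrangement inequality.\<close>

lemma poly_mono_hat_poly:
  "poly (mono_hat_poly n la nu) [:c:] =
     (\<Sum>al\<in>rearr n la. monom (c ^ (\<Sum>i<n. (n - 1 - i) * al i)) (\<Sum>i<n. al i * nu i))"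
proof -
  have "(\<Prod>i<n. (poly (hat_poly n nu i) [:c:]) ^ al i) =
      monom (c ^ (\<Sum>i<n. (n - 1 - i) * al i)) (\<Sum>i<n. al i * nu i)" for al
  proof -
    have "poly (hat_poly n nu i) [:c:] ^ al i = monom (c ^ ((n - 1 - i) * al i)) (al i * nu i)" for i
    proof -
      have "poly (hat_poly n nu i) [:c:] = monom 1 (nu i) * [:c ^ (n - 1 - i):]"
        by (simp add: hat_poly_def monom_altdef poly_const_pow)
      also have "\<dots> = monom (c ^ (n - 1 - i)) (nu i)"
        by (simp add: smult_monom)
      finally show ?thesis by (simp add: monom_power mult.commute flip: power_mult)
    qed
    then have "(\<Prod>i<n. (poly (hat_poly n nu i) [:c:]) ^ al i) =
       (\<Prod>i<n. monom (c ^ ((n - 1 - i) * al i)) (al i * nu i))" by simp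
    also have "\<dots> = monom (\<Prod>i<n. c ^ ((n - 1 - i) * al i)) (\<Sum>i<n. al i * nu i)"
      by (rule prod_monom)
    finally show ?thesis by (simp add: power_sum)
  qed
  then show ?thesis by (simp add: mono_hat_poly_def poly_sum poly_prod)
qed

lemma degree_mono_hat_poly:
  assumes "la \<in> Par n" "nu \<in> Par n"
  shows "degree (poly (mono_hat_poly n la nu) [:c:]) \<le> (\<Sum>i<n. la i * nu i)"
  unfolding poly_mono_hat_poly
  by (intro degree_sum_le finite_rearr order_trans[OF degree_monom_le] rearrangement_le assms)

text \<open>All contributions are nonnegative, being powers of c > 0 or zero, and \<open>la\<close>
  itself contributes a positive one.\<close>

lemma coeff_mono_hat_poly:
  fixes c :: rat
  assumes "c > 0"
  shows "coeff (poly (mono_hat_poly n la la) [:c:]) (\<Sum>i<n. la i * la i) \<noteq> 0"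
proof -
  have "coeff (poly (mono_hat_poly n la la) [:c:]) (\<Sum>i<n. la i * la i) > 0"
    unfolding poly_mono_hat_poly coeff_sum coeff_monom using assms
    by (intro sum_pos2[OF finite_rearr rearr_self]) auto
  then show ?thesis by simp
qed

text \<open>Positivity of the squared Euclidean distance between \<open>ka\<close> and
  \<open>la\<close>; it is the hypothesis of \<open>dominant_diagonal_kernel\<close> for d the
  scalar product.\<close>

lemma sq_distance:
  assumes "ka \<in> Par n" "la \<in> Par n" "ka \<noteq> la"
  shows "2 * (\<Sum>i<n. ka i * la i) < (\<Sum>i<n. ka i * ka i) + (\<Sum>i<n. la i * la i)"
proof -
  obtain j where j: "ka j \<noteq> la j" using assms(3) by blast
  then have jn: "j < n" using assms(1,2) by (metis Par_zero not_less)
  have sq: "2 * (a * b) \<le> a * a + b * (b::nat)" for a b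
    using zero_le_square[of "int a - int b"] by (simp add: algebra_simps flip: of_nat_mult of_nat_add)
  have sq': "2 * (a * b) < a * a + b * (b::nat)" if "a \<noteq> b" for a b
  proof -
    have "0 < (int a - int b)\<^sup>2" using that by simp
    then show ?thesis by (simp add: power2_eq_square algebra_simps flip: of_nat_mult of_nat_add)
  qed
  have "(\<Sum>i<n. 2 * (ka i * la i)) < (\<Sum>i<n. ka i * ka i + la i * la i)"
    using j jn sq sq' by (intro sum_strict_mono_ex1 bexI[of _ j]) auto
  then show ?thesis by (simp add: sum.distrib sum_distrib_left)
qed

text \<open>J may be any finite set of partitions, not only an order ideal: the argument compares
  exponents pairwise. Supports of polynomials and initial segments of the order can thus be treated
  alike.\<close>

lemma mono_hat_kernel:
  assumes "finite J" "J \<subseteq> Par n" "\<And>nu. nu \<in> J \<Longrightarrow> (\<Sum>la\<in>J. a la * mono n la (hat n nu)) = 0" "la \<in> J"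
  shows "a la = 0"
  using assms(1) _ _ _ _ assms(4)
proof (rule dominant_diagonal_kernel[where d = "\<lambda>k l. \<Sum>i<n. k i * l i" and M = "\<lambda>k l. mono_hat_poly n k l"])
  fix l assume "l \<in> J"
  then show "(\<Sum>k\<in>J. a k * to_fract (mono_hat_poly n k l)) = 0"
    using assms(3) by (simp add: mono_hat_to_fract)
qed (use assms(2) in \<open>auto intro!: sq_distance degree_mono_hat_poly coeff_mono_hat_poly\<close>)

text \<open>The transposed statement, about functionals that are combinations of evaluations at
  points \<open>hat n nu\<close>; it yields the uniqueness of \<open>ccoef\<close>.\<close>

lemma mono_hat_kernel':
  assumes "finite J" "J \<subseteq> Par n" "\<And>la. la \<in> J \<Longrightarrow> (\<Sum>nu\<in>J. b nu * mono n la (hat n nu)) = 0" "nu \<in> J"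
  shows "b nu = 0"
  using assms(1) _ _ _ _ assms(4)
proof (rule dominant_diagonal_kernel[where d = "\<lambda>k l. \<Sum>i<n. k i * l i" and M = "\<lambda>k l. mono_hat_poly n l k"])
  fix l assume "l \<in> J"
  then show "(\<Sum>k\<in>J. b k * to_fract (mono_hat_poly n l k)) = 0"
    using assms(3) by (simp add: mono_hat_to_fract)
next
  fix k l c assume "k \<in> J" "l \<in> J"
  then show "degree (poly (mono_hat_poly n l k) [:c:]) \<le> (\<Sum>i<n. k i * l i)"
    using degree_mono_hat_poly[of l n k c] assms(2) by (auto simp: mult.commute)
qed (use assms(2) in \<open>auto intro!: sq_distance coeff_mono_hat_poly\<close>)

text \<open>Bordering argument: m_k plus the combination given by h vanishes at the points of J and
  takes the value D at the point of k. \<open>mono_hat_kernel\<close> makes D nonzero, so a multiple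
  of this function corrects the new equation without disturbing the old ones.\<close>

lemma mono_hat_solvable:
  assumes "finite J" "J \<subseteq> Par n"
  obtains a where "\<And>nu. nu \<in> J \<Longrightarrow> (\<Sum>la\<in>J. a la * mono n la (hat n nu)) = b nu"
proof -
  have "\<forall>b. \<exists>a. \<forall>nu\<in>J. (\<Sum>la\<in>J. a la * mono n la (hat n nu)) = b nu"
    using assms
  proof (induction J)
    case (insert k J)
    let ?m = "\<lambda>la nu. mono n la (hat n nu)"
    have IH: "\<exists>a. \<forall>nu\<in>J. (\<Sum>la\<in>J. a la * ?m la nu) = b nu" for b
      using insert.IH insert.prems by simp
    obtain h where h: "\<forall>nu\<in>J. (\<Sum>la\<in>J. h la * ?m la nu) = - ?m k nu"
      using IH[of "\<lambda>nu. - ?m k nu"] by (elim exE)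
    define D where "D = ?m k k + (\<Sum>la\<in>J. h la * ?m la k)"
    have e: "(\<Sum>la\<in>J. (h(k := 1)) la * ?m la nu) = (\<Sum>la\<in>J. h la * ?m la nu)" for nu
      using insert.hyps by (intro sum.cong) auto
    have "D \<noteq> 0"
    proof
      assume "D = 0"
      have z: "(\<Sum>la\<in>insert k J. (h(k := 1)) la * ?m la nu) = 0" if "nu \<in> insert k J" for nu
      proof -
        have "(\<Sum>la\<in>insert k J. (h(k := 1)) la * ?m la nu) = ?m k nu + (\<Sum>la\<in>J. h la * ?m la nu)"
          using insert.hyps e[of nu] by simp
        then show ?thesis using that h \<open>D = 0\<close> by (auto simp: D_def)
      qed
      have "(h(k := 1)) k = 0"
        by (rule mono_hat_kernel[of "insert k J" n "h(k := 1)" k, OF _ insert.prems z])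
          (use insert.hyps in simp_all)
      then show False by simp
    qed
    show ?case
    proof
      fix b :: "(nat \<Rightarrow> nat) \<Rightarrow> K"
      obtain a where a: "\<forall>nu\<in>J. (\<Sum>la\<in>J. a la * ?m la nu) = b nu" using IH[of b] by (elim exE)
      define s where "s = (b k - (\<Sum>la\<in>J. a la * ?m la k)) / D"
      define a' where "a' la = (if la = k then s else a la + s * h la)" for la
      have a': "(\<Sum>la\<in>insert k J. a' la * ?m la nu) =
          (\<Sum>la\<in>J. a la * ?m la nu) + s * (?m k nu + (\<Sum>la\<in>J. h la * ?m la nu))" for nu
      proof -
        have "(\<Sum>la\<in>J. a' la * ?m la nu) = (\<Sum>la\<in>J. (a la + s * h la) * ?m la nu)"
          using insert.hyps by (intro sum.cong) (auto simp: a'_def)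
        then show ?thesis using insert.hyps
          by (simp add: a'_def algebra_simps sum.distrib sum_distrib_left)
      qed
      have "(\<Sum>la\<in>insert k J. a' la * ?m la nu) = b nu" if "nu \<in> insert k J" for nu
      proof (cases "nu = k")
        case True
        then show ?thesis unfolding a' using \<open>D \<noteq> 0\<close> by (simp add: s_def flip: D_def)
      next
        case False
        then show ?thesis unfolding a' using a h that by simp
      qed
      then show "\<exists>a. \<forall>nu\<in>insert k J. (\<Sum>la\<in>insert k J. a la * ?m la nu) = b nu" by blast
    qed
  qed simp
  then show thesis using that by blast
qed

lemma LamE:
  assumes "f \<in> Lam n"
  obtains F c where "finite F" "F \<subseteq> Par n" "f = (\<lambda>x. \<Sum>la\<in>F. c la * mono n la x)"
  using assms by (auto simp: Lam_def)

section \<open>Symmetric polynomial functions\<close>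

text \<open>Named so that the span and basis theory of \<open>vector_space\<close> applies to all
  functions on K^n; \<open>Lam n\<close> then becomes the span \<open>msp n (Par n)\<close>.\<close>

definition scl :: "K \<Rightarrow> ((nat \<Rightarrow> K) \<Rightarrow> K) \<Rightarrow> (nat \<Rightarrow> K) \<Rightarrow> K" where
  "scl c f = (\<lambda>x. c * f x)"

lemma scl_apply: "scl c f x = c * f x"
  by (simp add: scl_def)

lemma sum_fun_apply: "(\<Sum>i\<in>A. f i) x = (\<Sum>i\<in>A. f i x)"
  by (induction A rule: infinite_finite_induct) auto

global_interpretation fs: vector_space scl
  by unfold_locales (simp_all add: fun_eq_iff scl_apply algebra_simps)

definition msp :: "nat \<Rightarrow> (nat \<Rightarrow> nat) set \<Rightarrow> ((nat \<Rightarrow> K) \<Rightarrow> K) set" where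
  "msp n J = fs.span (mono n ` J)"

lemma msp_base: "la \<in> J \<Longrightarrow> mono n la \<in> msp n J"
  unfolding msp_def by (rule fs.span_base) simp

lemma msp_mono: "J \<subseteq> J' \<Longrightarrow> msp n J \<subseteq> msp n J'"
  unfolding msp_def by (intro fs.span_mono image_mono)

lemma msp_zero: "0 \<in> msp n J"
  unfolding msp_def by (rule fs.span_zero)

lemma msp_add: "f \<in> msp n J \<Longrightarrow> g \<in> msp n J \<Longrightarrow> f + g \<in> msp n J"
  unfolding msp_def by (rule fs.span_add)

lemma msp_diff: "f \<in> msp n J \<Longrightarrow> g \<in> msp n J \<Longrightarrow> f - g \<in> msp n J"
  unfolding msp_def by (rule fs.span_diff)

lemma msp_scl: "f \<in> msp n J \<Longrightarrow> scl c f \<in> msp n J"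
  unfolding msp_def by (rule fs.span_scale)

lemma msp_sum: "(\<And>i. i \<in> A \<Longrightarrow> f i \<in> msp n J) \<Longrightarrow> (\<Sum>i\<in>A. f i) \<in> msp n J"
  unfolding msp_def by (rule fs.span_sum)

lemma msp_sumI: "F \<subseteq> J \<Longrightarrow> (\<lambda>x. \<Sum>la\<in>F. c la * mono n la x) \<in> msp n J"
proof -
  assume "F \<subseteq> J"
  then have "(\<Sum>la\<in>F. scl (c la) (mono n la)) \<in> msp n J"
    by (intro msp_sum msp_scl msp_base) auto
  moreover have "(\<Sum>la\<in>F. scl (c la) (mono n la)) = (\<lambda>x. \<Sum>la\<in>F. c la * mono n la x)"
    by (simp add: fun_eq_iff scl_apply sum_fun_apply)
  ultimately show ?thesis by simp
qed

lemma span_imageE: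
  assumes "f \<in> fs.span (g ` J)"
  obtains F c where "finite F" "F \<subseteq> J" "f = (\<Sum>la\<in>F. scl (c la) (g la))"
proof -
  have "\<exists>F c. finite F \<and> F \<subseteq> J \<and> f = (\<Sum>la\<in>F. scl (c la) (g la))"
    using assms
  proof (induction rule: fs.span_induct_alt)
    case base
    show ?case by (intro exI[of _ "{}"]) simp
  next
    case (step k h f)
    then obtain la F c where *: "la \<in> J" "h = g la" "finite F" "F \<subseteq> J" "f = (\<Sum>la\<in>F. scl (c la) (g la))"
      by blast
    define c' where "c' mu = (if mu = la then k else 0) + (if mu \<in> F then c mu else 0)" for mu
    have "(\<Sum>mu\<in>insert la F. scl (c' mu) (g mu)) =
      (\<Sum>mu\<in>insert la F. scl (if mu = la then k else 0) (g mu)) + (\<Sum>mu\<in>insert la F. scl (if mu \<in> F then c mu else 0) (g mu))"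
      by (simp add: c'_def fs.scale_left_distrib sum.distrib)
    also have "(\<Sum>mu\<in>insert la F. scl (if mu = la then k else 0) (g mu)) = (\<Sum>mu\<in>{la}. scl k (g mu))"
      using *(3) by (intro sum.mono_neutral_cong_right) auto
    also have "(\<Sum>mu\<in>insert la F. scl (if mu \<in> F then c mu else 0) (g mu)) = f"
      unfolding *(5) using *(3) by (intro sum.mono_neutral_cong_right) auto
    finally show ?case using * by (intro exI[of _ "insert la F"] exI[of _ c']) simp
  qed
  then show thesis using that by blast
qed

lemma span_image_finiteE:
  assumes "f \<in> fs.span (g ` J)" "finite J"
  obtains c where "f = (\<Sum>la\<in>J. scl (c la) (g la))"
proof -
  obtain F c where F: "finite F" "F \<subseteq> J" "f = (\<Sum>la\<in>F. scl (c la) (g la))"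
    by (rule span_imageE[OF assms(1)])
  have "f = (\<Sum>la\<in>J. scl (if la \<in> F then c la else 0) (g la))"
    unfolding F(3) using F assms(2) by (intro sum.mono_neutral_cong_left) auto
  then show thesis by (rule that)
qed

lemma msp_finiteE:
  assumes "f \<in> msp n J" "finite J"
  obtains c where "f = (\<lambda>x. \<Sum>la\<in>J. c la * mono n la x)"
proof -
  obtain c where "f = (\<Sum>la\<in>J. scl (c la) (mono n la))"
    by (rule span_image_finiteE[OF assms(1)[unfolded msp_def] assms(2)])
  then have "f = (\<lambda>x. \<Sum>la\<in>J. c la * mono n la x)" by (simp add: fun_eq_iff scl_apply sum_fun_apply)
  then show thesis by (rule that)
qed

lemma Lam_eq_msp: "Lam n = msp n (Par n)"
proof
  show "Lam n \<subseteq> msp n (Par n)" by (auto simp: Lam_def intro: msp_sumI)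
  show "msp n (Par n) \<subseteq> Lam n"
  proof
    fix f assume "f \<in> msp n (Par n)"
    then obtain F c where F: "finite F" "F \<subseteq> Par n" "f = (\<Sum>la\<in>F. scl (c la) (mono n la))"
      unfolding msp_def by (rule span_imageE)
    then have "f = (\<lambda>x. \<Sum>la\<in>F. c la * mono n la x)" by (simp add: fun_eq_iff scl_apply sum_fun_apply)
    then show "f \<in> Lam n" unfolding Lam_def using F by blast
  qed
qed

lemma msp_subset_Lam: "J \<subseteq> Par n \<Longrightarrow> msp n J \<subseteq> Lam n"
  unfolding Lam_eq_msp by (rule msp_mono)

lemma Lam_add: "f \<in> Lam n \<Longrightarrow> g \<in> Lam n \<Longrightarrow> f + g \<in> Lam n"
  unfolding Lam_eq_msp by (rule msp_add)

lemma Lam_diff: "f \<in> Lam n \<Longrightarrow> g \<in> Lam n \<Longrightarrow> f - g \<in> Lam n"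
  unfolding Lam_eq_msp by (rule msp_diff)

lemma Lam_scl: "f \<in> Lam n \<Longrightarrow> scl c f \<in> Lam n"
  unfolding Lam_eq_msp by (rule msp_scl)

text \<open>The points indexed by the support of the difference already suffice. This is the test by
  which identities between operators are reduced to computations at lattice points.\<close>

lemma Lam_eq_on_hat:
  assumes "f \<in> Lam n" "g \<in> Lam n" "\<And>nu. nu \<in> Par n \<Longrightarrow> f (hat n nu) = g (hat n nu)"
  shows "f = g"
proof -
  obtain F c where F: "finite F" "F \<subseteq> Par n" "f - g = (\<lambda>x. \<Sum>la\<in>F. c la * mono n la x)"
    by (rule LamE[OF Lam_diff[OF assms(1,2)]])
  have "c la = 0" if "la \<in> F" for la
  proof (rule mono_hat_kernel[OF F(1,2) _ that])
    fix nu assume "nu \<in> F"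
    then have "(f - g) (hat n nu) = 0" using assms(3) F(2) by auto
    then show "(\<Sum>la\<in>F. c la * mono n la (hat n nu)) = 0" by (simp add: F(3))
  qed
  then have "f - g = 0" unfolding F(3) by (simp add: fun_eq_iff)
  then show ?thesis by simp
qed

section \<open>Products of monomial symmetric polynomials\<close>

lemma orbit_sum:
  fixes c :: "(nat \<Rightarrow> nat) \<Rightarrow> K"
  assumes "finite A" and out: "\<And>al i. al \<in> A \<Longrightarrow> n \<le> i \<Longrightarrow> al i = 0"
    and clo: "\<And>al \<sigma>. al \<in> A \<Longrightarrow> \<sigma> permutes {..<n} \<Longrightarrow> al \<circ> \<sigma> \<in> A"
    and inv: "\<And>al \<sigma>. al \<in> A \<Longrightarrow> \<sigma> permutes {..<n} \<Longrightarrow> c (al \<circ> \<sigma>) = c al"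
  shows "(\<Sum>al\<in>A. c al * (\<Prod>i<n. x i ^ al i)) = (\<Sum>la\<in>A \<inter> Par n. c la * mono n la x)"
proof -
  \<comment> \<open>Each orbit of exponents contains exactly one partition, so A is the disjoint
    union of the orbits of its partitions.\<close>
  have A: "A = (\<Union>la\<in>A \<inter> Par n. rearr n la)"
  proof (intro set_eqI iffI)
    fix al assume al: "al \<in> A"
    obtain \<sigma> where s: "\<sigma> permutes {..<n}" "al \<circ> \<sigma> \<in> Par n"
      by (rule exists_sorted_rearr[of n al, OF out[OF al]])
    have "al \<circ> \<sigma> \<in> rearr n al" using s(1) by (auto simp: rearr_def)
    then show "al \<in> (\<Union>la\<in>A \<inter> Par n. rearr n la)" using s clo[OF al s(1)] rearr_sym by blast
  qed (use clo in \<open>auto simp: rearr_def\<close>)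
  have "(\<Sum>al\<in>A. c al * (\<Prod>i<n. x i ^ al i)) =
      (\<Sum>la\<in>A \<inter> Par n. \<Sum>al\<in>rearr n la. c al * (\<Prod>i<n. x i ^ al i))"
  proof (subst A, rule sum.UNION_disjoint)
    show "\<forall>la\<in>A \<inter> Par n. \<forall>mu\<in>A \<inter> Par n. la \<noteq> mu \<longrightarrow> rearr n la \<inter> rearr n mu = {}"
    proof (intro ballI impI)
      fix la mu assume *: "la \<in> A \<inter> Par n" "mu \<in> A \<inter> Par n" "la \<noteq> mu"
      show "rearr n la \<inter> rearr n mu = {}"
      proof (rule ccontr)
        assume "rearr n la \<inter> rearr n mu \<noteq> {}"
        then obtain al where "al \<in> rearr n la" "al \<in> rearr n mu" by blast
        then have "la \<in> rearr n mu" using rearr_sym rearr_trans by blast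
        then show False using rearr_Par_unique * by blast
      qed
    qed
  qed (use assms(1) finite_rearr in auto)
  also have "\<dots> = (\<Sum>la\<in>A \<inter> Par n. c la * mono n la x)"
  proof (rule sum.cong[OF refl])
    fix la assume la: "la \<in> A \<inter> Par n"
    have "(\<Sum>al\<in>rearr n la. c al * (\<Prod>i<n. x i ^ al i)) = (\<Sum>al\<in>rearr n la. c la * (\<Prod>i<n. x i ^ al i))"
      using la inv by (intro sum.cong) (auto simp: rearr_def)
    then show "(\<Sum>al\<in>rearr n la. c al * (\<Prod>i<n. x i ^ al i)) = c la * mono n la x"
      by (simp add: mono_def sum_distrib_left)
  qed
  finally show ?thesis .
qed

lemma below_plus:
  assumes "ka \<in> Par n" "la \<in> Par n" "ka \<in> below n mu" "la \<in> below n nu"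
  shows "(\<lambda>i. ka i + la i) \<in> below n (\<lambda>i. mu i + nu i)"
  using assms by (auto simp: below_def dom_le_def Par_def psize_def sum.distrib intro!: add_mono)

lemma Par_plus: "la \<in> Par n \<Longrightarrow> mu \<in> Par n \<Longrightarrow> (\<lambda>i. la i + mu i) \<in> Par n"
  by (auto simp: Par_def intro!: add_mono)

text \<open>An exponent of the product is a rearrangement of \<open>la\<close> plus one of
  \<open>mu\<close>, so its partial sums are bounded by those of the sum. Equality in all of them
  forces the pair (la, mu), which gives the leading coefficient 1.\<close>

lemma mono_mult:
  assumes la: "la \<in> Par n" and mu: "mu \<in> Par n"
  shows "mono n la * mono n mu - mono n (\<lambda>i. la i + mu i) \<in> msp n (sbelow n (\<lambda>i. la i + mu i))"
proof -
  define R where "R = rearr n la \<times> rearr n mu"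
  define ad :: "(nat \<Rightarrow> nat) \<times> (nat \<Rightarrow> nat) \<Rightarrow> nat \<Rightarrow> nat" where "ad p = (\<lambda>i. fst p i + snd p i)" for p
  define A where "A = ad ` R"
  define c :: "(nat \<Rightarrow> nat) \<Rightarrow> K" where "c al = of_nat (card {p \<in> R. ad p = al})" for al
  define ka where "ka = (\<lambda>i. la i + mu i)"
  have ka: "ka \<in> Par n" unfolding ka_def by (rule Par_plus[OF la mu])
  have finR: "finite R" by (simp add: R_def finite_rearr)
  have R_comp: "(fst p \<circ> \<sigma>, snd p \<circ> \<sigma>) \<in> R" if "p \<in> R" "\<sigma> permutes {..<n}" for p \<sigma>
    using that by (auto simp: R_def intro: rearr_comp)
  have ad_comp: "ad (fst p \<circ> \<sigma>, snd p \<circ> \<sigma>) = ad p \<circ> \<sigma>" for p \<sigma>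
    by (auto simp: ad_def)
  have c_le: "card {p \<in> R. ad p = al} \<le> card {p \<in> R. ad p = al \<circ> \<sigma>}" if "\<sigma> permutes {..<n}" for al \<sigma>
  proof (rule card_inj_on_le)
    show "inj_on (\<lambda>p. (fst p \<circ> \<sigma>, snd p \<circ> \<sigma>)) {p \<in> R. ad p = al}"
    proof (rule inj_onI)
      fix p q :: "(nat \<Rightarrow> nat) \<times> (nat \<Rightarrow> nat)"
      assume "(fst p \<circ> \<sigma>, snd p \<circ> \<sigma>) = (fst q \<circ> \<sigma>, snd q \<circ> \<sigma>)"
      then have "fst p \<circ> (\<sigma> \<circ> inv \<sigma>) = fst q \<circ> (\<sigma> \<circ> inv \<sigma>)" "snd p \<circ> (\<sigma> \<circ> inv \<sigma>) = snd q \<circ> (\<sigma> \<circ> inv \<sigma>)"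
        by (simp_all flip: comp_assoc)
      then show "p = q" by (simp add: permutes_inv_o[OF that] prod_eq_iff)
    qed
    show "(\<lambda>p. (fst p \<circ> \<sigma>, snd p \<circ> \<sigma>)) ` {p \<in> R. ad p = al} \<subseteq> {p \<in> R. ad p = al \<circ> \<sigma>}"
      using R_comp[OF _ that] ad_comp by auto
    show "finite {p \<in> R. ad p = al \<circ> \<sigma>}" using finR by simp
  qed
  \<comment> \<open>The injection between fibres, used for the permutation and for its inverse,
    turns the inequality into an equality.\<close>
  have c_inv: "c (al \<circ> \<sigma>) = c al" if "\<sigma> permutes {..<n}" for al \<sigma>
    using c_le[OF that, of al] c_le[OF permutes_inv[OF that], of "al \<circ> \<sigma>"]
    by (simp add: c_def comp_assoc permutes_inv_o[OF that])
  have expand: "mono n la x * mono n mu x = (\<Sum>nu\<in>A \<inter> Par n. c nu * mono n nu x)" for x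
  proof -
    have "mono n la x * mono n mu x = (\<Sum>p\<in>R. \<Prod>i<n. x i ^ ad p i)"
      by (simp add: mono_def sum_product sum.cartesian_product R_def ad_def case_prod_unfold power_add prod.distrib)
    also have "\<dots> = (\<Sum>al\<in>A. \<Sum>p\<in>{p \<in> R. ad p = al}. \<Prod>i<n. x i ^ ad p i)"
      unfolding A_def using finR by (rule sum.image_gen)
    also have "\<dots> = (\<Sum>al\<in>A. c al * (\<Prod>i<n. x i ^ al i))"
      by (simp add: c_def)
    also have "\<dots> = (\<Sum>nu\<in>A \<inter> Par n. c nu * mono n nu x)"
    proof (rule orbit_sum)
      show "finite A" using finR by (simp add: A_def)
      show "al i = 0" if al: "al \<in> A" and i: "n \<le> i" for al i
      proof -
        obtain p where p: "fst p \<in> rearr n la" "snd p \<in> rearr n mu" "al = ad p" using al by (auto simp: A_def R_def)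
        have "fst p i = la i" "snd p i = mu i" using rearr_outside p(1,2) i not_less by blast+
        then show ?thesis using i la mu by (simp add: p(3) ad_def Par_zero)
      qed
      show "al \<circ> \<sigma> \<in> A" if "al \<in> A" "\<sigma> permutes {..<n}" for al \<sigma>
        using that R_comp ad_comp unfolding A_def by (metis imageE imageI)
    qed (rule c_inv)
    finally show ?thesis .
  qed
  have part: "(\<Sum>i<k. fst p i) \<le> (\<Sum>i<k. la i)" "(\<Sum>i<k. snd p i) \<le> (\<Sum>i<k. mu i)"
    if "p \<in> R" "k \<le> n" for p k
    using that rearr_sum_le[OF la, of "fst p" "{..<k}"] rearr_sum_le[OF mu, of "snd p" "{..<k}"]
    by (auto simp: R_def)
  have A_below: "A \<inter> Par n \<subseteq> below n ka"
  proof
    fix nu assume nu: "nu \<in> A \<inter> Par n"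
    then obtain p where p: "p \<in> R" "nu = ad p" by (auto simp: A_def)
    have "psize n nu = psize n ka"
      using p rearr_sum[of "fst p" n la "\<lambda>x. x"] rearr_sum[of "snd p" n mu "\<lambda>x. x"]
      by (auto simp: psize_def ad_def ka_def R_def sum.distrib)
    then show "nu \<in> below n ka"
      using nu part[OF p(1)] by (auto simp: below_def dom_le_def p(2) ad_def ka_def sum.distrib intro!: add_mono)
  qed
  have "{p \<in> R. ad p = ka} = {(la, mu)}"
  proof
    show "{(la, mu)} \<subseteq> {p \<in> R. ad p = ka}" by (auto simp: R_def rearr_self ad_def ka_def)
    show "{p \<in> R. ad p = ka} \<subseteq> {(la, mu)}"
    proof
      fix p assume "p \<in> {p \<in> R. ad p = ka}"
      then have p: "p \<in> R" "ad p = ka" by auto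
      have e: "fst p i + snd p i = la i + mu i" for i using fun_cong[OF p(2), of i] by (simp add: ad_def ka_def)
      have s: "(\<Sum>i<k. fst p i) = (\<Sum>i<k. la i)" if "k \<le> n" for k
      proof -
        have "(\<Sum>i<k. fst p i) + (\<Sum>i<k. snd p i) = (\<Sum>i<k. la i) + (\<Sum>i<k. mu i)"
          using e by (simp flip: sum.distrib)
        then show ?thesis using part[OF p(1) that] by linarith
      qed
      have f: "fst p = la"
      proof
        fix i show "fst p i = la i"
          using sum_eq_imp_eq[of n "fst p" la i, OF s] rearr_outside[of "fst p" n la i] p(1)
          by (cases "i < n") (auto simp: R_def)
      qed
      moreover have "snd p = mu" using e f by auto
      ultimately show "p \<in> {(la, mu)}" by (simp add: prod_eq_iff)
    qed
  qed
  then have c1: "c ka = 1" by (simp add: c_def)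
  have "ka \<in> A" unfolding A_def
    by (rule image_eqI[of _ _ "(la, mu)"]) (auto simp: ad_def ka_def R_def rearr_self)
  have finA: "finite (A \<inter> Par n)" using finR by (simp add: A_def)
  have "mono n la * mono n mu - mono n ka = (\<lambda>x. \<Sum>nu\<in>A \<inter> Par n - {ka}. c nu * mono n nu x)"
    using \<open>ka \<in> A\<close> ka finA by (simp add: fun_eq_iff expand sum.remove c1)
  also have "\<dots> \<in> msp n (sbelow n ka)"
    using A_below by (intro msp_sumI) (auto simp: below_def sbelow_def)
  finally show ?thesis by (simp add: ka_def)
qed

lemma mono_mult_below:
  assumes "la \<in> Par n" "mu \<in> Par n"
  shows "mono n la * mono n mu \<in> msp n (below n (\<lambda>i. la i + mu i))"
proof -
  have "mono n (\<lambda>i. la i + mu i) \<in> msp n (below n (\<lambda>i. la i + mu i))"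
    using Par_plus[OF assms] by (intro msp_base) (simp add: below_def dom_le_refl)
  moreover have "mono n la * mono n mu - mono n (\<lambda>i. la i + mu i) \<in> msp n (below n (\<lambda>i. la i + mu i))"
    using mono_mult[OF assms] msp_mono[OF sbelow_subset] by blast
  ultimately have "mono n la * mono n mu - mono n (\<lambda>i. la i + mu i) + mono n (\<lambda>i. la i + mu i)
      \<in> msp n (below n (\<lambda>i. la i + mu i))" by (intro msp_add)
  then show ?thesis by simp
qed

lemma times_add_right: "(f + g) * h = f * h + g * (h :: (nat \<Rightarrow> K) \<Rightarrow> K)"
  by (simp add: fun_eq_iff algebra_simps)

lemma scl_times: "scl c f * h = scl c (f * h)"
  by (simp add: fun_eq_iff scl_apply)

lemma zero_times: "0 * h = (0 :: (nat \<Rightarrow> K) \<Rightarrow> K)"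
  by (simp add: fun_eq_iff)

lemma msp_mult:
  assumes "f \<in> msp n J" "\<And>la. la \<in> J \<Longrightarrow> mono n la * h \<in> msp n J'"
  shows "f * h \<in> msp n J'"
  using assms(1)[unfolded msp_def]
proof (induction rule: fs.span_induct_alt)
  case base
  show ?case unfolding zero_times by (rule msp_zero)
next
  case (step c x y)
  then show ?case unfolding times_add_right scl_times using assms(2)
    by (blast intro: msp_add msp_scl)
qed

lemma Lam_mult:
  assumes "f \<in> Lam n" "g \<in> Lam n"
  shows "f * g \<in> Lam n"
proof -
  have mm: "mono n la * mono n mu \<in> msp n (Par n)" if "la \<in> Par n" "mu \<in> Par n" for la mu
    using mono_mult_below[OF that] msp_mono[OF below_subset_Par] by blast
  have "mono n la * g \<in> msp n (Par n)" if "la \<in> Par n" for la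
    using msp_mult[of g n "Par n" "mono n la"] assms(2) mm that by (simp add: mult.commute Lam_eq_msp)
  then show ?thesis using msp_mult assms(1) unfolding Lam_eq_msp by blast
qed

lemma mono_zero: "mono n zero_part = (\<lambda>_. 1)"
proof -
  have "rearr n zero_part = {zero_part}"
    by (auto simp: rearr_def zero_part_def o_def intro: permutes_id exI[of _ id])
  then show ?thesis by (simp add: fun_eq_iff mono_def) (simp add: zero_part_def)
qed

lemma one_Lam: "(\<lambda>_. 1) \<in> Lam n"
  using msp_base[OF zero_part_Par, of n n] unfolding mono_zero Lam_eq_msp .

lemma epart_Par: "k \<le> n \<Longrightarrow> epart k \<in> Par n"
  by (auto simp: epart_def Par_def)

lemma elem_Lam: "k \<le> n \<Longrightarrow> elem n k \<in> Lam n"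
  unfolding elem_def Lam_eq_msp by (intro msp_base epart_Par)

section \<open>Products of elementary symmetric polynomials and their leading terms\<close>

definition elist :: "nat \<Rightarrow> nat list \<Rightarrow> (nat \<Rightarrow> K) \<Rightarrow> K" where
  "elist n ks = foldr (\<lambda>k g. elem n k * g) ks (\<lambda>_. 1)"

text \<open>The leading exponent is the partition whose columns are the nonzero entries of
  \<open>ks\<close>. Adding one more column preserves strict dominance, so lower terms stay
  lower.\<close>

lemma elist_leading:
  assumes "\<forall>k\<in>set ks. k \<le> n"
  shows "(\<lambda>i. \<Sum>k\<leftarrow>ks. epart k i) \<in> Par n \<and>
    elist n ks - mono n (\<lambda>i. \<Sum>k\<leftarrow>ks. epart k i) \<in> msp n (sbelow n (\<lambda>i. \<Sum>k\<leftarrow>ks. epart k i))"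
  using assms
proof (induction ks)
  case Nil
  have "(\<lambda>i. \<Sum>k\<leftarrow>[]. epart k i) = zero_part" by (simp add: zero_part_def)
  then show ?case using zero_part_Par[of n] mono_zero[of n] msp_zero[of n "sbelow n zero_part"]
    by (simp add: elist_def zero_fun_def fun_diff_def)
next
  case (Cons k ks)
  define s where "s = (\<lambda>i. \<Sum>k\<leftarrow>ks. epart k i)"
  define s' where "s' = (\<lambda>i. epart k i + s i)"
  have s': "(\<lambda>i. \<Sum>k\<leftarrow>k # ks. epart k i) = s'" by (simp add: s'_def s_def)
  have "\<forall>k\<in>set ks. k \<le> n" using Cons.prems by simp
  note conj = Cons.IH[OF this, folded s_def]
  note s = conj[THEN conjunct1] and IH = conj[THEN conjunct2]
  have k: "epart k \<in> Par n" using Cons.prems by (intro epart_Par) simp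
  have s'P: "s' \<in> Par n" unfolding s'_def by (rule Par_plus[OF k s])
  have "elem n k * elist n ks - mono n s' =
     (elist n ks - mono n s) * elem n k + (mono n (epart k) * mono n s - mono n s')"
    by (simp add: fun_eq_iff algebra_simps elem_def)
  moreover have "mono n (epart k) * mono n s - mono n s' \<in> msp n (sbelow n s')"
    unfolding s'_def by (rule mono_mult[OF k s])
  moreover have "(elist n ks - mono n s) * elem n k \<in> msp n (sbelow n s')"
  proof (rule msp_mult[OF IH])
    fix la assume la: "la \<in> sbelow n s"
    have laP: "la \<in> Par n" using la by (simp add: sbelow_def)
    define la' where "la' = (\<lambda>i. la i + epart k i)"
    have "mono n la * elem n k \<in> msp n (below n la')"
      unfolding elem_def la'_def by (rule mono_mult_below[OF laP k])
    moreover have "below n la' \<subseteq> sbelow n s'"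
    proof (rule below_sbelow)
      have "la' \<noteq> s'" using la by (auto simp: sbelow_def la'_def s'_def fun_eq_iff)
      moreover have "la' \<in> below n s'"
        using below_plus[of "epart k" n la "epart k" s] k la laP
        by (simp add: below_def sbelow_def dom_le_refl s'_def la'_def add.commute)
      ultimately show "la' \<in> sbelow n s'" by (simp add: sbelow_def below_def)
    qed (rule s'P)
    ultimately show "mono n la * elem n k \<in> msp n (sbelow n s')" using msp_mono by blast
  qed
  ultimately have "elem n k * elist n ks - mono n s' \<in> msp n (sbelow n s')" by (simp only: msp_add)
  moreover have "elist n (k # ks) = elem n k * elist n ks" by (simp add: elist_def)
  ultimately show ?case unfolding s' using s'P by (simp only: simp_thms)
qed

text \<open>\<open>elist n (cols n mu)\<close> is the product of the e_k over the parts k of the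
  conjugate partition, the element that the homomorphism D sends to \<open>Dmu n mu\<close>.\<close>

definition cols :: "nat \<Rightarrow> (nat \<Rightarrow> nat) \<Rightarrow> nat list" where
  "cols n mu = map (conjp mu) [0..<mu 0]"

lemma sum_cols:
  assumes "mu \<in> Par n"
  shows "(\<lambda>i. \<Sum>k\<leftarrow>cols n mu. epart k i) = mu"
proof
  fix i
  have "(\<Sum>k\<leftarrow>cols n mu. epart k i) = (\<Sum>j<mu 0. epart (conjp mu j) i)"
    by (simp add: cols_def interv_sum_list_conv_sum_set_nat atLeast0LessThan o_def)
  also have "\<dots> = (\<Sum>j\<in>{j. j < mu 0 \<and> i < conjp mu j}. 1)"
    by (intro sum.mono_neutral_cong_right) (auto simp: epart_def)
  finally show "(\<Sum>k\<leftarrow>cols n mu. epart k i) = mu i" by (simp add: card_less_nu[OF assms])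
qed

lemma cols_le: "mu \<in> Par n \<Longrightarrow> k \<in> set (cols n mu) \<Longrightarrow> k \<in> {1..n}"
  using conjp_set(2)[of mu n] conjp_less_iff[of mu n 0] by (auto simp: cols_def Suc_le_eq)

lemma elist_cols: "mu \<in> Par n \<Longrightarrow> elist n (cols n mu) - mono n mu \<in> msp n (sbelow n mu)"
  using elist_leading[of "cols n mu" n] cols_le[of mu n] sum_cols[of mu n] by auto

section \<open>Induction on dominance and unitriangular families\<close>

lemma dom_induct [consumes 1, case_names less]:
  assumes "la \<in> Par n"
    and "\<And>la. la \<in> Par n \<Longrightarrow> (\<And>mu. mu \<in> sbelow n la \<Longrightarrow> P mu) \<Longrightarrow> P la"
  shows "P la"
  using assms(1)
proof (induction "card (sbelow n la)" arbitrary: la rule: less_induct)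
  case less
  show ?case
  proof (rule assms(2)[OF less.prems])
    fix mu assume mu: "mu \<in> sbelow n la"
    then have muP: "mu \<in> Par n" by (simp add: sbelow_def)
    \<comment> \<open>\<open>mu\<close> lies in the strict ideal of \<open>la\<close> but not in its
      own, so the cardinality drops.\<close>
    have "insert mu (sbelow n mu) \<subseteq> sbelow n la"
      using below_sbelow[OF less.prems mu] below_eq_insert[OF muP] by simp
    moreover have "mu \<notin> sbelow n mu" by (simp add: sbelow_def)
    ultimately have "sbelow n mu \<subset> sbelow n la" by blast
    then show "P mu" using less.hyps[of mu] muP psubset_card_mono[OF finite_sbelow] by blast
  qed
qed

text \<open>The family g is left arbitrary because the inversion is needed twice, for the Macdonald
  polynomials and for the products of elementary polynomials.\<close>

lemma unitriangular_span:
  assumes "\<And>la. la \<in> Par n \<Longrightarrow> g la - mono n la \<in> msp n (sbelow n la)" "la \<in> Par n"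
  shows "mono n la \<in> fs.span (g ` below n la)"
  using assms(2)
proof (induction rule: dom_induct)
  case (less la)
  have "msp n (sbelow n la) \<subseteq> fs.span (g ` below n la)"
    unfolding msp_def
  proof (rule fs.span_minimal)
    show "mono n ` sbelow n la \<subseteq> fs.span (g ` below n la)"
    proof
      fix h assume "h \<in> mono n ` sbelow n la"
      then obtain mu where mu: "mu \<in> sbelow n la" "h = mono n mu" by blast
      have "below n mu \<subseteq> below n la" using mu(1) by (intro below_mono) (auto simp: sbelow_def below_def)
      then show "h \<in> fs.span (g ` below n la)" using less(2)[OF mu(1)] fs.span_mono[OF image_mono] mu(2) by blast
    qed
  qed auto
  then have "g la - mono n la \<in> fs.span (g ` below n la)" using assms(1)[OF less(1)] by blast
  moreover have "g la \<in> fs.span (g ` below n la)"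
    using less(1) by (intro fs.span_base imageI) (simp add: below_def dom_le_refl)
  moreover have eq: "mono n la = g la - (g la - mono n la)" by simp
  ultimately show ?case by (subst eq) (rule fs.span_diff)
qed

lemma unitriangular_span_subset:
  assumes "\<And>la. la \<in> Par n \<Longrightarrow> g la - mono n la \<in> msp n (sbelow n la)"
    and "J \<subseteq> Par n" "\<And>la. la \<in> J \<Longrightarrow> below n la \<subseteq> J"
  shows "msp n J \<subseteq> fs.span (g ` J)"
  unfolding msp_def
proof (rule fs.span_minimal)
  show "mono n ` J \<subseteq> fs.span (g ` J)"
  proof (rule image_subsetI)
    fix la assume la: "la \<in> J"
    have "mono n la \<in> fs.span (g ` below n la)"
      by (rule unitriangular_span[OF assms(1)]) (use la assms(2) in auto)
    also have "\<dots> \<subseteq> fs.span (g ` J)" by (intro fs.span_mono image_mono assms(3) la)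
    finally show "mono n la \<in> fs.span (g ` J)" .
  qed
qed auto

lemma elem_sum_subsets:
  assumes "k \<le> n"
  shows "elem n k x = (\<Sum>S\<in>{S. S \<subseteq> {..<n} \<and> card S = k}. \<Prod>i\<in>S. x i)"
proof -
  define ind :: "nat set \<Rightarrow> nat \<Rightarrow> nat" where "ind S = (\<lambda>i. if i \<in> S then 1 else 0)" for S
  have "bij_betw ind {S. S \<subseteq> {..<n} \<and> card S = k} (rearr n (epart k))"
  proof (rule bij_betwI')
    fix S T show "(ind S = ind T) = (S = T)"
      by (auto simp: ind_def fun_eq_iff split: if_splits)
  next
    fix S assume "S \<in> {S. S \<subseteq> {..<n} \<and> card S = k}"
    then have S: "S \<subseteq> {..<n}" "card S = k" by auto
    obtain \<sigma> where s: "\<sigma> permutes {..<n}" "ind S \<circ> \<sigma> \<in> Par n"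
      by (rule exists_sorted_rearr[of n "ind S"]) (use S in \<open>auto simp: ind_def\<close>)
    define nu where "nu = ind S \<circ> \<sigma>"
    have nuR: "nu \<in> rearr n (ind S)" using s by (auto simp: rearr_def nu_def)
    \<comment> \<open>A weakly decreasing sequence of zeros and ones is a column; comparing sums
      then identifies its length \<open>conjp nu 0\<close> with k.\<close>
    have nu: "nu i = epart (conjp nu 0) i" for i
      using conjp_less_iff[of nu n i 0] s(2) by (auto simp: nu_def epart_def ind_def split: if_splits)
    have "(\<Sum>i<n. nu i) = (\<Sum>i<n. ind S i)" using rearr_sum[OF nuR, of "\<lambda>x. x"] .
    also have "\<dots> = (\<Sum>i\<in>S. 1)" using S by (intro sum.mono_neutral_cong_right) (auto simp: ind_def)
    also have "\<dots> = k" using S by simp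
    finally have "(\<Sum>i<n. nu i) = k" .
    moreover have "(\<Sum>i<n. epart (conjp nu 0) i) = (\<Sum>i<conjp nu 0. 1)"
      using conjp_set(2)[of nu n 0] s(2)
      by (intro sum.mono_neutral_cong_right) (auto simp: epart_def nu_def)
    ultimately have "conjp nu 0 = k" using nu by simp
    then have "nu = epart k" using nu by auto
    then show "ind S \<in> rearr n (epart k)" using rearr_sym[OF nuR] by simp
  next
    fix al assume "al \<in> rearr n (epart k)"
    then obtain \<sigma> where s: "\<sigma> permutes {..<n}" "al = epart k \<circ> \<sigma>" by (auto simp: rearr_def)
    define S where "S = inv \<sigma> ` {..<k}"
    have si: "inv \<sigma> permutes {..<n}" using s(1) by (rule permutes_inv)
    have "S \<subseteq> inv \<sigma> ` {..<n}" unfolding S_def using assms by (intro image_mono) auto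
    then have "S \<subseteq> {..<n}" using permutes_image[OF si] by simp
    moreover have "card S = k" unfolding S_def
      using card_image[OF inj_on_subset[OF permutes_inj[OF si] subset_UNIV]] by simp
    moreover have "i \<in> S \<longleftrightarrow> \<sigma> i < k" for i
      unfolding S_def using permutes_inverses[OF s(1)] by (metis imageE imageI lessThan_iff)
    then have "al = ind S" by (auto simp: s(2) ind_def epart_def)
    ultimately show "\<exists>S\<in>{S. S \<subseteq> {..<n} \<and> card S = k}. al = ind S" by blast
  qed
  then have "elem n k x = (\<Sum>S\<in>{S. S \<subseteq> {..<n} \<and> card S = k}. \<Prod>i<n. x i ^ ind S i)"
    unfolding elem_def mono_def by (rule sum.reindex_bij_betw[symmetric])
  also have "\<dots> = (\<Sum>S\<in>{S. S \<subseteq> {..<n} \<and> card S = k}. \<Prod>i\<in>S. x i)"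
    by (intro sum.cong refl prod.mono_neutral_cong_right) (auto simp: ind_def)
  finally show ?thesis .
qed

section \<open>Alternating sums and the Vandermonde product\<close>

text \<open>The alternant, the determinant of the matrix with entries x_i^(g_j). For g a partition
  plus \<open>stair n\<close> it is a Vandermonde times a Schur polynomial.\<close>

definition alt :: "nat \<Rightarrow> (nat \<Rightarrow> nat) \<Rightarrow> (nat \<Rightarrow> K) \<Rightarrow> K" where
  "alt n g x = (\<Sum>w | w permutes {..<n}. of_int (sign w) * (\<Prod>i<n. x i ^ g (w i)))"

lemma two_neq_zero_K: "(2 :: K) \<noteq> 0"
proof -
  have "(2 :: K) = to_fract 2" by (metis one_add_one to_fract_1 to_fract_add)
  then show ?thesis by (simp only: to_fract_eq_0_iff)
qed

lemma neg_self_K: "(a::K) = - a \<Longrightarrow> a = 0"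
proof -
  assume "a = - a"
  then have "2 * a = 0" by (metis add.right_inverse mult_2)
  then show ?thesis using two_neq_zero_K by simp
qed

lemma sign_permutes_comp:
  "p permutes {..<n::nat} \<Longrightarrow> q permutes {..<n} \<Longrightarrow> sign (p \<circ> q) = sign p * sign q"
  by (intro sign_compose permutation_permutes[THEN iffD2]) auto

lemma alt_cong:
  assumes "\<And>i. i < n \<Longrightarrow> g i = h i"
  shows "alt n g x = alt n h x"
  unfolding alt_def
proof (intro sum.cong refl arg_cong2[where f = "(*)"] prod.cong)
  fix w i assume "w \<in> {w. w permutes {..<n}}" "i \<in> {..<n}"
  then have "w i < n" using permutes_in_image[of w "{..<n}" i] by auto
  then show "x i ^ g (w i) = x i ^ h (w i)" using assms by simp
qed

lemma of_int_sign_sq: "of_int (sign \<sigma>) * (of_int (sign \<sigma>) :: 'a::ring_1) = 1"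
  by (simp add: sign_def)

lemma alt_comp:
  assumes s: "\<sigma> permutes {..<n}"
  shows "alt n (g \<circ> \<sigma>) x = of_int (sign \<sigma>) * alt n g x"
proof -
  have "alt n g x = (\<Sum>w | w permutes {..<n}. of_int (sign (\<sigma> \<circ> w)) * (\<Prod>i<n. x i ^ g ((\<sigma> \<circ> w) i)))"
    unfolding alt_def by (rule setum_permutations_compose_left[OF s])
  also have "\<dots> = (\<Sum>w | w permutes {..<n}. of_int (sign \<sigma>) * (of_int (sign w) * (\<Prod>i<n. x i ^ (g \<circ> \<sigma>) (w i))))"
    using s by (intro sum.cong refl) (simp add: sign_permutes_comp mult.assoc)
  also have "\<dots> = of_int (sign \<sigma>) * alt n (g \<circ> \<sigma>) x"
    by (simp add: alt_def sum_distrib_left)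
  finally show ?thesis by (simp add: of_int_sign_sq flip: mult.assoc)
qed

lemma alt_comp_points:
  assumes s: "\<sigma> permutes {..<n}"
  shows "alt n g (x \<circ> \<sigma>) = of_int (sign \<sigma>) * alt n g x"
proof -
  have "alt n g (x \<circ> \<sigma>) = (\<Sum>w | w permutes {..<n}. of_int (sign (w \<circ> \<sigma>)) * (\<Prod>i<n. (x \<circ> \<sigma>) i ^ g ((w \<circ> \<sigma>) i)))"
    unfolding alt_def by (rule sum_permutations_compose_right[OF s])
  also have "\<dots> = (\<Sum>w | w permutes {..<n}. of_int (sign \<sigma>) * (of_int (sign w) * (\<Prod>i<n. x i ^ g (w i))))"
  proof (intro sum.cong refl)
    fix w assume "w \<in> {w. w permutes {..<n}}"
    then have "sign (w \<circ> \<sigma>) = sign w * sign \<sigma>" using s by (simp add: sign_permutes_comp)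
    moreover have "(\<Prod>i<n. (x \<circ> \<sigma>) i ^ g ((w \<circ> \<sigma>) i)) = (\<Prod>i<n. x i ^ g (w i))"
      using prod.permute[OF s, of "\<lambda>i. x i ^ g (w i)"] by (simp add: o_def)
    ultimately show "of_int (sign (w \<circ> \<sigma>)) * (\<Prod>i<n. (x \<circ> \<sigma>) i ^ g ((w \<circ> \<sigma>) i)) =
       of_int (sign \<sigma>) * (of_int (sign w) * (\<Prod>i<n. x i ^ g (w i)))" by (simp add: mult_ac)
  qed
  also have "\<dots> = of_int (sign \<sigma>) * alt n g x"
    by (simp add: alt_def sum_distrib_left)
  finally show ?thesis .
qed

lemma transpose_comp_eq: "f i = f j \<Longrightarrow> f \<circ> Transposition.transpose i j = f"
  by (auto simp: fun_eq_iff Transposition.transpose_def)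

lemma alt_points_not_inj:
  assumes "i < n" "j < n" "i \<noteq> j" "x i = x j"
  shows "alt n g x = 0"
proof -
  have "Transposition.transpose i j permutes {..<n}" using assms by (intro permutes_swap_id) auto
  from alt_comp_points[OF this, of g x] show ?thesis
    using assms by (intro neg_self_K) (simp add: transpose_comp_eq sign_swap_id)
qed

lemma alt_not_inj:
  assumes "i < n" "j < n" "i \<noteq> j" "g i = g j"
  shows "alt n g x = 0"
proof -
  have "Transposition.transpose i j permutes {..<n}" using assms by (intro permutes_swap_id) auto
  from alt_comp[OF this, of g x] show ?thesis
    using assms by (intro neg_self_K) (simp add: transpose_comp_eq sign_swap_id)
qed

lemma permutes_fixing_last:
  "{w. w permutes {..<Suc n} \<and> w n = n} = {w. w permutes {..<n}}"
proof (intro set_eqI iffI)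
  fix w assume "w \<in> {w. w permutes {..<Suc n} \<and> w n = n}"
  then show "w \<in> {w. w permutes {..<n}}" by (auto simp: permutes_def less_Suc_eq)
next
  fix w assume w: "w \<in> {w. w permutes {..<n}}"
  then have "w permutes {..<Suc n}" by (auto intro: permutes_subset)
  moreover have "w n = n" using w by (auto simp: permutes_def)
  ultimately show "w \<in> {w. w permutes {..<Suc n} \<and> w n = n}" by simp
qed

text \<open>As a polynomial in the last variable the alternant has degree at most n, vanishes at the
  n other nodes and has \<open>alt n\<close> of those nodes as its coefficient of degree n. This
  determines it when the nodes are distinct; otherwise both sides vanish.\<close>

lemma vandermonde: "alt n (\<lambda>i. i) x = (\<Prod>j<n. \<Prod>i<j. x j - x i)"
proof (induction n)
  case 0
  have "{w :: nat \<Rightarrow> nat. w permutes {..<0}} = {id}" by auto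
  then show ?case by (simp add: alt_def)
next
  case (Suc n)
  show ?case
  proof (cases "inj_on x {..<n}")
    case True
    define p where "p = (\<Sum>w | w permutes {..<Suc n}. monom (of_int (sign w) * (\<Prod>i<n. x i ^ w i)) (w n))"
    define q where "q = smult (alt n (\<lambda>i. i) x) (\<Prod>i<n. [:- x i, 1:])"
    have fin: "finite {w. w permutes {..<Suc n}}" by (simp add: finite_permutations)
    have p: "poly p y = alt (Suc n) (\<lambda>i. i) (x(n := y))" for y
      by (simp add: p_def alt_def poly_sum poly_monom mult.assoc)
    have "p = q"
    proof (rule poly_eqI_degree_lead_coeff[where A = "x ` {..<n}" and n = n])
      have "coeff p n = (\<Sum>w | w permutes {..<Suc n}. if w n = n then of_int (sign w) * (\<Prod>i<n. x i ^ w i) else 0)"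
        by (simp add: p_def coeff_sum coeff_monom)
      also have "\<dots> = (\<Sum>w | w permutes {..<Suc n} \<and> w n = n. of_int (sign w) * (\<Prod>i<n. x i ^ w i))"
        using fin by (intro sum.mono_neutral_cong_right) auto
      also have "\<dots> = alt n (\<lambda>i. i) x" by (simp add: permutes_fixing_last alt_def)
      finally have "coeff p n = alt n (\<lambda>i. i) x" .
      moreover have d: "degree (\<Prod>i<n. [:- x i, 1:]) = n" by (simp add: degree_prod_eq_sum_degree)
      moreover have "lead_coeff (\<Prod>i<n. [:- x i, 1:]) = 1" by (simp add: lead_coeff_prod)
      ultimately show "coeff p n = coeff q n" by (simp add: q_def)
      show "degree q \<le> n" using degree_smult_le[of "alt n (\<lambda>i. i) x" "\<Prod>i<n. [:- x i, 1:]"]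
        unfolding q_def d .
      show "degree p \<le> n" unfolding p_def
      proof (intro degree_sum_le fin order_trans[OF degree_monom_le])
        fix w assume "w \<in> {w. w permutes {..<Suc n}}"
        then show "w n \<le> n" using permutes_in_image[of w "{..<Suc n}" n] by auto
      qed
      show "n \<le> card (x ` {..<n})" using True by (simp add: card_image)
      fix z assume "z \<in> x ` {..<n}"
      then obtain j where j: "j < n" "z = x j" by auto
      have "poly p z = 0" unfolding p j(2) using j(1) by (intro alt_points_not_inj[of j _ n]) auto
      moreover have "poly q z = 0" using j by (auto simp: q_def poly_prod)
      ultimately show "poly p z = poly q z" by simp
    qed
    then have "alt (Suc n) (\<lambda>i. i) x = poly q (x n)" using p[of "x n"] by simp
    then show ?thesis by (simp add: q_def poly_prod Suc.IH)
  next
    case False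
    then obtain i j where ij: "i < j" "j < n" "x i = x j"
      unfolding inj_on_def by (metis lessThan_iff linorder_less_linear)
    then have "alt (Suc n) (\<lambda>i. i) x = 0" by (intro alt_points_not_inj[of i _ j]) auto
    moreover have "(\<Prod>i<j. x j - x i) = 0" using ij by (intro prod_zero bexI[of _ i]) auto
    then have "(\<Prod>j<Suc n. \<Prod>i<j. x j - x i) = 0"
      by (rule prod_zero[OF finite_lessThan bexI[of _ j]]) (use ij in simp)
    ultimately show ?thesis by simp
  qed
qed

text \<open>Reversal turns the exponents of \<open>stair n\<close> into 0, ..., n - 1. Its sign is
  absorbed in c, of which only nonvanishing matters.\<close>

lemma alt_stair: "\<exists>c. c \<noteq> 0 \<and> (\<forall>x. alt n (stair n) x = c * (\<Prod>j<n. \<Prod>i<j. x j - x i))"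
proof -
  define r where "r i = (if i < n then n - 1 - i else i)" for i :: nat
  have "bij_betw r {..<n} {..<n}"
    by (rule bij_betwI[where g = r]) (auto simp: r_def)
  then have r: "r permutes {..<n}" by (rule bij_imp_permutes) (simp add: r_def)
  have "alt n (stair n) x = alt n ((\<lambda>i. i) \<circ> r) x" for x
    by (rule alt_cong) (simp add: stair_def r_def)
  also have "alt n ((\<lambda>i. i) \<circ> r) x = of_int (sign r) * (\<Prod>j<n. \<Prod>i<j. x j - x i)" for x
    unfolding alt_comp[OF r] vandermonde ..
  finally show ?thesis by (intro exI[of _ "of_int (sign r)"]) (simp add: sign_def)
qed

lemma alt_stair_neq_zero: "inj_on x {..<n} \<Longrightarrow> alt n (stair n) x \<noteq> 0"
proof -
  assume "inj_on x {..<n}"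
  then have "x j - x i \<noteq> 0" if "i < j" "j < n" for i j
    using inj_onD[of x "{..<n}" j i] that by auto
  then have "(\<Prod>j<n. \<Prod>i<j. x j - x i) \<noteq> 0" by simp
  then show ?thesis using alt_stair[of n] by auto
qed

text \<open>The origin of the coefficients of D_k. Multiplying the coordinates in S by t changes the
  Vandermonde product by a factor t for each pair inside S, whence the exponent k(k-1)/2, and by one
  fraction for each mixed pair.\<close>

lemma vandermonde_ratio:
  fixes x :: "nat \<Rightarrow> 'a::field" and t :: 'a and S :: "nat set"
  assumes "inj_on x {..<n}"
  defines "y \<equiv> \<lambda>i. if i \<in> S then t * x i else x i"
  shows "(\<Prod>j<n. \<Prod>i<j. y j - y i) =
    t ^ (card (S \<inter> {..<n}) * (card (S \<inter> {..<n}) - 1) div 2) *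
    (\<Prod>i\<in>S \<inter> {..<n}. \<Prod>j\<in>{..<n} - S. (t * x i - x j) / (x i - x j)) * (\<Prod>j<n. \<Prod>i<j. x j - x i)"
  using assms(1)
proof (induction n)
  case (Suc n)
  define m where "m = card (S \<inter> {..<n})"
  define R where "R = (\<Prod>i\<in>S \<inter> {..<n}. \<Prod>j\<in>{..<n} - S. (t * x i - x j) / (x i - x j))"
  define W where "W = (\<Prod>j<n. \<Prod>i<j. x j - x i)"
  have inj: "inj_on x {..<n}" and ne: "\<And>i. i < n \<Longrightarrow> x i \<noteq> x n"
    using Suc.prems by (auto simp: inj_on_def)
  have ne': "x n - x i \<noteq> 0" "x i - x n \<noteq> 0" if "i < n" for i using ne[OF that] by auto
  define rho where "rho i j = (t * x i - x j) / (x i - x j)" for i j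
  have R: "R = (\<Prod>i\<in>S \<inter> {..<n}. \<Prod>j\<in>{..<n} - S. rho i j)" by (simp add: R_def rho_def)
  have IH: "(\<Prod>j<n. \<Prod>i<j. y j - y i) = t ^ (m * (m - 1) div 2) * R * W"
    unfolding m_def R_def W_def by (rule Suc.IH[OF inj])
  have split: "(\<Prod>i<n. f i) = (\<Prod>i\<in>S \<inter> {..<n}. f i) * (\<Prod>i\<in>{..<n} - S. f i)" for f :: "nat \<Rightarrow> 'a"
    by (subst prod.union_disjoint[symmetric]) (auto intro: arg_cong2[where f = prod])
  show ?case
  proof (cases "n \<in> S")
    case True
    have S1: "S \<inter> {..<Suc n} = insert n (S \<inter> {..<n})" and S2: "{..<Suc n} - S = {..<n} - S"
      using True by (auto simp: less_Suc_eq)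
    have "(\<Prod>i<n. y n - y i) = (\<Prod>i\<in>S \<inter> {..<n}. t * (x n - x i)) * (\<Prod>i\<in>{..<n} - S. t * x n - x i)"
      unfolding split using True by (intro arg_cong2[where f = "(*)"] prod.cong) (auto simp: y_def algebra_simps)
    also have "(\<Prod>i\<in>{..<n} - S. t * x n - x i) = (\<Prod>i\<in>{..<n} - S. rho n i * (x n - x i))"
      using ne' by (intro prod.cong) (auto simp: rho_def)
    also have "(\<Prod>i\<in>S \<inter> {..<n}. t * (x n - x i)) * \<dots> =
        t ^ m * (\<Prod>i\<in>{..<n} - S. rho n i) * (\<Prod>i<n. x n - x i)"
      unfolding split[of "\<lambda>i. x n - x i"] by (simp add: prod.distrib m_def)
    finally have step: "(\<Prod>i<n. y n - y i) =
        t ^ m * (\<Prod>i\<in>{..<n} - S. rho n i) * (\<Prod>i<n. x n - x i)" .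
    have card: "card (S \<inter> {..<Suc n}) = Suc m" by (simp add: S1 m_def)
    \<comment> \<open>The new index forms m pairs with the earlier elements of S; parity makes the
      truncated halves add up exactly.\<close>
    have "even (m * (m - 1))" by (cases m) auto
    then have "Suc m * (Suc m - 1) div 2 = m * (m - 1) div 2 + m" by (cases m) (auto simp: algebra_simps)
    then show ?thesis unfolding card unfolding S1 S2 rho_def[symmetric]
      by (simp add: IH step power_add R W_def mult_ac)
  next
    case False
    have S1: "S \<inter> {..<Suc n} = S \<inter> {..<n}" and S2: "{..<Suc n} - S = insert n ({..<n} - S)"
      using False by (auto simp: less_Suc_eq)
    have "(\<Prod>i<n. y n - y i) = (\<Prod>i\<in>S \<inter> {..<n}. x n - t * x i) * (\<Prod>i\<in>{..<n} - S. x n - x i)"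
      unfolding split using False by (intro arg_cong2[where f = "(*)"] prod.cong) (auto simp: y_def)
    also have "(\<Prod>i\<in>S \<inter> {..<n}. x n - t * x i) = (\<Prod>i\<in>S \<inter> {..<n}. rho i n * (x n - x i))"
    proof (rule prod.cong[OF refl])
      fix i assume "i \<in> S \<inter> {..<n}"
      then have "rho i n * (x i - x n) = t * x i - x n" using ne'(2)[of i] by (simp add: rho_def)
      then show "x n - t * x i = rho i n * (x n - x i)" by (simp add: algebra_simps)
    qed
    finally have step: "(\<Prod>i<n. y n - y i) = (\<Prod>i\<in>S \<inter> {..<n}. rho i n) * (\<Prod>i<n. x n - x i)"
      unfolding split[of "\<lambda>i. x n - x i"] by (simp add: prod.distrib)
    show ?thesis unfolding S1 S2 rho_def[symmetric]
      by (simp add: IH step prod.distrib R W_def m_def mult_ac)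
  qed
qed simp

lemma alt_stair_scaled:
  assumes "inj_on x {..<n}" "S \<subseteq> {..<n}" "card S = k"
  shows "alt n (stair n) (\<lambda>i. if i \<in> S then tt * x i else x i) =
    tt ^ (k * (k - 1) div 2) * (\<Prod>i\<in>S. \<Prod>j\<in>{..<n} - S. (tt * x i - x j) / (x i - x j)) * alt n (stair n) x"
proof -
  obtain c where c: "\<And>x. alt n (stair n) x = c * (\<Prod>j<n. \<Prod>i<j. x j - x i)" using alt_stair[of n] by blast
  have "S \<inter> {..<n} = S" using assms(2) by auto
  then show ?thesis unfolding c vandermonde_ratio[OF assms(1), of S tt] using assms(3) by (simp add: mult_ac)
qed

section \<open>The Macdonald operators on symmetric polynomials\<close>

lemma mono_perm:
  assumes "w permutes {..<n}"
  shows "mono n la (x \<circ> w) = mono n la x"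
proof -
  have "mono n la (x \<circ> w) = (\<Sum>be\<in>rearr n la. \<Prod>i<n. (x \<circ> w) i ^ (be \<circ> w) i)"
    unfolding mono_def by (rule sum.reindex_bij_betw[OF rearr_comp_bij[OF assms], symmetric])
  also have "\<dots> = mono n la x" unfolding mono_def
  proof (rule sum.cong[OF refl])
    fix be
    show "(\<Prod>i<n. (x \<circ> w) i ^ (be \<circ> w) i) = (\<Prod>i<n. x i ^ be i)"
      using prod.permute[OF assms, of "\<lambda>i. x i ^ be i"] by (simp add: o_def)
  qed
  finally show ?thesis .
qed

lemma hat_stair: "i < n \<Longrightarrow> hat n la i = qq ^ la i * tt ^ stair n i"
  by (simp add: hat_def stair_def)

text \<open>The coefficients are absorbed into a Vandermonde at the point scaled by t on S, so t
  enters with exponents from \<open>stair n\<close> and q with exponents from the monomial. Once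
  both are permuted by the same w, an index i of S contributes \<open>hat n be (w i)\<close>, and
  the sum over S is e_k.\<close>

lemma alt_Dform_mono:
  assumes x: "inj_on x {..<n}" and k: "k \<le> n"
  shows "alt n (stair n) x * Dform n k (mono n la) x =
    (\<Sum>be\<in>rearr n la. elem n k (hat n be) * alt n (\<lambda>i. be i + stair n i) x)"
proof -
  define SS where "SS = {S. S \<subseteq> {..<n} \<and> card S = k}"
  define W where "W = {w. w permutes {..<n}}"
  define xt where "xt S = (\<lambda>i. if i \<in> S then tt * x i else x i)" for S
  define xq where "xq S = (\<lambda>i. if i \<in> S then qq * x i else x i)" for S
  define e where "e w be = (\<Prod>i<n. x i ^ (be (w i) + stair n (w i)))" for w be
  have finS: "finite SS" unfolding SS_def by simp
  have "alt n (stair n) x * Dform n k (mono n la) x = (\<Sum>S\<in>SS. alt n (stair n) (xt S) * mono n la (xq S))"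
    unfolding Dform_def sum_distrib_left SS_def xq_def xt_def
    by (intro sum.cong refl) (simp add: alt_stair_scaled[OF x] mult_ac)
  also have "\<dots> = (\<Sum>S\<in>SS. \<Sum>w\<in>W. \<Sum>al\<in>rearr n la.
      of_int (sign w) * (\<Prod>i<n. xt S i ^ stair n (w i)) * (\<Prod>i<n. xq S i ^ al i))"
    by (simp add: alt_def mono_def sum_product W_def)
  also have "\<dots> = (\<Sum>S\<in>SS. \<Sum>w\<in>W. \<Sum>be\<in>rearr n la. of_int (sign w) * e w be * (\<Prod>i\<in>S. hat n be (w i)))"
  proof (rule sum.cong[OF refl], rule sum.cong[OF refl])
    fix S w assume S: "S \<in> SS" and w: "w \<in> W"
    then have w: "w permutes {..<n}" by (simp add: W_def)
    \<comment> \<open>Writing al as \<open>be \<circ> w\<close> aligns the monomial exponents with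
      the permuted entries of \<open>stair n\<close>.\<close>
    have "(\<Sum>al\<in>rearr n la. of_int (sign w) * (\<Prod>i<n. xt S i ^ stair n (w i)) * (\<Prod>i<n. xq S i ^ al i)) =
      (\<Sum>be\<in>rearr n la. of_int (sign w) * (\<Prod>i<n. xt S i ^ stair n (w i)) * (\<Prod>i<n. xq S i ^ (be \<circ> w) i))"
      by (rule sum.reindex_bij_betw[OF rearr_comp_bij[OF w], symmetric])
    also have "\<dots> = (\<Sum>be\<in>rearr n la. of_int (sign w) * e w be * (\<Prod>i\<in>S. hat n be (w i)))"
    proof (rule sum.cong[OF refl])
      fix be
      have "(\<Prod>i<n. xt S i ^ stair n (w i)) * (\<Prod>i<n. xq S i ^ (be \<circ> w) i) =
         (\<Prod>i<n. x i ^ (be (w i) + stair n (w i)) * (if i \<in> S then hat n be (w i) else 1))"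
        unfolding prod.distrib[symmetric]
      proof (rule prod.cong[OF refl])
        fix i assume "i \<in> {..<n}"
        then have "w i < n" using permutes_in_image[OF w, of i] by simp
        then show "xt S i ^ stair n (w i) * xq S i ^ (be \<circ> w) i =
            x i ^ (be (w i) + stair n (w i)) * (if i \<in> S then hat n be (w i) else 1)"
          by (simp add: xt_def xq_def hat_stair power_add power_mult_distrib mult_ac)
      qed
      also have "\<dots> = e w be * (\<Prod>i\<in>S. hat n be (w i))"
      proof -
        have "(\<Prod>i<n. if i \<in> S then hat n be (w i) else 1) = (\<Prod>i\<in>S. hat n be (w i))"
          using S by (intro prod.mono_neutral_cong_right) (auto simp: SS_def)
        then show ?thesis by (simp add: prod.distrib e_def)
      qed
      finally show "of_int (sign w) * (\<Prod>i<n. xt S i ^ stair n (w i)) * (\<Prod>i<n. xq S i ^ (be \<circ> w) i) =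
          of_int (sign w) * e w be * (\<Prod>i\<in>S. hat n be (w i))" by (simp only: mult.assoc)
    qed
    finally show "(\<Sum>al\<in>rearr n la. of_int (sign w) * (\<Prod>i<n. xt S i ^ stair n (w i)) * (\<Prod>i<n. xq S i ^ al i)) =
        (\<Sum>be\<in>rearr n la. of_int (sign w) * e w be * (\<Prod>i\<in>S. hat n be (w i)))" .
  qed
  also have "\<dots> = (\<Sum>w\<in>W. \<Sum>be\<in>rearr n la. \<Sum>S\<in>SS. of_int (sign w) * e w be * (\<Prod>i\<in>S. hat n be (w i)))"
    by (subst sum.swap, rule sum.cong[OF refl], rule sum.swap)
  also have "\<dots> = (\<Sum>w\<in>W. \<Sum>be\<in>rearr n la. of_int (sign w) * e w be * elem n k (hat n be))"
  proof (intro sum.cong refl)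
    fix w be assume "w \<in> W"
    \<comment> \<open>The sum over S is e_k at the point permuted by w, and e_k is
      symmetric.\<close>
    then have "elem n k (hat n be) = elem n k (hat n be \<circ> w)" by (simp add: W_def elem_def mono_perm)
    then show "(\<Sum>S\<in>SS. of_int (sign w) * e w be * (\<Prod>i\<in>S. hat n be (w i))) =
        of_int (sign w) * e w be * elem n k (hat n be)"
      by (simp add: elem_sum_subsets[OF k] SS_def sum_distrib_left)
  qed
  also have "\<dots> = (\<Sum>be\<in>rearr n la. elem n k (hat n be) * alt n (\<lambda>i. be i + stair n i) x)"
    by (subst sum.swap) (simp add: alt_def W_def e_def sum_distrib_left mult_ac)
  finally show ?thesis .
qed

lemma elem_zero: "elem n 0 = (\<lambda>_. 1)"
proof -
  have "epart 0 = zero_part" by (simp add: epart_def zero_part_def)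
  then show ?thesis by (simp add: elem_def mono_zero)
qed

text \<open>The case k = 0 of \<open>alt_Dform_mono\<close>: only the empty subset occurs, and e_0 =
  1.\<close>

lemma alt_stair_mono:
  assumes "inj_on x {..<n}"
  shows "alt n (stair n) x * mono n la x = (\<Sum>be\<in>rearr n la. alt n (\<lambda>i. be i + stair n i) x)"
proof -
  have "{S. S \<subseteq> {..<n} \<and> card S = 0} = {{}}"
    using finite_subset[OF _ finite_lessThan] by (auto dest: card_eq_0_iff[THEN iffD1])
  then have "Dform n 0 (mono n la) x = mono n la x" by (simp add: Dform_def)
  then show ?thesis using alt_Dform_mono[OF assms, of 0 la] by (simp add: elem_zero)
qed

section \<open>Straightening of alternants and triangularity of the operators\<close>

lemma strictly_decreasing_gap:
  fixes g :: "nat \<Rightarrow> nat"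
  assumes "\<And>i. Suc i < n \<Longrightarrow> g (Suc i) < g i" "i \<le> j" "j < n"
  shows "g j + (j - i) \<le> g i"
  using assms(2,3)
proof (induction rule: dec_induct)
  case (step m)
  then show ?case using assms(1)[of m] by (simp add: Suc_diff_le)
qed simp

text \<open>Repeated exponents kill the alternant. Otherwise sorting costs a sign and subtracting
  \<open>stair n\<close> leaves a partition rho; its partial sums do not exceed those of
  \<open>nu\<close>, since \<open>stair n\<close> is largest on its first k places.\<close>

lemma straighten:
  assumes nu: "nu \<in> Par n" and be: "be \<in> rearr n nu" "be \<noteq> nu"
  shows "(\<forall>x. alt n (\<lambda>i. be i + stair n i) x = 0) \<or>
    (\<exists>rho\<in>sbelow n nu. \<exists>c. \<forall>x. alt n (\<lambda>i. be i + stair n i) x = c * alt n (\<lambda>i. rho i + stair n i) x)"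
proof -
  define g where "g = (\<lambda>i. be i + stair n i)"
  show ?thesis
  proof (cases "inj_on g {..<n}")
    case False
    then obtain i j where "i < n" "j < n" "i \<noteq> j" "g i = g j" by (auto simp: inj_on_def)
    then have "alt n g x = 0" for x by (rule alt_not_inj)
    then show ?thesis by (simp add: g_def)
  next
    case True
    obtain \<sigma> where s: "\<sigma> permutes {..<n}" and dec: "\<And>i j. i \<le> j \<Longrightarrow> j < n \<Longrightarrow> g (\<sigma> j) \<le> g (\<sigma> i)"
      using sorting_permutation[of n g] by metis
    have \<sigma>n: "\<sigma> i < n" if "i < n" for i using permutes_in_image[OF s, of i] that by simp
    have sdec: "g (\<sigma> (Suc i)) < g (\<sigma> i)" if "Suc i < n" for i
    proof -
      have "\<sigma> (Suc i) \<noteq> \<sigma> i" using permutes_inj[OF s] by (simp add: inj_eq)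
      then have "g (\<sigma> (Suc i)) \<noteq> g (\<sigma> i)"
        using inj_onD[OF True, of "\<sigma> (Suc i)" "\<sigma> i"] \<sigma>n that by auto
      then show ?thesis using dec[of i "Suc i"] that by simp
    qed
    have gap: "g (\<sigma> j) + (j - i) \<le> g (\<sigma> i)" if "i \<le> j" "j < n" for i j
      using strictly_decreasing_gap[of n "\<lambda>i. g (\<sigma> i)"] sdec that by blast
    define rho where "rho i = (if i < n then g (\<sigma> i) - stair n i else 0)" for i
    have big: "stair n i \<le> g (\<sigma> i)" if "i < n" for i
    proof -
      have "i \<le> n - 1" "n - 1 < n" using that by auto
      from gap[OF this] show ?thesis by (simp add: stair_def)
    qed
    have rho: "rho i + stair n i = g (\<sigma> i)" if "i < n" for i
      using big[OF that] that by (simp add: rho_def)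
    have rhoP: "rho \<in> Par n"
    proof -
      have "rho j \<le> rho i" if "i \<le> j" for i j
      proof (cases "j < n")
        case True
        then show ?thesis using gap[OF that True] rho[of i] rho[of j] that by (simp add: stair_def)
      qed (simp add: rho_def)
      then show ?thesis by (simp add: Par_def rho_def)
    qed
    have sum_rho: "(\<Sum>i<k. rho i) + (\<Sum>i<k. stair n i) = sum be (\<sigma> ` {..<k}) + sum (stair n) (\<sigma> ` {..<k})"
      if "k \<le> n" for k
    proof -
      have inj: "inj_on \<sigma> {..<k}" by (rule inj_on_subset[OF permutes_inj[OF s]]) simp
      have "(\<Sum>i<k. rho i) + (\<Sum>i<k. stair n i) = (\<Sum>i<k. g (\<sigma> i))"
        unfolding sum.distrib[symmetric] using that by (intro sum.cong refl rho) simp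
      also have "\<dots> = sum g (\<sigma> ` {..<k})" by (simp add: sum.reindex[OF inj])
      finally show ?thesis by (simp add: g_def sum.distrib)
    qed
    have "psize n rho = psize n nu"
      using sum_rho[of n] permutes_image[OF s] rearr_sum[OF be(1), of "\<lambda>x. x"] by (simp add: psize_def)
    moreover have "(\<Sum>i<k. rho i) \<le> (\<Sum>i<k. nu i)" if "k \<le> n" for k
    proof -
      have sub: "\<sigma> ` {..<k} \<subseteq> {..<n}" using \<sigma>n that by auto
      have card: "card (\<sigma> ` {..<k}) = k"
        using card_image[OF inj_on_subset[OF permutes_inj[OF s] subset_UNIV]] by simp
      show ?thesis
        using sum_rho[OF that] rearr_sum_le[OF nu be(1) sub] rearr_sum_le[OF stair_Par rearr_self sub]
        unfolding card by linarith
    qed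
    ultimately have "rho \<in> below n nu" using rhoP by (simp add: below_def dom_le_def)
    moreover have "rho \<noteq> nu"
    proof
      \<comment> \<open>Sorting preserves the sum of squares of \<open>be\<close> plus
        \<open>stair n\<close>. If rho were \<open>nu\<close>, expanding the squares would give
        \<open>be\<close> and \<open>nu\<close> equal scalar products with \<open>stair n\<close>,
        the equality case of the rearrangement inequality.\<close>
      assume "rho = nu"
      then have "(\<Sum>i<n. (nu i + stair n i)\<^sup>2) = (\<Sum>i<n. (g (\<sigma> i))\<^sup>2)"
        using rho by (intro sum.cong) auto
      also have "\<dots> = (\<Sum>i<n. (be i + stair n i)\<^sup>2)"
        using sum.permute[OF s, of "\<lambda>i. (g i)\<^sup>2"] by (simp add: o_def g_def)
      finally have "(\<Sum>i<n. (nu i + stair n i)\<^sup>2) = (\<Sum>i<n. (be i + stair n i)\<^sup>2)" .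
      moreover have "(\<Sum>i<n. (be i)\<^sup>2) = (\<Sum>i<n. (nu i)\<^sup>2)" using rearr_sum[OF be(1)] .
      ultimately have "(\<Sum>i<n. be i * stair n i) = (\<Sum>i<n. nu i * stair n i)"
        by (simp add: power2_sum sum.distrib mult.assoc flip: sum_distrib_left)
      then show False using rearrangement_stair_eq[OF nu be(1)] be(2) by simp
    qed
    ultimately have "rho \<in> sbelow n nu" by (simp add: below_def sbelow_def)
    moreover have "alt n g x = of_int (sign \<sigma>) * alt n (\<lambda>i. rho i + stair n i) x" for x
    proof -
      have "alt n (\<lambda>i. rho i + stair n i) x = alt n (g \<circ> \<sigma>) x"
        by (rule alt_cong) (simp add: rho)
      then show ?thesis by (simp add: alt_comp[OF s] of_int_sign_sq flip: mult.assoc)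
    qed
    ultimately show ?thesis unfolding g_def by blast
  qed
qed

text \<open>The case \<open>be = nu\<close> is left out because its quotient, a Schur polynomial,
  has leading term m_nu. That term comes from solving \<open>alt_stair_mono\<close> for the sorted
  exponent, which the induction does for smaller rho; straightening reduces the unsorted exponents
  of \<open>nu\<close> to these.\<close>

lemma alt_quotient:
  assumes "nu \<in> Par n"
  shows "\<forall>be\<in>rearr n nu. be \<noteq> nu \<longrightarrow> (\<exists>h\<in>msp n (sbelow n nu).
    \<forall>x. inj_on x {..<n} \<longrightarrow> alt n (\<lambda>i. be i + stair n i) x = alt n (stair n) x * h x)"
  using assms
proof (induction rule: dom_induct)
  case (less nu)
  have leading: "\<exists>h\<in>msp n (below n rho).
      \<forall>x. inj_on x {..<n} \<longrightarrow> alt n (\<lambda>i. rho i + stair n i) x = alt n (stair n) x * h x"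
    if rho: "rho \<in> sbelow n nu" for rho
  proof -
    have rhoP: "rho \<in> Par n" using rho by (simp add: sbelow_def)
    from less(2)[OF rho] obtain h where h: "\<And>be. be \<in> rearr n rho \<Longrightarrow> be \<noteq> rho \<Longrightarrow> h be \<in> msp n (sbelow n rho)"
      and hx: "\<And>be x. be \<in> rearr n rho \<Longrightarrow> be \<noteq> rho \<Longrightarrow> inj_on x {..<n} \<Longrightarrow>
         alt n (\<lambda>i. be i + stair n i) x = alt n (stair n) x * h be x"
      by metis
    define H where "H = mono n rho - (\<Sum>be\<in>rearr n rho - {rho}. h be)"
    have "H \<in> msp n (below n rho)" unfolding H_def
    proof (intro msp_diff msp_sum)
      show "mono n rho \<in> msp n (below n rho)"
        using rhoP by (intro msp_base) (simp add: below_def dom_le_refl)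
      show "h be \<in> msp n (below n rho)" if "be \<in> rearr n rho - {rho}" for be
        using h that msp_mono[OF sbelow_subset] by blast
    qed
    moreover have "alt n (\<lambda>i. rho i + stair n i) x = alt n (stair n) x * H x" if x: "inj_on x {..<n}" for x
    proof -
      have "alt n (stair n) x * mono n rho x =
         alt n (\<lambda>i. rho i + stair n i) x + (\<Sum>be\<in>rearr n rho - {rho}. alt n (\<lambda>i. be i + stair n i) x)"
        unfolding alt_stair_mono[OF x] by (rule sum.remove[OF finite_rearr rearr_self])
      also have "(\<Sum>be\<in>rearr n rho - {rho}. alt n (\<lambda>i. be i + stair n i) x) =
          alt n (stair n) x * (\<Sum>be\<in>rearr n rho - {rho}. h be x)"
        unfolding sum_distrib_left using hx x by (intro sum.cong) auto
      finally show ?thesis by (simp add: H_def sum_fun_apply algebra_simps)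
    qed
    ultimately show ?thesis by blast
  qed
  show ?case
  proof (intro ballI impI)
    fix be assume be: "be \<in> rearr n nu" "be \<noteq> nu"
    from straighten[OF less(1) be] show "\<exists>h\<in>msp n (sbelow n nu).
      \<forall>x. inj_on x {..<n} \<longrightarrow> alt n (\<lambda>i. be i + stair n i) x = alt n (stair n) x * h x"
    proof (elim disjE bexE exE)
      assume "\<forall>x. alt n (\<lambda>i. be i + stair n i) x = 0"
      then show ?thesis by (intro bexI[OF _ msp_zero]) simp
    next
      fix rho c assume rho: "rho \<in> sbelow n nu"
        and c: "\<forall>x. alt n (\<lambda>i. be i + stair n i) x = c * alt n (\<lambda>i. rho i + stair n i) x"
      obtain h where h: "h \<in> msp n (below n rho)"
          "\<And>x. inj_on x {..<n} \<Longrightarrow> alt n (\<lambda>i. rho i + stair n i) x = alt n (stair n) x * h x"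
        using leading[OF rho] by blast
      have "scl c h \<in> msp n (sbelow n nu)"
        using msp_scl[OF h(1)] msp_mono[OF below_sbelow[OF less(1) rho]] by blast
      then show ?thesis using h(2) c by (intro bexI[of _ "scl c h"]) (simp_all add: scl_apply)
    qed
  qed
qed

text \<open>Subtracting e_k(hat la) times \<open>alt_stair_mono\<close> cancels the sorted exponent.
  Only unsorted ones remain, and their quotients lie strictly below \<open>la\<close>.\<close>

lemma Dform_mono:
  assumes la: "la \<in> Par n" and k: "k \<le> n"
  obtains h where "h \<in> msp n (sbelow n la)"
    "\<And>x. inj_on x {..<n} \<Longrightarrow> Dform n k (mono n la) x = elem n k (hat n la) * mono n la x + h x"
proof -
  from alt_quotient[OF la] obtain h where h: "\<And>be. be \<in> rearr n la \<Longrightarrow> be \<noteq> la \<Longrightarrow> h be \<in> msp n (sbelow n la)"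
    and hx: "\<And>be x. be \<in> rearr n la \<Longrightarrow> be \<noteq> la \<Longrightarrow> inj_on x {..<n} \<Longrightarrow>
       alt n (\<lambda>i. be i + stair n i) x = alt n (stair n) x * h be x"
    by metis
  define ev where "ev be = elem n k (hat n be)" for be
  define H where "H = (\<Sum>be\<in>rearr n la - {la}. scl (ev be - ev la) (h be))"
  have "H \<in> msp n (sbelow n la)" unfolding H_def using h by (intro msp_sum msp_scl) auto
  moreover have "Dform n k (mono n la) x = elem n k (hat n la) * mono n la x + H x" if x: "inj_on x {..<n}" for x
  proof -
    define V where "V = alt n (stair n) x"
    define a where "a be = alt n (\<lambda>i. be i + stair n i) x" for be
    have "V * Dform n k (mono n la) x = (\<Sum>be\<in>rearr n la. ev be * a be)"
      unfolding V_def a_def ev_def by (rule alt_Dform_mono[OF x k])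
    also have "\<dots> = ev la * (\<Sum>be\<in>rearr n la. a be) + (\<Sum>be\<in>rearr n la. (ev be - ev la) * a be)"
      by (simp add: sum_distrib_left algebra_simps flip: sum.distrib)
    also have "(\<Sum>be\<in>rearr n la. a be) = V * mono n la x"
      unfolding V_def a_def by (rule alt_stair_mono[OF x, symmetric])
    also have "(\<Sum>be\<in>rearr n la. (ev be - ev la) * a be) = (\<Sum>be\<in>rearr n la - {la}. (ev be - ev la) * a be)"
      by (simp add: sum.remove[OF finite_rearr rearr_self])
    also have "\<dots> = V * H x"
      unfolding H_def sum_fun_apply sum_distrib_left
      using hx x by (intro sum.cong) (auto simp: a_def V_def scl_apply)
    finally have "V * Dform n k (mono n la) x = V * (ev la * mono n la x + H x)" by (simp add: algebra_simps)
    then show ?thesis using alt_stair_neq_zero[OF x] by (simp add: V_def ev_def)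
  qed
  ultimately show thesis by (rule that)
qed

section \<open>Well-definedness and linearity of the operators \<open>Dk\<close>\<close>

lemma Dform_add: "Dform n k (f + g) x = Dform n k f x + Dform n k g x"
  by (simp add: Dform_def algebra_simps sum.distrib)

lemma Dform_scl: "Dform n k (scl c f) x = c * Dform n k f x"
  by (simp add: Dform_def scl_apply sum_distrib_left mult_ac)

lemma Dform_zero: "Dform n k 0 x = 0"
  by (simp add: Dform_def)

lemma hat_poly_monom: "hat_poly n la i = monom (monom 1 (la i)) (n - 1 - i)"
proof -
  have "[:[:0, 1::rat:]:] ^ la i = [:monom 1 (la i):]" by (simp add: poly_const_pow monom_altdef)
  moreover have "([:0, 1:] :: rat poly poly) ^ (n - 1 - i) = monom 1 (n - 1 - i)" by (simp add: monom_altdef)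
  ultimately show ?thesis by (simp add: hat_poly_def smult_monom)
qed

text \<open>The powers of t alone separate the coordinates, whatever the exponents of q are; the
  formula for D_k is therefore valid at shifted points that no longer come from partitions.\<close>

lemma inj_hat: "inj_on (hat n la) {..<n}"
proof (rule inj_onI)
  fix i j assume ij: "i \<in> {..<n}" "j \<in> {..<n}" "hat n la i = hat n la j"
  then have e: "hat_poly n la i = hat_poly n la j" by (simp add: hat_to_fract)
  have d: "degree (hat_poly n la i) = n - 1 - i" for i by (simp add: hat_poly_monom degree_monom_eq)
  have "n - 1 - i = n - 1 - j" using e d by metis
  then show "i = j" using ij by auto
qed

text \<open>Makes the description in \<open>Dk\<close> proper: existence extends linearly from
  \<open>Dform_mono\<close>, and uniqueness holds because the test points of
  \<open>Lam_eq_on_hat\<close> have distinct coordinates.\<close>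

lemma Dk_exists:
  assumes "f \<in> Lam n" "k \<le> n"
  shows "\<exists>!g. g \<in> Lam n \<and> (\<forall>x. inj_on x {..<n} \<longrightarrow> g x = Dform n k f x)"
proof (rule ex_ex1I)
  show "\<exists>g. g \<in> Lam n \<and> (\<forall>x. inj_on x {..<n} \<longrightarrow> g x = Dform n k f x)"
    using assms(1) unfolding Lam_eq_msp msp_def
  proof (induction rule: fs.span_induct_alt)
    case base
    show ?case
    proof (intro exI conjI allI impI)
      show "0 \<in> fs.span (mono n ` Par n)" by (rule fs.span_zero)
      show "0 x = Dform n k 0 x" for x by (simp only: Dform_zero zero_fun_apply)
    qed
  next
    case (step c m f)
    then obtain la g where la: "la \<in> Par n" "m = mono n la" and g: "g \<in> msp n (Par n)"
      "\<And>x. inj_on x {..<n} \<Longrightarrow> g x = Dform n k f x" by (auto simp: msp_def)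
    obtain h where h: "h \<in> msp n (sbelow n la)"
      "\<And>x. inj_on x {..<n} \<Longrightarrow> Dform n k (mono n la) x = elem n k (hat n la) * mono n la x + h x"
      using Dform_mono[OF la(1) assms(2)] by metis
    have "h \<in> msp n (Par n)" using h(1) msp_mono[OF sbelow_subset_Par] by blast
    then have *: "scl c (scl (elem n k (hat n la)) (mono n la) + h) + g \<in> msp n (Par n)"
      using la g by (intro msp_add msp_scl msp_base)
    show ?case unfolding la(2)
    proof (intro exI conjI allI impI)
      show "scl c (scl (elem n k (hat n la)) (mono n la) + h) + g \<in> fs.span (mono n ` Par n)"
        by (rule *[unfolded msp_def])
      fix x :: "nat \<Rightarrow> K" assume x: "inj_on x {..<n}"
      show "(scl c (scl (elem n k (hat n la)) (mono n la) + h) + g) x = Dform n k (scl c (mono n la) + f) x"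
        unfolding Dform_add Dform_scl by (simp add: h(2)[OF x] g(2)[OF x] scl_apply)
    qed
  qed
next
  fix g h
  assume g: "g \<in> Lam n \<and> (\<forall>x. inj_on x {..<n} \<longrightarrow> g x = Dform n k f x)"
    and h: "h \<in> Lam n \<and> (\<forall>x. inj_on x {..<n} \<longrightarrow> h x = Dform n k f x)"
  show "g = h"
    by (rule Lam_eq_on_hat[of _ n]) (use g h inj_hat in auto)
qed

lemma Dk_Lam: "f \<in> Lam n \<Longrightarrow> k \<le> n \<Longrightarrow> Dk n k f \<in> Lam n"
  and Dk_apply: "f \<in> Lam n \<Longrightarrow> k \<le> n \<Longrightarrow> inj_on x {..<n} \<Longrightarrow> Dk n k f x = Dform n k f x"
  using theI'[OF Dk_exists] unfolding Dk_def by blast+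

lemma Dk_eqI:
  assumes "f \<in> Lam n" "k \<le> n" "g \<in> Lam n" "\<And>nu. nu \<in> Par n \<Longrightarrow> g (hat n nu) = Dform n k f (hat n nu)"
  shows "Dk n k f = g"
  by (rule Lam_eq_on_hat[OF Dk_Lam[OF assms(1,2)] assms(3)]) (simp add: assms(4) Dk_apply[OF assms(1,2) inj_hat])

lemma Dk_add: "f \<in> Lam n \<Longrightarrow> g \<in> Lam n \<Longrightarrow> k \<le> n \<Longrightarrow> Dk n k (f + g) = Dk n k f + Dk n k g"
  by (rule Dk_eqI) (simp_all add: Lam_add Dk_Lam Dk_apply inj_hat Dform_add del: plus_fun_def)

lemma Dk_scl: "f \<in> Lam n \<Longrightarrow> k \<le> n \<Longrightarrow> Dk n k (scl c f) = scl c (Dk n k f)"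
  by (rule Dk_eqI) (simp_all add: Lam_scl Dk_Lam Dk_apply inj_hat Dform_scl scl_apply)

lemma Dk_mono:
  assumes "la \<in> Par n" "k \<le> n"
  shows "Dk n k (mono n la) - scl (elem n k (hat n la)) (mono n la) \<in> msp n (sbelow n la)"
proof -
  obtain h where h: "h \<in> msp n (sbelow n la)"
    "\<And>x. inj_on x {..<n} \<Longrightarrow> Dform n k (mono n la) x = elem n k (hat n la) * mono n la x + h x"
    using Dform_mono[OF assms] by metis
  have m: "mono n la \<in> Lam n" using assms(1) unfolding Lam_eq_msp by (rule msp_base)
  have hL: "h \<in> Lam n" using h(1) msp_subset_Lam[OF sbelow_subset_Par] by blast
  have "Dk n k (mono n la) = scl (elem n k (hat n la)) (mono n la) + h"
    by (rule Dk_eqI[OF m assms(2)]) (simp_all add: Lam_add[OF Lam_scl[OF m] hL] h(2) inj_hat scl_apply)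
  then show ?thesis using h(1) by simp
qed

section \<open>Commutation with the first Macdonald operator\<close>

text \<open>A polynomial of degree below the number of nodes is its own Lagrange interpolant; the
  sum is the top coefficient of the interpolant.\<close>

lemma lagrange_leading_coeff:
  fixes N :: "'a::field poly"
  assumes "finite A" "degree N < card A"
  shows "(\<Sum>z\<in>A. poly N z / (\<Prod>w\<in>A - {z}. z - w)) = coeff N (card A - 1)"
proof -
  define c where "c z = poly N z / (\<Prod>w\<in>A - {z}. z - w)" for z
  define b where "b z = (\<Prod>w\<in>A - {z}. [:- w, 1:])" for z
  define L where "L = (\<Sum>z\<in>A. smult (c z) (b z))"
  have deg: "degree (b z) = card A - 1" if "z \<in> A" for z
    using that assms(1) by (simp add: b_def degree_prod_eq_sum_degree)
  have lead: "coeff (b z) (card A - 1) = 1" if "z \<in> A" for z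
  proof -
    have "lead_coeff (b z) = 1" by (simp add: b_def lead_coeff_prod)
    then show ?thesis by (simp add: deg[OF that])
  qed
  have "N = L"
  proof (rule poly_eqI_degree)
    fix z assume z: "z \<in> A"
    have "poly L z = (\<Sum>w\<in>A. c w * poly (b w) z)" by (simp add: L_def poly_sum)
    also have "\<dots> = c z * poly (b z) z + (\<Sum>w\<in>A - {z}. c w * poly (b w) z)"
      using assms(1) z by (rule sum.remove)
    also have "(\<Sum>w\<in>A - {z}. c w * poly (b w) z) = 0"
    proof (rule sum.neutral, rule ballI)
      fix w assume "w \<in> A - {z}"
      then have "poly (b w) z = 0" using assms(1) z by (auto simp: b_def poly_prod)
      then show "c w * poly (b w) z = 0" by simp
    qed
    also have "poly (b z) z = (\<Prod>w\<in>A - {z}. z - w)" by (simp add: b_def poly_prod)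
    also have "c z * \<dots> + 0 = poly N z" using assms(1) by (simp add: c_def)
    finally show "poly N z = poly L z" by simp
  next
    show "degree L < card A" unfolding L_def
    proof (rule le_less_trans)
      show "degree (\<Sum>z\<in>A. smult (c z) (b z)) \<le> card A - 1"
        using assms(1) deg by (intro degree_sum_le order_trans[OF degree_smult_le]) auto
      show "card A - 1 < card A" using assms(2) by simp
    qed
  qed (rule assms(2))
  then have "coeff N (card A - 1) = (\<Sum>z\<in>A. c z * coeff (b z) (card A - 1))"
    by (simp add: L_def coeff_sum)
  also have "\<dots> = (\<Sum>z\<in>A. c z)" using lead by simp
  finally show ?thesis by (simp add: c_def)
qed

definition rfac :: "'a::field \<Rightarrow> 'a \<Rightarrow> 'a \<Rightarrow> 'a" where
  "rfac t u v = (t * u - v) / (u - v)"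

text \<open>The interpolation nodes are \<open>0\<close>, \<open>x a\<close> and \<open>q x a\<close>; the node \<open>0\<close> alone accounts for the
  leading coefficient, so the other two families of terms cancel.\<close>

lemma rfac_exchange:
  fixes x :: "'b \<Rightarrow> 'a::field" and q t :: 'a
  assumes fin: "finite U" and inj: "inj_on x U" and x0: "\<And>a. a \<in> U \<Longrightarrow> x a \<noteq> 0"
    and qx: "\<And>a b. a \<in> U \<Longrightarrow> b \<in> U \<Longrightarrow> x a \<noteq> q * x b"
    and qt: "q \<noteq> 0" "q \<noteq> 1" "t \<noteq> 1" "t \<noteq> q"
  shows "(\<Sum>i\<in>U. \<Prod>a\<in>U - {i}. rfac t (x a) (x i) * rfac t (x i) (q * x a)) =
    (\<Sum>i\<in>U. \<Prod>a\<in>U - {i}. rfac t (x i) (x a) * rfac t (x a) (q * x i))"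
proof -
  define X where "X = x ` U"
  define Y where "Y = (\<lambda>a. q * x a) ` U"
  define A where "A = insert 0 (X \<union> Y)"
  \<comment> \<open>Chosen so that the Lagrange terms at x_i and at q x_i factor into the two
    products to be compared. Its degree is at most 2 card U, one less than the number of
    nodes.\<close>
  define N where "N = (\<Prod>a\<in>U. [:- t * x a, 1:] * [:- q * x a, t:])"
  \<comment> \<open>What the index a = i contributes together with the node 0; at q x_i the same
    quantity appears with the opposite sign. The conditions on q and t make it nonzero.\<close>
  define C where "C = (1 - t) * (t - q) / (1 - q)"
  have injY: "inj_on (\<lambda>a. q * x a) U" using inj qt(1) by (auto simp: inj_on_def)
  have fX: "finite X" "finite Y" using fin by (auto simp: X_def Y_def)
  have disj: "X \<inter> Y = {}" "0 \<notin> X" "0 \<notin> Y"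
    using qx x0 qt(1) by (auto simp: X_def Y_def)
  have cX: "card X = card U" "card Y = card U"
    using inj injY by (simp_all add: X_def Y_def card_image)
  have cA: "card A = Suc (2 * card U)"
    using fX disj by (simp add: A_def card_Un_disjoint cX)
  have polyN: "poly N z = (\<Prod>a\<in>U. (z - t * x a) * (t * z - q * x a))" for z
    by (auto simp: N_def poly_prod algebra_simps intro!: prod.cong)
  have N: "degree N \<le> 2 * card U \<and> coeff N (2 * card U) = t ^ card U"
    unfolding N_def using fin
  proof (induction U)
    case (insert a U)
    define p where "p = [:- t * x a, 1:] * [:- q * x a, t:]"
    define M where "M = (\<Prod>a\<in>U. [:- t * x a, 1:] * [:- q * x a, t:])"
    have p: "degree p \<le> 2" "coeff p 2 = t"
      by (simp_all add: p_def numeral_2_eq_2 degree_pCons_le)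
    have M: "degree M \<le> 2 * card U" "coeff M (2 * card U) = t ^ card U"
      using insert.IH by (simp_all add: M_def)
    have "degree (p * M) \<le> 2 + 2 * card U"
      by (rule order_trans[OF degree_mult_le]) (use p M in linarith)
    moreover have "coeff (p * M) (2 + 2 * card U) = t * t ^ card U"
    proof -
      have "coeff (p * M) (2 + 2 * card U) = (\<Sum>i\<le>2 + 2 * card U. coeff p i * coeff M (2 + 2 * card U - i))"
        by (rule coeff_mult)
      also have "\<dots> = (\<Sum>i\<in>{2}. coeff p i * coeff M (2 + 2 * card U - i))"
      proof (rule sum.mono_neutral_right)
        show "\<forall>i\<in>{..2 + 2 * card U} - {2}. coeff p i * coeff M (2 + 2 * card U - i) = 0"
        proof
          fix i assume "i \<in> {..2 + 2 * card U} - {2}"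
          then consider "i > degree p" | "2 + 2 * card U - i > degree M" using p(1) M(1) by force
          then show "coeff p i * coeff M (2 + 2 * card U - i) = 0" by cases (auto simp: coeff_eq_0)
        qed
      qed auto
      finally show ?thesis using p M by simp
    qed
    ultimately show ?case using insert.hyps by (simp add: p_def M_def)
  qed simp
  define T where "T z = poly N z / (\<Prod>w\<in>A - {z}. z - w)" for z
  have "t ^ card U = (\<Sum>z\<in>A. T z)"
    using lagrange_leading_coeff[of A N] N fX cA by (simp add: A_def T_def)
  also have "\<dots> = T 0 + ((\<Sum>z\<in>X. T z) + (\<Sum>z\<in>Y. T z))"
    using fX disj by (simp add: A_def sum.union_disjoint)
  also have "(\<Sum>z\<in>X. T z) = (\<Sum>i\<in>U. T (x i))" by (simp add: X_def sum.reindex[OF inj])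
  also have "(\<Sum>z\<in>Y. T z) = (\<Sum>i\<in>U. T (q * x i))" by (simp add: Y_def sum.reindex[OF injY])
  also have "T 0 = t ^ card U"
  proof -
    have "A - {0} = X \<union> Y" using disj by (auto simp: A_def)
    then have "(\<Prod>w\<in>A - {0}. 0 - w) = (\<Prod>a\<in>U. (- x a) * (- (q * x a)))"
      unfolding prod.distrib using fX disj
      by (simp add: prod.union_disjoint X_def Y_def prod.reindex[OF inj] prod.reindex[OF injY])
    moreover have "poly N 0 = (\<Prod>a\<in>U. t * ((- x a) * (- (q * x a))))"
      by (simp add: polyN mult_ac)
    moreover have "(\<Prod>a\<in>U. (- x a) * (- (q * x a))) \<noteq> 0" using fin x0 qt(1) by simp
    ultimately show ?thesis by (simp add: T_def prod.distrib)
  qed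
  finally have zero: "(\<Sum>i\<in>U. T (x i)) + (\<Sum>i\<in>U. T (q * x i)) = 0" by simp
  have TX: "T (x i) = C * (\<Prod>a\<in>U - {i}. rfac t (x a) (x i) * rfac t (x i) (q * x a))" if i: "i \<in> U" for i
  proof -
    have "A - {x i} = insert 0 (x ` (U - {i}) \<union> Y)"
      using disj i x0[OF i] inj by (auto simp: A_def X_def inj_on_def)
    moreover have "0 \<notin> x ` (U - {i}) \<union> Y" "x ` (U - {i}) \<inter> Y = {}" using disj by (auto simp: X_def)
    moreover have "inj_on x (U - {i})" using inj by (rule inj_on_subset) auto
    ultimately have "(\<Prod>w\<in>A - {x i}. x i - w) =
        x i * ((\<Prod>a\<in>U - {i}. x i - x a) * (\<Prod>a\<in>U. x i - q * x a))"
      using fX fin by (simp add: prod.union_disjoint prod.reindex Y_def injY)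
    also have "(\<Prod>a\<in>U. x i - q * x a) = (x i - q * x i) * (\<Prod>a\<in>U - {i}. x i - q * x a)"
      using fin i by (rule prod.remove)
    finally have "(\<Prod>w\<in>A - {x i}. x i - w) =
        x i * (x i - q * x i) * (\<Prod>a\<in>U - {i}. (x i - x a) * (x i - q * x a))"
      by (simp add: prod.distrib mult_ac)
    moreover have "poly N (x i) = (x i - t * x i) * (t * x i - q * x i) *
        (\<Prod>a\<in>U - {i}. (x i - t * x a) * (t * x i - q * x a))"
      unfolding polyN using fin i by (rule prod.remove)
    ultimately have "T (x i) = (x i - t * x i) * (t * x i - q * x i) / (x i * (x i - q * x i)) *
        (\<Prod>a\<in>U - {i}. ((x i - t * x a) * (t * x i - q * x a)) / ((x i - x a) * (x i - q * x a)))"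
      by (simp add: T_def prod_dividef)
    also have "(x i - t * x i) * (t * x i - q * x i) / (x i * (x i - q * x i)) = C"
    proof -
      have "(x i - t * x i) * (t * x i - q * x i) = x i * x i * ((1 - t) * (t - q))"
        and "x i * (x i - q * x i) = x i * x i * (1 - q)" by (simp_all add: algebra_simps)
      then show ?thesis using x0[OF i] by (simp add: C_def)
    qed
    also have "(\<Prod>a\<in>U - {i}. ((x i - t * x a) * (t * x i - q * x a)) / ((x i - x a) * (x i - q * x a))) =
        (\<Prod>a\<in>U - {i}. rfac t (x a) (x i) * rfac t (x i) (q * x a))"
    proof (rule prod.cong[OF refl])
      fix a
      have "(x i - t * x a) / (x i - x a) = rfac t (x a) (x i)"
        unfolding rfac_def by (metis minus_diff_eq minus_divide_divide)
      then show "((x i - t * x a) * (t * x i - q * x a)) / ((x i - x a) * (x i - q * x a)) =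
          rfac t (x a) (x i) * rfac t (x i) (q * x a)"
        by (simp only: times_divide_times_eq[symmetric] rfac_def[of t "x i" "q * x a"])
    qed
    finally show ?thesis .
  qed
  have TY: "T (q * x i) = - C * (\<Prod>a\<in>U - {i}. rfac t (x i) (x a) * rfac t (x a) (q * x i))" if i: "i \<in> U" for i
  proof -
    let ?y = "\<lambda>a. q * x a"
    have "A - {q * x i} = insert 0 (X \<union> ?y ` (U - {i}))"
      using disj i x0[OF i] qt(1) injY by (auto simp: A_def Y_def inj_on_def)
    moreover have "0 \<notin> X \<union> ?y ` (U - {i})" "X \<inter> ?y ` (U - {i}) = {}" using disj by (auto simp: Y_def)
    moreover have "inj_on ?y (U - {i})" using injY by (rule inj_on_subset) auto
    ultimately have "(\<Prod>w\<in>A - {q * x i}. q * x i - w) =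
        q * x i * ((\<Prod>a\<in>U. q * x i - x a) * (\<Prod>a\<in>U - {i}. q * x i - q * x a))"
      using fX fin by (simp add: prod.union_disjoint prod.reindex X_def inj)
    also have "(\<Prod>a\<in>U. q * x i - x a) = (q * x i - x i) * (\<Prod>a\<in>U - {i}. q * x i - x a)"
      using fin i by (rule prod.remove)
    finally have "(\<Prod>w\<in>A - {q * x i}. q * x i - w) =
        q * x i * (q * x i - x i) * (\<Prod>a\<in>U - {i}. (q * x i - x a) * (q * x i - q * x a))"
      by (simp add: prod.distrib mult_ac)
    moreover have "poly N (q * x i) = (q * x i - t * x i) * (t * (q * x i) - q * x i) *
        (\<Prod>a\<in>U - {i}. (q * x i - t * x a) * (t * (q * x i) - q * x a))"
      unfolding polyN using fin i by (rule prod.remove)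
    ultimately have "T (q * x i) = (q * x i - t * x i) * (t * (q * x i) - q * x i) / (q * x i * (q * x i - x i)) *
        (\<Prod>a\<in>U - {i}. ((q * x i - t * x a) * (t * (q * x i) - q * x a)) / ((q * x i - x a) * (q * x i - q * x a)))"
      by (simp add: T_def prod_dividef)
    also have "(q * x i - t * x i) * (t * (q * x i) - q * x i) / (q * x i * (q * x i - x i)) = - C"
    proof -
      have "(q * x i - t * x i) * (t * (q * x i) - q * x i) = q * x i * x i * ((1 - t) * (t - q))"
        and "q * x i * (q * x i - x i) = - (q * x i * x i * (1 - q))" by (simp_all add: algebra_simps)
      then show ?thesis using x0[OF i] qt(1) by (simp add: C_def)
    qed
    also have "(\<Prod>a\<in>U - {i}. ((q * x i - t * x a) * (t * (q * x i) - q * x a)) / ((q * x i - x a) * (q * x i - q * x a))) =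
        (\<Prod>a\<in>U - {i}. rfac t (x i) (x a) * rfac t (x a) (q * x i))"
    proof (rule prod.cong[OF refl])
      fix a
      have "(q * x i - t * x a) / (q * x i - x a) = rfac t (x a) (q * x i)"
        unfolding rfac_def by (metis minus_diff_eq minus_divide_divide)
      moreover have "(t * (q * x i) - q * x a) / (q * x i - q * x a) = rfac t (x i) (x a)"
      proof -
        have "t * (q * x i) - q * x a = q * (t * x i - x a)" "q * x i - q * x a = q * (x i - x a)"
          by (simp_all add: algebra_simps)
        then show ?thesis using qt(1) by (simp add: rfac_def)
      qed
      ultimately show "((q * x i - t * x a) * (t * (q * x i) - q * x a)) / ((q * x i - x a) * (q * x i - q * x a)) =
          rfac t (x i) (x a) * rfac t (x a) (q * x i)"
        by (simp only: times_divide_times_eq[symmetric] mult.commute)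
    qed
    finally show ?thesis .
  qed
  have "C * ((\<Sum>i\<in>U. \<Prod>a\<in>U - {i}. rfac t (x a) (x i) * rfac t (x i) (q * x a)) -
      (\<Sum>i\<in>U. \<Prod>a\<in>U - {i}. rfac t (x i) (x a) * rfac t (x a) (q * x i))) = 0"
    using zero by (simp add: TX TY sum_distrib_left sum_negf right_diff_distrib)
  moreover have "C \<noteq> 0" using qt by (simp add: C_def)
  ultimately show ?thesis by simp
qed

section \<open>The operators on the lattice of points \<open>hat\<close>\<close>

definition shift :: "(nat \<Rightarrow> nat) \<Rightarrow> nat set \<Rightarrow> nat \<Rightarrow> nat" where
  "shift l S = (\<lambda>i. if i \<in> S then Suc (l i) else l i)"

text \<open>The coefficient of the S-term of D_k at \<open>hat n l\<close>, without the power of t.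
  With \<open>shift\<close> it turns D_k into a difference operator on exponent vectors, which need
  not be partitions.\<close>

definition Dcoef :: "nat \<Rightarrow> nat set \<Rightarrow> (nat \<Rightarrow> nat) \<Rightarrow> K" where
  "Dcoef n S l = (\<Prod>i\<in>S. \<Prod>j\<in>{..<n} - S. rfac tt (hat n l i) (hat n l j))"

definition ksub :: "nat \<Rightarrow> nat \<Rightarrow> nat set set" where
  "ksub n k = {S. S \<subseteq> {..<n} \<and> card S = k}"

lemma finite_ksub: "finite (ksub n k)"
  unfolding ksub_def by simp

lemma hat_shift: "i < n \<Longrightarrow> hat n (shift l S) i = (if i \<in> S then qq * hat n l i else hat n l i)"
  by (simp add: hat_def shift_def)

lemma Dform_hat:
  "Dform n k f (hat n l) = tt ^ (k * (k - 1) div 2) * (\<Sum>S\<in>ksub n k. Dcoef n S l * f (hat n (shift l S)))"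
proof -
  have "(\<lambda>i. if i \<in> S then qq * hat n l i else hat n l i) = hat n (shift l S)" if "S \<in> ksub n k" for S
    using that by (auto simp: ksub_def hat_def shift_def)
  then show ?thesis by (simp add: Dform_def Dcoef_def rfac_def ksub_def)
qed

lemma Dform_one_hat: "Dform n 1 f (hat n l) = (\<Sum>i<n. Dcoef n {i} l * f (hat n (shift l {i})))"
proof -
  have "ksub n 1 = (\<lambda>i. {i}) ` {..<n}" by (auto simp: ksub_def card_1_singleton_iff)
  then show ?thesis by (simp add: Dform_hat sum.reindex)
qed

text \<open>Provides the distinct nodes for \<open>rfac_exchange\<close>: powers of t separate
  different indices, and for equal indices the powers of q differ.\<close>

lemma hat_generic: "i < n \<Longrightarrow> hat n l i \<noteq> 0" "i < n \<Longrightarrow> j < n \<Longrightarrow> hat n l i \<noteq> qq * hat n l j"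
proof -
  show "i < n \<Longrightarrow> hat n l i \<noteq> 0" for i by (simp add: hat_to_fract hat_poly_monom)
  assume ij: "i < n" "j < n"
  have "qq * hat n l j = hat n (shift l {j}) j" using ij by (simp add: hat_shift)
  also have "hat n l i \<noteq> \<dots>"
  proof
    assume "hat n l i = hat n (shift l {j}) j"
    then have e: "monom (monom (1::rat) (l i)) (n - 1 - i) = monom (monom 1 (Suc (l j))) (n - 1 - j)"
      using ij by (simp add: hat_to_fract hat_poly_monom shift_def)
    then have "n - 1 - i = n - 1 - j" by (metis degree_monom_eq monom_eq_0_iff one_neq_zero)
    then have "i = j" using ij by simp
    then have "monom (1::rat) (l j) = monom 1 (Suc (l j))" using e by simp
    then show False by (metis degree_monom_eq n_not_Suc_n one_neq_zero)
  qed
  finally show "hat n l i \<noteq> qq * hat n l j" .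
qed

lemma qt_generic: "qq \<noteq> 0" "qq \<noteq> 1" "tt \<noteq> 1" "tt \<noteq> qq"
proof -
  have 1: "to_fract 1 = (1 :: K)" by simp
  show "qq \<noteq> 0" by (simp add: qq_to_fract)
  show "qq \<noteq> 1" "tt \<noteq> 1" "tt \<noteq> qq"
    unfolding qq_to_fract tt_to_fract 1[symmetric] to_fract_eq_iff by (simp_all add: one_pCons)
qed

text \<open>A factor between i and another element of S sees both coordinates multiplied by q, and
  \<open>rfac\<close> is homogeneous of degree zero. So these terms of the two compositions agree
  one by one.\<close>

lemma Dcoef_shift_inside:
  assumes S: "S \<subseteq> {..<n}" and i: "i \<in> S"
  shows "Dcoef n S l * Dcoef n {i} (shift l S) = Dcoef n {i} l * Dcoef n S (shift l {i})"
proof -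
  let ?x = "hat n l"
  have fin: "finite S" using S by (rule finite_subset) simp
  have split: "(\<Prod>j\<in>{..<n} - {i}. h j) = (\<Prod>j\<in>S - {i}. h j) * (\<Prod>j\<in>{..<n} - S. h j)" for h :: "nat \<Rightarrow> K"
  proof -
    have "{..<n} - {i} = (S - {i}) \<union> ({..<n} - S)" using S i by auto
    then show ?thesis using fin by (subst prod.union_disjoint[symmetric]) auto
  qed
  have scale: "rfac tt (qq * u) (qq * v) = rfac tt u v" for u v
  proof -
    have "tt * (qq * u) - qq * v = qq * (tt * u - v)" "qq * u - qq * v = qq * (u - v)"
      by (simp_all add: algebra_simps)
    then show ?thesis using qt_generic(1) by (simp add: rfac_def)
  qed
  have *: "S - {i} \<subseteq> {..<n}" "i < n" using S i by auto
  have 1: "Dcoef n {i} (shift l S) =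
     (\<Prod>j\<in>S - {i}. rfac tt (?x i) (?x j)) * (\<Prod>j\<in>{..<n} - S. rfac tt (qq * ?x i) (?x j))"
    unfolding Dcoef_def split using i * by (auto simp: hat_shift scale subset_iff intro!: arg_cong2[where f = "(*)"] prod.cong)
  have 2: "Dcoef n {i} l = (\<Prod>j\<in>S - {i}. rfac tt (?x i) (?x j)) * (\<Prod>j\<in>{..<n} - S. rfac tt (?x i) (?x j))"
    unfolding Dcoef_def split by simp
  have 3: "Dcoef n S l = (\<Prod>j\<in>{..<n} - S. rfac tt (?x i) (?x j)) *
      (\<Prod>a\<in>S - {i}. \<Prod>j\<in>{..<n} - S. rfac tt (?x a) (?x j))"
    unfolding Dcoef_def using fin i by (rule prod.remove)
  have "Dcoef n S (shift l {i}) = (\<Prod>j\<in>{..<n} - S. rfac tt (hat n (shift l {i}) i) (hat n (shift l {i}) j)) *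
      (\<Prod>a\<in>S - {i}. \<Prod>j\<in>{..<n} - S. rfac tt (hat n (shift l {i}) a) (hat n (shift l {i}) j))"
    unfolding Dcoef_def using fin i by (rule prod.remove)
  also have "\<dots> = (\<Prod>j\<in>{..<n} - S. rfac tt (qq * ?x i) (?x j)) *
      (\<Prod>a\<in>S - {i}. \<Prod>j\<in>{..<n} - S. rfac tt (?x a) (?x j))"
    using i * by (auto simp: hat_shift subset_iff intro!: arg_cong2[where f = "(*)"] prod.cong)
  finally show ?thesis unfolding 1 2 3 by (simp add: mult_ac)
qed

text \<open>Here S is U without i. Both orders share the factor \<open>Dcoef n U l\<close>; the
  remaining products are those of \<open>rfac_exchange\<close>, which balance after summation over i
  in U.\<close>

lemma Dcoef_shift_outside:
  assumes U: "U \<subseteq> {..<n}" and i: "i \<in> U"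
  shows "Dcoef n (U - {i}) l * Dcoef n {i} (shift l (U - {i})) =
      Dcoef n U l * (\<Prod>a\<in>U - {i}. rfac tt (hat n l a) (hat n l i) * rfac tt (hat n l i) (qq * hat n l a))"
    and "Dcoef n {i} l * Dcoef n (U - {i}) (shift l {i}) =
      Dcoef n U l * (\<Prod>a\<in>U - {i}. rfac tt (hat n l i) (hat n l a) * rfac tt (hat n l a) (qq * hat n l i))"
proof -
  let ?x = "hat n l"
  have fin: "finite U" using U by (rule finite_subset) simp
  have *: "U - {i} \<subseteq> {..<n}" "i < n" using U i by auto
  have split: "(\<Prod>j\<in>{..<n} - {i}. h j) = (\<Prod>j\<in>U - {i}. h j) * (\<Prod>j\<in>{..<n} - U. h j)" for h :: "nat \<Rightarrow> K"
  proof -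
    have "{..<n} - {i} = (U - {i}) \<union> ({..<n} - U)" using U i by auto
    then show ?thesis using fin by (subst prod.union_disjoint[symmetric]) auto
  qed
  have split': "(\<Prod>j\<in>{..<n} - (U - {i}). h j) = h i * (\<Prod>j\<in>{..<n} - U. h j)" for h :: "nat \<Rightarrow> K"
  proof -
    have "{..<n} - (U - {i}) = insert i ({..<n} - U)" using U i by auto
    then show ?thesis using i by simp
  qed
  have 0: "Dcoef n U l = (\<Prod>j\<in>{..<n} - U. rfac tt (?x i) (?x j)) *
      (\<Prod>a\<in>U - {i}. \<Prod>j\<in>{..<n} - U. rfac tt (?x a) (?x j))"
    unfolding Dcoef_def using fin i by (rule prod.remove)
  have 1: "Dcoef n (U - {i}) l = (\<Prod>a\<in>U - {i}. rfac tt (?x a) (?x i)) *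
      (\<Prod>a\<in>U - {i}. \<Prod>j\<in>{..<n} - U. rfac tt (?x a) (?x j))"
    unfolding Dcoef_def split' prod.distrib ..
  have 2: "Dcoef n {i} (shift l (U - {i})) =
     (\<Prod>j\<in>U - {i}. rfac tt (?x i) (qq * ?x j)) * (\<Prod>j\<in>{..<n} - U. rfac tt (?x i) (?x j))"
    unfolding Dcoef_def split using i *
    by (auto simp: hat_shift subset_iff intro!: arg_cong2[where f = "(*)"] prod.cong)
  have 3: "Dcoef n {i} l = (\<Prod>j\<in>U - {i}. rfac tt (?x i) (?x j)) * (\<Prod>j\<in>{..<n} - U. rfac tt (?x i) (?x j))"
    unfolding Dcoef_def split by simp
  have 4: "Dcoef n (U - {i}) (shift l {i}) = (\<Prod>a\<in>U - {i}. rfac tt (?x a) (qq * ?x i)) *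
      (\<Prod>a\<in>U - {i}. \<Prod>j\<in>{..<n} - U. rfac tt (?x a) (?x j))"
    unfolding Dcoef_def split' prod.distrib using i *
    by (auto simp: hat_shift subset_iff intro!: arg_cong2[where f = "(*)"] prod.cong)
  show "Dcoef n (U - {i}) l * Dcoef n {i} (shift l (U - {i})) =
      Dcoef n U l * (\<Prod>a\<in>U - {i}. rfac tt (?x a) (?x i) * rfac tt (?x i) (qq * ?x a))"
    unfolding 0 1 2 prod.distrib by (simp only: mult_ac)
  show "Dcoef n {i} l * Dcoef n (U - {i}) (shift l {i}) =
      Dcoef n U l * (\<Prod>a\<in>U - {i}. rfac tt (?x i) (?x a) * rfac tt (?x a) (qq * ?x i))"
    unfolding 0 3 4 prod.distrib by (simp only: mult_ac)
qed

text \<open>Pairs (S, i) with i outside S are regrouped by the union U of S and i.\<close>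

lemma ksub_extend:
  fixes F :: "nat set \<Rightarrow> nat \<Rightarrow> 'a::comm_monoid_add"
  shows "(\<Sum>S\<in>ksub n k. \<Sum>i<n. F S i) =
    (\<Sum>S\<in>ksub n k. \<Sum>i\<in>S. F S i) + (\<Sum>U\<in>ksub n (Suc k). \<Sum>i\<in>U. F (U - {i}) i)"
proof -
  have fin: "finite S" if "S \<in> ksub n k" for S k
    using that by (auto simp: ksub_def intro: finite_subset)
  have "(\<Sum>S\<in>ksub n k. \<Sum>i<n. F S i) = (\<Sum>S\<in>ksub n k. (\<Sum>i\<in>S. F S i) + (\<Sum>i\<in>{..<n} - S. F S i))"
  proof (rule sum.cong[OF refl])
    fix S assume S: "S \<in> ksub n k"
    then have "{..<n} = S \<union> ({..<n} - S)" by (auto simp: ksub_def)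
    then show "(\<Sum>i<n. F S i) = (\<Sum>i\<in>S. F S i) + (\<Sum>i\<in>{..<n} - S. F S i)"
      using fin[OF S] by (subst sum.union_disjoint[symmetric]) auto
  qed
  also have "\<dots> = (\<Sum>S\<in>ksub n k. \<Sum>i\<in>S. F S i) + (\<Sum>S\<in>ksub n k. \<Sum>i\<in>{..<n} - S. F S i)"
    by (rule sum.distrib)
  also have "(\<Sum>S\<in>ksub n k. \<Sum>i\<in>{..<n} - S. F S i) = (\<Sum>(S, i)\<in>(SIGMA S:ksub n k. {..<n} - S). F S i)"
    by (rule sum.Sigma) (auto simp: finite_ksub)
  also have "\<dots> = (\<Sum>(U, i)\<in>(SIGMA U:ksub n (Suc k). U). F (U - {i}) i)"
  proof (rule sum.reindex_bij_witness[where i = "\<lambda>(U, i). (U - {i}, i)" and j = "\<lambda>(S, i). (insert i S, i)"], goal_cases)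
    case (1 a)
    then show ?case by (cases a) simp
  next
    case (2 a)
    then obtain S i where a: "a = (S, i)" "S \<in> ksub n k" "i < n" "i \<notin> S" by auto
    have "finite S" by (rule fin[OF a(2)])
    then show ?case using a by (simp add: ksub_def)
  next
    case (3 b)
    then show ?case by (cases b) (simp add: insert_absorb)
  next
    case (4 b)
    then show ?case by (cases b) (auto simp: ksub_def)
  next
    case (5 a)
    then show ?case by (cases a) simp
  qed
  also have "\<dots> = (\<Sum>U\<in>ksub n (Suc k). \<Sum>i\<in>U. F (U - {i}) i)"
    by (rule sum.Sigma[symmetric]) (use finite_ksub fin in blast)+
  finally show ?thesis .
qed

lemma shift_twice:
  "i \<in> S \<Longrightarrow> shift (shift l S) {i} = shift (shift l {i}) S"
  "i \<notin> S \<Longrightarrow> shift (shift l S) {i} = shift l (insert i S)"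
  "i \<notin> S \<Longrightarrow> shift (shift l {i}) S = shift l (insert i S)"
  by (auto simp: shift_def)

text \<open>At a lattice point both compositions are sums over pairs (S, i). Pairs with i in S match
  termwise; the others match after grouping by U, which is where the exchange identity
  enters.\<close>

lemma Dk_commute:
  assumes n: "1 \<le> n" and k: "k \<le> n" and f: "f \<in> Lam n"
  shows "Dk n k (Dk n 1 f) = Dk n 1 (Dk n k f)"
proof (rule Lam_eq_on_hat)
  show "Dk n k (Dk n 1 f) \<in> Lam n" "Dk n 1 (Dk n k f) \<in> Lam n" using n k f by (simp_all add: Dk_Lam)
  fix l
  define c where "c = tt ^ (k * (k - 1) div 2)"
  define F where "F S i = Dcoef n S l * Dcoef n {i} (shift l S) * f (hat n (shift (shift l S) {i}))" for S i
  define G where "G S i = Dcoef n {i} l * Dcoef n S (shift l {i}) * f (hat n (shift (shift l {i}) S))" for S i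
  have "Dk n k (Dk n 1 f) (hat n l) = c * (\<Sum>S\<in>ksub n k. Dcoef n S l * Dk n 1 f (hat n (shift l S)))"
    by (simp only: Dk_apply[OF Dk_Lam[OF f n] k inj_hat] Dform_hat c_def)
  also have "\<dots> = c * (\<Sum>S\<in>ksub n k. \<Sum>i<n. F S i)"
    by (simp only: Dk_apply[OF f n inj_hat] Dform_one_hat F_def sum_distrib_left mult.assoc)
  also have "(\<Sum>S\<in>ksub n k. \<Sum>i<n. F S i) = (\<Sum>S\<in>ksub n k. \<Sum>i<n. G S i)"
    unfolding ksub_extend
  proof (rule arg_cong2[where f = "(+)"])
    show "(\<Sum>S\<in>ksub n k. \<Sum>i\<in>S. F S i) = (\<Sum>S\<in>ksub n k. \<Sum>i\<in>S. G S i)"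
      by (intro sum.cong refl) (auto simp: F_def G_def ksub_def Dcoef_shift_inside shift_twice)
    show "(\<Sum>U\<in>ksub n (Suc k). \<Sum>i\<in>U. F (U - {i}) i) = (\<Sum>U\<in>ksub n (Suc k). \<Sum>i\<in>U. G (U - {i}) i)"
    proof (rule sum.cong[OF refl])
      fix U assume "U \<in> ksub n (Suc k)"
      then have U: "U \<subseteq> {..<n}" and fin: "finite U" by (auto simp: ksub_def intro: finite_subset)
      let ?x = "hat n l"
      have "(\<Sum>i\<in>U. F (U - {i}) i) = Dcoef n U l * f (hat n (shift l U)) *
          (\<Sum>i\<in>U. \<Prod>a\<in>U - {i}. rfac tt (?x a) (?x i) * rfac tt (?x i) (qq * ?x a))"
        unfolding sum_distrib_left F_def
        by (intro sum.cong refl) (simp add: Dcoef_shift_outside(1)[OF U] shift_twice insert_absorb mult_ac)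
      also have "(\<Sum>i\<in>U. \<Prod>a\<in>U - {i}. rfac tt (?x a) (?x i) * rfac tt (?x i) (qq * ?x a)) =
          (\<Sum>i\<in>U. \<Prod>a\<in>U - {i}. rfac tt (?x i) (?x a) * rfac tt (?x a) (qq * ?x i))"
        using U by (intro rfac_exchange fin inj_on_subset[OF inj_hat U] qt_generic hat_generic) auto
      also have "Dcoef n U l * f (hat n (shift l U)) * \<dots> = (\<Sum>i\<in>U. G (U - {i}) i)"
        unfolding sum_distrib_left G_def
        by (intro sum.cong refl) (simp add: Dcoef_shift_outside(2)[OF U] shift_twice insert_absorb mult_ac)
      finally show "(\<Sum>i\<in>U. F (U - {i}) i) = (\<Sum>i\<in>U. G (U - {i}) i)" .
    qed
  qed
  also have "c * (\<Sum>S\<in>ksub n k. \<Sum>i<n. G S i) = Dk n 1 (Dk n k f) (hat n l)"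
  proof -
    have "Dk n 1 (Dk n k f) (hat n l) = (\<Sum>i<n. Dcoef n {i} l * Dk n k f (hat n (shift l {i})))"
      by (simp only: Dk_apply[OF Dk_Lam[OF f k] n inj_hat] Dform_one_hat)
    also have "\<dots> = (\<Sum>i<n. \<Sum>S\<in>ksub n k. c * G S i)"
      by (simp add: Dk_apply[OF f k inj_hat] Dform_hat c_def G_def sum_distrib_left mult_ac)
    also have "\<dots> = c * (\<Sum>S\<in>ksub n k. \<Sum>i<n. G S i)"
      unfolding sum_distrib_left by (rule sum.swap)
    finally show ?thesis ..
  qed
  finally show "Dk n k (Dk n 1 f) (hat n l) = Dk n 1 (Dk n k f) (hat n l)" .
qed

section \<open>Macdonald polynomials\<close>

definition ev :: "nat \<Rightarrow> (nat \<Rightarrow> nat) \<Rightarrow> K" where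
  "ev n la = elem n 1 (hat n la)"

text \<open>The coefficient of t^(n-1-j) in the eigenvalue is q^(la j), so the parts can be read
  off.\<close>

lemma ev_distinct:
  assumes "1 \<le> n" "la \<in> Par n" "mu \<in> Par n" "ev n la = ev n mu"
  shows "la = mu"
proof
  have ev: "ev n la = to_fract (\<Sum>i<n. hat_poly n la i)" for la
  proof -
    have "ksub n 1 = (\<lambda>i. {i}) ` {..<n}" by (auto simp: ksub_def card_1_singleton_iff)
    then have "ev n la = (\<Sum>i<n. hat n la i)"
      unfolding ev_def elem_sum_subsets[OF assms(1)] ksub_def[symmetric] by (simp add: sum.reindex)
    then show ?thesis by (simp add: hat_to_fract)
  qed
  have c: "coeff (\<Sum>i<n. hat_poly n la i) (n - 1 - j) = monom 1 (la j)" if "j < n" for j la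
  proof -
    have "coeff (\<Sum>i<n. hat_poly n la i) (n - 1 - j) = (\<Sum>i<n. if i = j then monom 1 (la j) else 0)"
      unfolding coeff_sum hat_poly_monom using that by (intro sum.cong) auto
    then show ?thesis using that by simp
  qed
  fix j
  show "la j = mu j"
  proof (cases "j < n")
    case True
    have "(\<Sum>i<n. hat_poly n la i) = (\<Sum>i<n. hat_poly n mu i)"
      using assms(4) unfolding ev by (simp only: to_fract_eq_iff)
    then have "monom (1::rat) (la j) = monom 1 (mu j)" using c[OF True] by metis
    then show ?thesis by (metis degree_monom_eq one_neq_zero)
  qed (use assms in \<open>simp add: Par_zero\<close>)
qed

lemma zero_Lam: "0 \<in> Lam n"
  unfolding Lam_eq_msp by (rule msp_zero)

lemma mono_Lam: "la \<in> Par n \<Longrightarrow> mono n la \<in> Lam n"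
  unfolding Lam_eq_msp by (rule msp_base)

lemma Dk_zero: "k \<le> n \<Longrightarrow> Dk n k 0 = 0"
  using Dk_scl[OF zero_Lam, of k n 0] by simp

lemma Dk_diff: "f \<in> Lam n \<Longrightarrow> g \<in> Lam n \<Longrightarrow> k \<le> n \<Longrightarrow> Dk n k (f - g) = Dk n k f - Dk n k g"
  using Dk_add[OF Lam_diff, of f n g g k] by (metis add_diff_cancel_right' diff_add_cancel)

lemma Dk_below:
  assumes "f \<in> msp n J" "J \<subseteq> Par n" "\<And>la. la \<in> J \<Longrightarrow> below n la \<subseteq> J" "k \<le> n"
  shows "Dk n k f \<in> msp n J"
proof -
  have "f \<in> Lam n \<and> Dk n k f \<in> msp n J"
    using assms(1)[unfolded msp_def]
  proof (induction rule: fs.span_induct_alt)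
    case base
    show ?case using zero_Lam Dk_zero[OF assms(4)] msp_zero by metis
  next
    case (step c m f)
    then obtain la where la: "la \<in> J" "m = mono n la" by blast
    then have laP: "la \<in> Par n" using assms(2) by blast
    have "Dk n k m \<in> msp n J"
    proof -
      have "Dk n k m - scl (elem n k (hat n la)) m \<in> msp n J"
        using Dk_mono[OF laP assms(4)] msp_mono[of "sbelow n la" J n] sbelow_subset[of n la] assms(3)[OF la(1)] la(2)
        by blast
      moreover have "scl (elem n k (hat n la)) m \<in> msp n J" using la by (simp add: msp_scl msp_base)
      ultimately have "Dk n k m - scl (elem n k (hat n la)) m + scl (elem n k (hat n la)) m \<in> msp n J" by (rule msp_add)
      then show ?thesis by (simp only: diff_add_cancel)
    qed
    moreover have m: "m \<in> Lam n" using mono_Lam[OF laP] la(2) by simp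
    moreover have "Dk n k (scl c m + f) = scl c (Dk n k m) + Dk n k f"
      using step(2) m assms(4) by (simp only: Dk_add Dk_scl Lam_scl)
    ultimately show ?case using step(2) by (simp only: Lam_add Lam_scl msp_add msp_scl simp_thms)
  qed
  then show ?thesis ..
qed

section \<open>The operator D_1 - theta on dominance ideals, and its eigenvectors\<close>

definition Tsh :: "nat \<Rightarrow> K \<Rightarrow> ((nat \<Rightarrow> K) \<Rightarrow> K) \<Rightarrow> (nat \<Rightarrow> K) \<Rightarrow> K" where
  "Tsh n \<theta> f = Dk n 1 f - scl \<theta> f"

lemma Tsh_add: "1 \<le> n \<Longrightarrow> f \<in> Lam n \<Longrightarrow> g \<in> Lam n \<Longrightarrow> Tsh n \<theta> (f + g) = Tsh n \<theta> f + Tsh n \<theta> g"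
  unfolding Tsh_def by (simp only: Dk_add fs.scale_right_distrib add_diff_add)

lemma Tsh_diff: "1 \<le> n \<Longrightarrow> f \<in> Lam n \<Longrightarrow> g \<in> Lam n \<Longrightarrow> Tsh n \<theta> (f - g) = Tsh n \<theta> f - Tsh n \<theta> g"
  unfolding Tsh_def by (simp add: Dk_diff fs.scale_right_diff_distrib fun_eq_iff)

lemma Tsh_scl: "1 \<le> n \<Longrightarrow> f \<in> Lam n \<Longrightarrow> Tsh n \<theta> (scl c f) = scl c (Tsh n \<theta> f)"
  unfolding Tsh_def by (simp only: Dk_scl fs.scale_right_diff_distrib fs.scale_left_commute)

lemma Tsh_zero: "1 \<le> n \<Longrightarrow> Tsh n \<theta> 0 = 0"
  unfolding Tsh_def by (simp only: Dk_zero fs.scale_zero_right diff_0_right)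

lemma Tsh_mono:
  assumes "1 \<le> n" "la \<in> Par n"
  shows "Tsh n \<theta> (mono n la) - scl (ev n la - \<theta>) (mono n la) \<in> msp n (sbelow n la)"
proof -
  have "Tsh n \<theta> (mono n la) - scl (ev n la - \<theta>) (mono n la) = Dk n 1 (mono n la) - scl (ev n la) (mono n la)"
    by (simp add: Tsh_def fun_eq_iff scl_apply algebra_simps)
  then show ?thesis using Dk_mono[OF assms(2,1)] by (simp only: ev_def)
qed

lemma Tsh_surj_span:
  assumes n: "1 \<le> n" and J: "J \<subseteq> Par n"
    and base: "\<And>ka. ka \<in> J \<Longrightarrow> \<exists>g\<in>msp n J. Tsh n \<theta> g = mono n ka"
    and h: "h \<in> msp n J"
  shows "\<exists>g\<in>msp n J. Tsh n \<theta> g = h"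
  using h[unfolded msp_def]
proof (induction rule: fs.span_induct_alt)
  case base
  show ?case using msp_zero Tsh_zero[OF n] by blast
next
  case (step c m f)
  obtain g where g: "g \<in> msp n J" "Tsh n \<theta> g = m" using base step(1) by blast
  obtain g' where g': "g' \<in> msp n J" "Tsh n \<theta> g' = f" using step(2) by blast
  have L: "g \<in> Lam n" "g' \<in> Lam n" using g g' msp_subset_Lam[OF J] by auto
  have "Tsh n \<theta> (scl c g + g') = scl c m + f"
    by (simp only: Tsh_add[OF n Lam_scl[OF L(1)] L(2)] Tsh_scl[OF n L(1)] g g')
  moreover have "scl c g + g' \<in> msp n J" using g g' by (intro msp_add msp_scl)
  ultimately show ?case by blast
qed

text \<open>Back substitution: the lower terms of the image of m_mu have preimages by induction, and
  the diagonal entry can be divided by because theta is not an eigenvalue in the ideal.\<close>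

lemma Tsh_surj_mono:
  assumes n: "1 \<le> n" and mu: "mu \<in> Par n" and "\<forall>ka\<in>below n mu. ev n ka \<noteq> \<theta>"
  shows "\<exists>g\<in>msp n (below n mu). Tsh n \<theta> g = mono n mu"
  using mu assms(3)
proof (induction rule: dom_induct)
  case (less mu)
  define r where "r = Tsh n \<theta> (mono n mu) - scl (ev n mu - \<theta>) (mono n mu)"
  have r: "r \<in> msp n (sbelow n mu)" unfolding r_def by (rule Tsh_mono[OF n less(1)])
  have "\<exists>g\<in>msp n (sbelow n mu). Tsh n \<theta> g = r"
  proof (rule Tsh_surj_span[OF n sbelow_subset_Par _ r])
    fix ka assume ka: "ka \<in> sbelow n mu"
    have sub: "below n ka \<subseteq> sbelow n mu" by (rule below_sbelow[OF less(1) ka])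
    then have "\<forall>x\<in>below n ka. ev n x \<noteq> \<theta>" using less(3) sbelow_subset by blast
    then have "\<exists>g\<in>msp n (below n ka). Tsh n \<theta> g = mono n ka" by (rule less(2)[OF ka])
    then show "\<exists>g\<in>msp n (sbelow n mu). Tsh n \<theta> g = mono n ka" using msp_mono[OF sub] by blast
  qed
  then obtain g where g: "g \<in> msp n (sbelow n mu)" "Tsh n \<theta> g = r" by blast
  have gL: "g \<in> Lam n" using g(1) msp_subset_Lam[OF sbelow_subset_Par] by blast
  have mL: "mono n mu \<in> Lam n" by (rule mono_Lam[OF less(1)])
  have mb: "mu \<in> below n mu" using less(1) by (simp add: below_def dom_le_refl)
  define c where "c = ev n mu - \<theta>"
  have c: "c \<noteq> 0" using less(3) mb by (simp add: c_def)
  have "Tsh n \<theta> (mono n mu) - r = scl c (mono n mu)" by (simp add: r_def c_def)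
  then have "Tsh n \<theta> (scl (1 / c) (mono n mu - g)) = scl (1 / c) (scl c (mono n mu))"
    by (simp only: Tsh_scl[OF n Lam_diff[OF mL gL]] Tsh_diff[OF n mL gL] g(2))
  also have "\<dots> = mono n mu" using c by (simp add: fun_eq_iff scl_apply)
  finally have "Tsh n \<theta> (scl (1 / c) (mono n mu - g)) = mono n mu" .
  moreover have "scl (1 / c) (mono n mu - g) \<in> msp n (below n mu)"
    using g(1) msp_mono[OF sbelow_subset] mb by (intro msp_scl msp_diff msp_base) blast+
  ultimately show ?case by blast
qed

text \<open>D_1 - ev la sends m_la strictly below \<open>la\<close>, where it is onto since the
  eigenvalues there differ from ev la. Subtracting a preimage from m_la gives the
  eigenvector.\<close>

lemma mac_exists:
  assumes n: "1 \<le> n" and la: "la \<in> Par n"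
  shows "\<exists>P. P - mono n la \<in> msp n (sbelow n la) \<and> Tsh n (ev n la) P = 0"
proof -
  have "Tsh n (ev n la) (mono n la) \<in> msp n (sbelow n la)"
    using Tsh_mono[OF n la, of "ev n la"] by (simp only: diff_self fs.scale_zero_left diff_0_right)
  moreover have "\<exists>g\<in>msp n (sbelow n la). Tsh n (ev n la) g = mono n ka" if ka: "ka \<in> sbelow n la" for ka
  proof -
    have sub: "below n ka \<subseteq> sbelow n la" by (rule below_sbelow[OF la ka])
    have "\<forall>x\<in>below n ka. ev n x \<noteq> ev n la"
      using sub ev_distinct[OF n _ la] by (auto simp: sbelow_def below_def)
    then have "\<exists>g\<in>msp n (below n ka). Tsh n (ev n la) g = mono n ka"
      using ka by (intro Tsh_surj_mono n) (auto simp: sbelow_def)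
    then show ?thesis using msp_mono[OF sub] by blast
  qed
  ultimately obtain g where g: "g \<in> msp n (sbelow n la)" "Tsh n (ev n la) g = Tsh n (ev n la) (mono n la)"
    using Tsh_surj_span[OF n sbelow_subset_Par] by metis
  have gL: "g \<in> Lam n" using g(1) msp_subset_Lam[OF sbelow_subset_Par] by blast
  have "Tsh n (ev n la) (mono n la - g) = 0"
    by (simp only: Tsh_diff[OF n mono_Lam[OF la] gL] g(2) diff_self)
  moreover have "mono n la - g - mono n la \<in> msp n (sbelow n la)"
  proof -
    have "mono n la - g - mono n la = 0 - g" by (simp add: fun_eq_iff)
    then show ?thesis using msp_diff[OF msp_zero g(1)] by (simp only:)
  qed
  ultimately show ?thesis by blast
qed

text \<open>Characterised through D_1 alone; \<open>mac_eigen\<close> extends the eigenvector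
  property to all D_k and \<open>Pmac_eq_mac\<close> makes the identification.\<close>

definition mac :: "nat \<Rightarrow> (nat \<Rightarrow> nat) \<Rightarrow> (nat \<Rightarrow> K) \<Rightarrow> K" where
  "mac n la = (SOME P. P - mono n la \<in> msp n (sbelow n la) \<and> Tsh n (ev n la) P = 0)"

lemma mac_leading: "1 \<le> n \<Longrightarrow> la \<in> Par n \<Longrightarrow> mac n la - mono n la \<in> msp n (sbelow n la)"
  and mac_Tsh: "1 \<le> n \<Longrightarrow> la \<in> Par n \<Longrightarrow> Tsh n (ev n la) (mac n la) = 0"
  unfolding mac_def using someI_ex[OF mac_exists] by blast+

lemma mac_below: "1 \<le> n \<Longrightarrow> la \<in> Par n \<Longrightarrow> mac n la \<in> msp n (below n la)"
proof -
  assume *: "1 \<le> n" "la \<in> Par n"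
  have "mac n la - mono n la + mono n la \<in> msp n (below n la)"
    using mac_leading[OF *] msp_mono[OF sbelow_subset] *(2)
    by (intro msp_add msp_base) (auto simp: below_def dom_le_refl)
  then show ?thesis by (simp only: diff_add_cancel)
qed

lemma mac_Lam: "1 \<le> n \<Longrightarrow> la \<in> Par n \<Longrightarrow> mac n la \<in> Lam n"
  using mac_below msp_subset_Lam[OF below_subset_Par] by blast

lemma mac_ev: "1 \<le> n \<Longrightarrow> la \<in> Par n \<Longrightarrow> Dk n 1 (mac n la) = scl (ev n la) (mac n la)"
  using mac_Tsh[of n la] unfolding Tsh_def by (simp only: right_minus_eq)

text \<open>Applying D_1 - e k removes the summand \<open>g k\<close> and multiplies f by theta - e
  k. Singling out one eigenvector f makes the lemma serve both uniqueness and linear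
  independence.\<close>

lemma eigen_sum_zero:
  assumes n: "1 \<le> n" and "finite F" and "f \<in> Lam n" "Dk n 1 f = scl \<theta> f" "f = (\<Sum>mu\<in>F. g mu)"
    and "\<And>mu. mu \<in> F \<Longrightarrow> g mu \<in> Lam n" "\<And>mu. mu \<in> F \<Longrightarrow> Dk n 1 (g mu) = scl (e mu) (g mu)"
    and "\<And>mu. mu \<in> F \<Longrightarrow> e mu \<noteq> \<theta>"
  shows "f = 0"
  using assms(2-)
proof (induction F arbitrary: f g)
  case (insert k F)
  have gL: "g mu \<in> Lam n" if "mu \<in> insert k F" for mu using insert.prems(4) that .
  have gsum: "(\<Sum>mu\<in>G. h mu) \<in> Lam n \<and> Dk n 1 (\<Sum>mu\<in>G. h mu) = (\<Sum>mu\<in>G. Dk n 1 (h mu))"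
    if "finite G" "\<And>mu. mu \<in> G \<Longrightarrow> h mu \<in> Lam n" for G and h :: "'a \<Rightarrow> (nat \<Rightarrow> K) \<Rightarrow> K"
    using that
  proof (induction G)
    case empty
    show ?case by (simp only: sum.empty zero_Lam Dk_zero[OF n] simp_thms)
  next
    case (insert a G)
    then have L: "h a \<in> Lam n" "sum h G \<in> Lam n" by simp_all
    have "Dk n 1 (sum h G) = (\<Sum>mu\<in>G. Dk n 1 (h mu))" using insert by simp
    then show ?case by (simp only: sum.insert[OF insert.hyps] Dk_add[OF L n] Lam_add[OF L] simp_thms)
  qed
  define f' where "f' = scl (\<theta> - e k) f"
  have "f' = 0"
  proof (rule insert.IH[of f' "\<lambda>mu. scl (e mu - e k) (g mu)"])
    show "f' \<in> Lam n" unfolding f'_def by (rule Lam_scl[OF insert.prems(1)])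
    show "Dk n 1 f' = scl \<theta> f'"
      unfolding f'_def by (simp only: Dk_scl[OF insert.prems(1) n] insert.prems(2) fs.scale_left_commute)
    have "f' = Dk n 1 f - scl (e k) f"
      unfolding f'_def insert.prems(2) by (rule fs.scale_left_diff_distrib)
    also have "\<dots> = (\<Sum>mu\<in>insert k F. scl (e mu) (g mu)) - scl (e k) (\<Sum>mu\<in>insert k F. g mu)"
    proof -
      have "Dk n 1 (\<Sum>mu\<in>insert k F. g mu) = (\<Sum>mu\<in>insert k F. scl (e mu) (g mu))"
        using gsum[of "insert k F" g] insert.hyps gL insert.prems(5) by simp
      then show ?thesis using insert.prems(3) by simp
    qed
    also have "\<dots> = (\<Sum>mu\<in>F. scl (e mu - e k) (g mu))"
      using insert.hyps by (simp add: fs.scale_left_diff_distrib fs.scale_sum_right fs.scale_right_distrib sum_subtractf)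
    finally show "f' = (\<Sum>mu\<in>F. scl (e mu - e k) (g mu))" .
    fix mu assume mu: "mu \<in> F"
    then have "g mu \<in> Lam n" using gL by simp
    then show "scl (e mu - e k) (g mu) \<in> Lam n" by (rule Lam_scl)
    have d: "Dk n 1 (g mu) = scl (e mu) (g mu)" using insert.prems(5) mu by simp
    show "Dk n 1 (scl (e mu - e k) (g mu)) = scl (e mu) (scl (e mu - e k) (g mu))"
      by (simp only: Dk_scl[OF \<open>g mu \<in> Lam n\<close> n] d fs.scale_left_commute)
    show "e mu \<noteq> \<theta>" using insert.prems(6) mu by simp
  qed
  moreover have "\<theta> - e k \<noteq> 0" using insert.prems(6)[of k] by auto
  ultimately show ?case unfolding f'_def by (simp only: fs.scale_eq_0_iff simp_thms)
qed simp

lemma mac_span: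
  assumes "1 \<le> n" "J \<subseteq> Par n" "\<And>la. la \<in> J \<Longrightarrow> below n la \<subseteq> J"
  shows "msp n J \<subseteq> fs.span (mac n ` J)"
  by (rule unitriangular_span_subset) (use assms mac_leading in auto)

lemma eigen_unique:
  assumes n: "1 \<le> n" and la: "la \<in> Par n" and f: "f \<in> msp n (sbelow n la)" "Dk n 1 f = scl (ev n la) f"
  shows "f = 0"
proof -
  have "f \<in> fs.span (mac n ` sbelow n la)"
    using mac_span[OF n sbelow_subset_Par below_sbelow[OF la]] f(1) by blast
  then obtain c where c: "f = (\<Sum>mu\<in>sbelow n la. scl (c mu) (mac n mu))"
    by (rule span_image_finiteE[OF _ finite_sbelow])
  show ?thesis
  proof (rule eigen_sum_zero[OF n finite_sbelow _ f(2) c, where e = "ev n"])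
    show "f \<in> Lam n" using f(1) msp_subset_Lam[OF sbelow_subset_Par] by blast
    fix mu assume mu: "mu \<in> sbelow n la"
    then have muP: "mu \<in> Par n" by (simp add: sbelow_def)
    show "scl (c mu) (mac n mu) \<in> Lam n" by (intro Lam_scl mac_Lam n muP)
    show "Dk n 1 (scl (c mu) (mac n mu)) = scl (ev n mu) (scl (c mu) (mac n mu))"
      by (simp only: Dk_scl[OF mac_Lam[OF n muP] n] mac_ev[OF n muP] fs.scale_left_commute)
    show "ev n mu \<noteq> ev n la" using ev_distinct[OF n muP la] mu by (auto simp: sbelow_def)
  qed
qed

text \<open>The difference D_k P - e_k(hat la) P lies strictly below \<open>la\<close> by
  triangularity, and by commutation it is again a D_1-eigenvector with the eigenvalue of
  \<open>la\<close>; \<open>eigen_unique\<close> forces it to vanish.\<close>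

lemma mac_eigen:
  assumes n: "1 \<le> n" and la: "la \<in> Par n" and k: "k \<le> n"
  shows "Dk n k (mac n la) = scl (elem n k (hat n la)) (mac n la)"
proof -
  let ?P = "mac n la" and ?e = "elem n k (hat n la)"
  define r where "r = ?P - mono n la"
  have r: "r \<in> msp n (sbelow n la)" unfolding r_def by (rule mac_leading[OF n la])
  have rL: "r \<in> Lam n" using r msp_subset_Lam[OF sbelow_subset_Par] by blast
  have PL: "?P \<in> Lam n" by (rule mac_Lam[OF n la])
  have P: "?P = mono n la + r" by (simp add: r_def)
  then have Px: "?P x = mono n la x + r x" for x by simp
  have DP: "Dk n k ?P = Dk n k (mono n la) + Dk n k r"
    unfolding P by (rule Dk_add[OF mono_Lam[OF la] rL k])
  define f where "f = Dk n k ?P - scl ?e ?P"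
  have "f = (Dk n k (mono n la) - scl ?e (mono n la)) + (Dk n k r - scl ?e r)"
    unfolding f_def DP by (simp add: fun_eq_iff scl_apply Px algebra_simps)
  also have "\<dots> \<in> msp n (sbelow n la)"
    by (intro msp_add Dk_mono la k msp_diff msp_scl r Dk_below sbelow_subset_Par below_sbelow)
  finally have f: "f \<in> msp n (sbelow n la)" .
  have "Dk n 1 f = Dk n 1 (Dk n k ?P) - Dk n 1 (scl ?e ?P)"
    unfolding f_def by (rule Dk_diff[OF Dk_Lam[OF PL k] Lam_scl[OF PL] n])
  also have "Dk n 1 (Dk n k ?P) = Dk n k (scl (ev n la) ?P)"
    by (simp only: Dk_commute[OF n k PL, symmetric] mac_ev[OF n la])
  also have "\<dots> = scl (ev n la) (Dk n k ?P)" by (rule Dk_scl[OF PL k])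
  also have "Dk n 1 (scl ?e ?P) = scl (ev n la) (scl ?e ?P)"
    by (simp only: Dk_scl[OF PL n] mac_ev[OF n la] fs.scale_left_commute)
  also have "scl (ev n la) (Dk n k ?P) - scl (ev n la) (scl ?e ?P) = scl (ev n la) f"
    unfolding f_def by (rule fs.scale_right_diff_distrib[symmetric])
  finally have "f = 0" by (rule eigen_unique[OF n la f])
  then show ?thesis unfolding f_def by (simp only: right_minus_eq)
qed

lemma Pmac_eq_mac:
  assumes n: "1 \<le> n" and la: "la \<in> Par n"
  shows "Pmac n la = mac n la"
  unfolding Pmac_def
proof (rule the_equality)
  show "mac n la \<in> Lam n \<and>
      (\<forall>k\<in>{1..n}. Dk n k (mac n la) = (\<lambda>x. elem n k (hat n la) * mac n la x)) \<and>
      (\<exists>b. mac n la = (\<lambda>x. mono n la x + (\<Sum>mu\<in>{mu \<in> Par n. dom_le n mu la \<and> mu \<noteq> la}. b mu * mono n mu x)))"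
  proof (intro conjI ballI)
    show "mac n la \<in> Lam n" by (rule mac_Lam[OF n la])
    show "Dk n k (mac n la) = (\<lambda>x. elem n k (hat n la) * mac n la x)" if "k \<in> {1..n}" for k
      using mac_eigen[OF n la, of k] that by (simp add: scl_def)
    obtain b where b: "mac n la - mono n la = (\<lambda>x. \<Sum>mu\<in>sbelow n la. b mu * mono n mu x)"
      by (rule msp_finiteE[OF mac_leading[OF n la] finite_sbelow])
    have "mac n la x = mono n la x + (\<Sum>mu\<in>sbelow n la. b mu * mono n mu x)" for x
      using fun_cong[OF b, of x] by (simp add: algebra_simps)
    then show "\<exists>b. mac n la = (\<lambda>x. mono n la x + (\<Sum>mu\<in>{mu \<in> Par n. dom_le n mu la \<and> mu \<noteq> la}. b mu * mono n mu x))"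
      unfolding sbelow_def by blast
  qed
next
  fix P assume P: "P \<in> Lam n \<and> (\<forall>k\<in>{1..n}. Dk n k P = (\<lambda>x. elem n k (hat n la) * P x)) \<and>
      (\<exists>b. P = (\<lambda>x. mono n la x + (\<Sum>mu\<in>{mu \<in> Par n. dom_le n mu la \<and> mu \<noteq> la}. b mu * mono n mu x)))"
  then have PL: "P \<in> Lam n" by blast
  obtain b where b: "P = (\<lambda>x. mono n la x + (\<Sum>mu\<in>sbelow n la. b mu * mono n mu x))"
    using P unfolding sbelow_def by blast
  have "P - mono n la = (\<lambda>x. \<Sum>mu\<in>sbelow n la. b mu * mono n mu x)" unfolding b by (simp add: fun_eq_iff)
  then have 1: "P - mono n la \<in> msp n (sbelow n la)" using msp_sumI[OF order_refl] by simp
  have "P - mac n la = (P - mono n la) - (mac n la - mono n la)" by simp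
  also have "\<dots> \<in> msp n (sbelow n la)" by (rule msp_diff[OF 1 mac_leading[OF n la]])
  finally have d: "P - mac n la \<in> msp n (sbelow n la)" .
  have "Dk n 1 P = scl (ev n la) P" using P n by (simp add: scl_def ev_def del: One_nat_def)
  then have "Dk n 1 (P - mac n la) = scl (ev n la) (P - mac n la)"
    by (simp only: Dk_diff[OF PL mac_Lam[OF n la] n] mac_ev[OF n la] fs.scale_right_diff_distrib)
  then have "P - mac n la = 0" by (rule eigen_unique[OF n la d])
  then show "P = mac n la" by (simp only: right_minus_eq)
qed

lemma mono_notin_sbelow:
  assumes "la \<in> Par n"
  shows "mono n la \<notin> msp n (sbelow n la)"
proof
  assume "mono n la \<in> msp n (sbelow n la)"
  then obtain c where c: "mono n la = (\<lambda>x. \<Sum>mu\<in>sbelow n la. c mu * mono n mu x)"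
    by (rule msp_finiteE[OF _ finite_sbelow])
  define a where "a mu = (if mu = la then 1 else - c mu)" for mu
  have nin: "la \<notin> sbelow n la" by (simp add: sbelow_def)
  have "a la = 0"
  proof (rule mono_hat_kernel[of "insert la (sbelow n la)" n a la])
    fix nu
    have "(\<Sum>mu\<in>sbelow n la. a mu * mono n mu (hat n nu)) = - (\<Sum>mu\<in>sbelow n la. c mu * mono n mu (hat n nu))"
      unfolding sum_negf[symmetric] using nin by (intro sum.cong) (auto simp: a_def)
    also have "\<dots> = - mono n la (hat n nu)" using fun_cong[OF c, of "hat n nu"] by simp
    finally show "(\<Sum>mu\<in>insert la (sbelow n la). a mu * mono n mu (hat n nu)) = 0"
      using nin finite_sbelow by (simp add: a_def)
  qed (use assms finite_sbelow sbelow_subset_Par in auto)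
  then show False by (simp add: a_def)
qed

lemma mac_nonzero: "1 \<le> n \<Longrightarrow> la \<in> Par n \<Longrightarrow> mac n la \<noteq> 0"
proof
  assume *: "1 \<le> n" "la \<in> Par n" "mac n la = 0"
  have "0 - (mac n la - mono n la) \<in> msp n (sbelow n la)"
    by (rule msp_diff[OF msp_zero mac_leading[OF *(1,2)]])
  moreover have "0 - (mac n la - mono n la) = mono n la" using *(3) by simp
  ultimately show False using mono_notin_sbelow[OF *(2)] by (simp only:)
qed

lemma inj_on_mac: "1 \<le> n \<Longrightarrow> inj_on (mac n) (Par n)"
proof (rule inj_onI)
  fix la mu assume *: "1 \<le> n" "la \<in> Par n" "mu \<in> Par n" "mac n la = mac n mu"
  have "scl (ev n la) (mac n la) = scl (ev n mu) (mac n la)"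
    using mac_ev[OF *(1,2)] mac_ev[OF *(1,3)] *(4) by simp
  then have "scl (ev n la - ev n mu) (mac n la) = 0" by (simp only: fs.scale_left_diff_distrib diff_self)
  then have "ev n la = ev n mu" using mac_nonzero[OF *(1,2)] by (simp only: fs.scale_eq_0_iff right_minus_eq simp_thms)
  then show "la = mu" by (rule ev_distinct[OF *(1-3)])
qed

lemma mac_independent:
  assumes n: "1 \<le> n"
  shows "fs.independent (mac n ` Par n)"
proof
  assume "fs.dependent (mac n ` Par n)"
  then obtain t u v where t: "finite t" "t \<subseteq> mac n ` Par n" and z: "(\<Sum>v\<in>t. scl (u v) v) = 0"
    and v: "v \<in> t" "u v \<noteq> 0" unfolding fs.dependent_explicit by blast
  \<comment> \<open>Independence is about sets of vectors, so the eigenvalue is recovered from the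
    vector through the injectivity of \<open>mac n\<close>.\<close>
  define e where "e w = ev n (inv_into (Par n) (mac n) w)" for w
  have e: "w \<in> Lam n" "Dk n 1 w = scl (e w) w" if w: "w \<in> t" for w
  proof -
    obtain la where la: "la \<in> Par n" "w = mac n la" using w t(2) by blast
    then have "inv_into (Par n) (mac n) w = la" using inv_into_f_f[OF inj_on_mac[OF n]] by simp
    then show "w \<in> Lam n" "Dk n 1 w = scl (e w) w" using la mac_Lam mac_ev n by (simp_all add: e_def del: One_nat_def)
  qed
  have ed: "e w \<noteq> e v" if w: "w \<in> t" "w \<noteq> v" for w
  proof
    assume ew: "e w = e v"
    obtain la mu where lm: "la \<in> Par n" "w = mac n la" "mu \<in> Par n" "v = mac n mu" using w(1) v(1) t(2) by blast
    then have "ev n la = ev n mu" using ew inv_into_f_f[OF inj_on_mac[OF n]] by (simp add: e_def)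
    then show False using ev_distinct[OF n lm(1,3)] lm w(2) by simp
  qed
  have sc: "Dk n 1 (scl c w) = scl (e w) (scl c w)" if "w \<in> t" for w c
    by (simp only: Dk_scl[OF e(1)[OF that] n] e(2)[OF that] fs.scale_left_commute)
  have "scl (u v) v + (\<Sum>w\<in>t - {v}. scl (u w) w) = 0"
    using z sum.remove[OF t(1) v(1), of "\<lambda>w. scl (u w) w"] by simp
  then have split: "scl (u v) v = (\<Sum>w\<in>t - {v}. scl (- u w) w)"
    by (simp only: fs.scale_minus_left sum_negf eq_neg_iff_add_eq_0)
  have "scl (u v) v = 0"
  proof (rule eigen_sum_zero[OF n _ _ sc[OF v(1)] split, where e = e])
    show "finite (t - {v})" using t(1) by simp
    show "scl (u v) v \<in> Lam n" by (intro Lam_scl e v(1))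
    fix w assume w: "w \<in> t - {v}"
    then show "scl (- u w) w \<in> Lam n" by (intro Lam_scl e) simp
    show "Dk n 1 (scl (- u w) w) = scl (e w) (scl (- u w) w)" using w by (intro sc) simp
    show "e w \<noteq> e v" using w ed by simp
  qed
  moreover have "v \<noteq> 0" using v(1) t(2) mac_nonzero[OF n] by auto
  ultimately show False using fs.scale_eq_0_iff[of "u v" v] v(2) by blast
qed

section \<open>The Fourier pairing\<close>

global_interpretation fsp: vector_space_pair scl scl
  by unfold_locales

lemma is_Dhom_iff: "is_Dhom n D \<longleftrightarrow>
     (\<forall>g\<in>Lam n. \<forall>f\<in>Lam n. D g f \<in> Lam n) \<and>
     (\<forall>g\<in>Lam n. \<forall>f. f \<notin> Lam n \<longrightarrow> D g f = (\<lambda>_. 0)) \<and>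
     (\<forall>g. g \<notin> Lam n \<longrightarrow> D g = (\<lambda>_ _. 0)) \<and>
     (\<forall>g\<in>Lam n. \<forall>f\<in>Lam n. \<forall>h\<in>Lam n. D g (f + h) = D g f + D g h) \<and>
     (\<forall>g\<in>Lam n. \<forall>f\<in>Lam n. \<forall>c. D g (scl c f) = scl c (D g f)) \<and>
     (\<forall>g1\<in>Lam n. \<forall>g2\<in>Lam n. \<forall>f\<in>Lam n. D (g1 + g2) f = D g1 f + D g2 f) \<and>
     (\<forall>g\<in>Lam n. \<forall>f\<in>Lam n. \<forall>c. D (scl c g) f = scl c (D g f)) \<and>
     (\<forall>g1\<in>Lam n. \<forall>g2\<in>Lam n. \<forall>f\<in>Lam n. D (g1 * g2) f = D g1 (D g2 f)) \<and>
     (\<forall>f\<in>Lam n. D (\<lambda>_. 1) f = f) \<and>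
     (\<forall>k\<in>{1..n}. \<forall>f\<in>Lam n. D (elem n k) f = Dk n k f)"
  unfolding is_Dhom_def plus_fun_def times_fun_def scl_def ..

text \<open>The maps are required to be linear only on \<open>Lam n\<close>, as the operators of the
  pairing are; hence membership in \<open>Lam n\<close> is carried through the induction.\<close>

lemma Lam_linear_eqI:
  assumes f: "f \<in> Lam n"
    and "\<And>a b. a \<in> Lam n \<Longrightarrow> b \<in> Lam n \<Longrightarrow> L1 (a + b) = L1 a + L1 b"
    and "\<And>c a. a \<in> Lam n \<Longrightarrow> L1 (scl c a) = scl c (L1 a)"
    and "\<And>a b. a \<in> Lam n \<Longrightarrow> b \<in> Lam n \<Longrightarrow> L2 (a + b) = L2 a + L2 b"
    and "\<And>c a. a \<in> Lam n \<Longrightarrow> L2 (scl c a) = scl c (L2 a)"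
    and gen: "\<And>m. m \<in> G \<Longrightarrow> m \<in> Lam n \<and> L1 m = L2 m" and span: "Lam n \<subseteq> fs.span G"
  shows "L1 f = L2 f"
proof -
  have f': "f \<in> fs.span G" using f span by blast
  have "f \<in> Lam n \<and> L1 f = L2 f"
    using f'
  proof (induction rule: fs.span_induct_alt)
    case base
    have "L1 (scl 0 0) = scl 0 (L1 0)" "L2 (scl 0 0) = scl 0 (L2 0)"
      by (rule assms(3)[OF zero_Lam], rule assms(5)[OF zero_Lam])
    then have "L1 0 = L2 0" by (simp only: fs.scale_zero_left)
    with zero_Lam show ?case by (rule conjI)
  next
    case (step c m f)
    have m: "m \<in> Lam n" "L1 m = L2 m" using gen[OF step(1)] by auto
    have f: "f \<in> Lam n" "L1 f = L2 f" using step(2) by auto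
    have s: "scl c m \<in> Lam n" by (rule Lam_scl[OF m(1)])
    have "L1 (scl c m + f) = L2 (scl c m + f)"
      by (simp only: assms(2)[OF s f(1)] assms(3)[OF m(1)] assms(4)[OF s f(1)] assms(5)[OF m(1)] m(2) f(2))
    with Lam_add[OF s f(1)] show ?case by (rule conjI)
  qed
  then show ?thesis ..
qed

section \<open>The homomorphism D as a family of diagonal operators\<close>

lemma Lam_span_mac: "1 \<le> n \<Longrightarrow> Lam n \<subseteq> fs.span (mac n ` Par n)"
  unfolding Lam_eq_msp by (rule mac_span) (auto simp: below_def)

text \<open>The operator with eigenvalue g(hat la) on P_la, cut off to zero outside
  \<open>Lam n\<close> as \<open>is_Dhom\<close> demands.\<close>

definition diag :: "nat \<Rightarrow> ((nat \<Rightarrow> K) \<Rightarrow> K) \<Rightarrow> ((nat \<Rightarrow> K) \<Rightarrow> K) \<Rightarrow> (nat \<Rightarrow> K) \<Rightarrow> K" where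
  "diag n g f = (if g \<in> Lam n \<and> f \<in> Lam n
     then fsp.construct (mac n ` Par n) (\<lambda>b. scl (g (hat n (inv_into (Par n) (mac n) b))) b) f
     else (\<lambda>_. 0))"

lemma diag_mac:
  assumes "1 \<le> n" "g \<in> Lam n" "la \<in> Par n"
  shows "diag n g (mac n la) = scl (g (hat n la)) (mac n la)"
proof -
  have "inv_into (Par n) (mac n) (mac n la) = la" by (rule inv_into_f_f[OF inj_on_mac[OF assms(1)] assms(3)])
  then show ?thesis using assms mac_Lam[OF assms(1,3)]
    by (simp only: diag_def fsp.construct_basis[OF mac_independent[OF assms(1)] imageI[OF assms(3)]] if_True simp_thms)
qed

lemma diag_add:
  assumes "1 \<le> n" "g \<in> Lam n" "f \<in> Lam n" "h \<in> Lam n"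
  shows "diag n g (f + h) = diag n g f + diag n g h"
  using assms(2-) Lam_add[OF assms(3,4)] fsp.linear_add[OF fsp.linear_construct[OF mac_independent[OF assms(1)]]]
  by (simp only: diag_def if_True simp_thms)

lemma diag_scl:
  assumes "1 \<le> n" "g \<in> Lam n" "f \<in> Lam n"
  shows "diag n g (scl c f) = scl c (diag n g f)"
  using assms(2-) Lam_scl[OF assms(3), of c] fsp.linear_scale[OF fsp.linear_construct[OF mac_independent[OF assms(1)]]]
  by (simp only: diag_def if_True simp_thms)

lemma diag_Lam:
  assumes "1 \<le> n" "g \<in> Lam n" "f \<in> Lam n"
  shows "diag n g f \<in> Lam n"
proof -
  have "f \<in> fs.span (mac n ` Par n)" using assms Lam_span_mac by blast
  then have "f \<in> Lam n \<and> diag n g f \<in> Lam n"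
  proof (induction rule: fs.span_induct_alt)
    case base
    have "diag n g (scl 0 0) = scl 0 (diag n g 0)" by (rule diag_scl[OF assms(1,2) zero_Lam])
    then have "diag n g 0 = 0" by (simp only: fs.scale_zero_left)
    then show ?case by (simp only: zero_Lam simp_thms)
  next
    case (step c m f)
    then obtain la where la: "la \<in> Par n" "m = mac n la" by blast
    have m: "m \<in> Lam n" unfolding la(2) by (rule mac_Lam[OF assms(1) la(1)])
    have "diag n g m \<in> Lam n" unfolding la(2) diag_mac[OF assms(1,2) la(1)]
      by (intro Lam_scl mac_Lam assms(1) la(1))
    then show ?case using step(2) m
      by (simp only: diag_add[OF assms(1,2)] diag_scl[OF assms(1,2)] Lam_add Lam_scl simp_thms)
  qed
  then show ?thesis ..
qed

lemma diag_eqI: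
  assumes n: "1 \<le> n" and f: "f \<in> Lam n" and g: "g \<in> Lam n"
    and "\<And>a b. a \<in> Lam n \<Longrightarrow> b \<in> Lam n \<Longrightarrow> L (a + b) = L a + L b"
    and "\<And>c a. a \<in> Lam n \<Longrightarrow> L (scl c a) = scl c (L a)"
    and "\<And>la. la \<in> Par n \<Longrightarrow> L (mac n la) = scl (g (hat n la)) (mac n la)"
  shows "diag n g f = L f"
proof (rule Lam_linear_eqI[OF f diag_add[OF n g] diag_scl[OF n g] assms(4,5) _ Lam_span_mac[OF n]])
  fix m assume "m \<in> mac n ` Par n"
  then obtain la where la: "la \<in> Par n" "m = mac n la" by blast
  show "m \<in> Lam n \<and> diag n g m = L m"
    unfolding la(2) assms(6)[OF la(1)] diag_mac[OF n g la(1)] using mac_Lam[OF n la(1)] by simp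
qed

text \<open>Each law in g is checked on the eigenbasis, where it says that evaluation at
  \<open>hat n la\<close> is a ring homomorphism; the value at e_k is
  \<open>mac_eigen\<close>.\<close>

lemma diag_is_Dhom:
  assumes n: "1 \<le> n"
  shows "is_Dhom n (diag n)"
  unfolding is_Dhom_iff
proof (intro conjI ballI allI impI)
  fix g f assume g: "g \<in> Lam n" and f: "f \<in> Lam n"
  show "diag n g f \<in> Lam n" by (rule diag_Lam[OF n g f])
  show "diag n g (f + h) = diag n g f + diag n g h" if "h \<in> Lam n" for h
    by (rule diag_add[OF n g f that])
  show "diag n g (scl c f) = scl c (diag n g f)" for c by (rule diag_scl[OF n g f])
  show "diag n (scl c g) f = scl c (diag n g f)" for c
  proof (rule diag_eqI[OF n f Lam_scl[OF g], where L = "\<lambda>f. scl c (diag n g f)"])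
    fix a b assume ab: "a \<in> Lam n" "b \<in> Lam n"
    show "scl c (diag n g (a + b)) = scl c (diag n g a) + scl c (diag n g b)"
      by (simp only: diag_add[OF n g ab] fs.scale_right_distrib)
    show "scl c (diag n g (scl d a)) = scl d (scl c (diag n g a))" for d
      by (simp only: diag_scl[OF n g ab(1)] fs.scale_left_commute)
  next
    fix la assume la: "la \<in> Par n"
    show "scl c (diag n g (mac n la)) = scl (scl c g (hat n la)) (mac n la)"
      by (simp only: diag_mac[OF n g la] fs.scale_scale scl_apply)
  qed
next
  fix g1 g2 f assume g: "g1 \<in> Lam n" "g2 \<in> Lam n" and f: "f \<in> Lam n"
  show "diag n (g1 + g2) f = diag n g1 f + diag n g2 f"
  proof (rule diag_eqI[OF n f Lam_add[OF g], where L = "\<lambda>f. diag n g1 f + diag n g2 f"])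
    fix a b assume ab: "a \<in> Lam n" "b \<in> Lam n"
    show "diag n g1 (a + b) + diag n g2 (a + b) = (diag n g1 a + diag n g2 a) + (diag n g1 b + diag n g2 b)"
      by (simp only: diag_add[OF n g(1) ab] diag_add[OF n g(2) ab] add_ac)
    show "diag n g1 (scl d a) + diag n g2 (scl d a) = scl d (diag n g1 a + diag n g2 a)" for d
      by (simp only: diag_scl[OF n g(1) ab(1)] diag_scl[OF n g(2) ab(1)] fs.scale_right_distrib)
  next
    fix la assume la: "la \<in> Par n"
    show "diag n g1 (mac n la) + diag n g2 (mac n la) = scl ((g1 + g2) (hat n la)) (mac n la)"
      by (simp only: diag_mac[OF n g(1) la] diag_mac[OF n g(2) la] fs.scale_left_distrib plus_fun_apply)
  qed
  show "diag n (g1 * g2) f = diag n g1 (diag n g2 f)"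
  proof (rule diag_eqI[OF n f Lam_mult[OF g], where L = "\<lambda>f. diag n g1 (diag n g2 f)"])
    fix a b assume ab: "a \<in> Lam n" "b \<in> Lam n"
    note L = diag_Lam[OF n g(2) ab(1)] diag_Lam[OF n g(2) ab(2)]
    show "diag n g1 (diag n g2 (a + b)) = diag n g1 (diag n g2 a) + diag n g1 (diag n g2 b)"
      by (simp only: diag_add[OF n g(2) ab] diag_add[OF n g(1) L])
    show "diag n g1 (diag n g2 (scl d a)) = scl d (diag n g1 (diag n g2 a))" for d
      by (simp only: diag_scl[OF n g(2) ab(1)] diag_scl[OF n g(1) L(1)])
  next
    fix la assume la: "la \<in> Par n"
    show "diag n g1 (diag n g2 (mac n la)) = scl ((g1 * g2) (hat n la)) (mac n la)"
      by (simp only: diag_mac[OF n g(1) la] diag_mac[OF n g(2) la] diag_scl[OF n g(1) mac_Lam[OF n la]]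
          fs.scale_scale times_fun_apply mult.commute)
  qed
next
  fix f assume f: "f \<in> Lam n"
  show "diag n (\<lambda>_. 1) f = f"
    by (rule diag_eqI[OF n f one_Lam, where L = "\<lambda>f. f"]) (simp_all only: fs.scale_one)
next
  fix k f assume k: "k \<in> {1..n}" and f: "f \<in> Lam n"
  then have kn: "k \<le> n" by simp
  show "diag n (elem n k) f = Dk n k f"
    by (rule diag_eqI[OF n f elem_Lam[OF kn]]) (simp_all only: Dk_add Dk_scl mac_eigen[OF n] kn)
qed (simp_all add: diag_def fun_eq_iff)

section \<open>Uniqueness of the homomorphism and values of the pairing\<close>

lemma elist_Cons: "elist n (k # ks) = elem n k * elist n ks"
  by (simp add: elist_def)

lemma elist_Lam: "\<forall>k\<in>set ks. k \<le> n \<Longrightarrow> elist n ks \<in> Lam n"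
proof (induction ks)
  case (Cons k ks)
  then have "elem n k * elist n ks \<in> Lam n" by (intro Lam_mult elem_Lam) simp_all
  then show ?case by (simp only: elist_Cons)
qed (simp add: elist_def one_Lam)

lemma foldr_Dk_Lam: "\<forall>k\<in>set ks. k \<le> n \<Longrightarrow> f \<in> Lam n \<Longrightarrow> foldr (Dk n) ks f \<in> Lam n"
  by (induction ks) (auto intro: Dk_Lam)

lemma is_Dhom_elist:
  assumes D: "is_Dhom n D" and "set ks \<subseteq> {1..n}" and f: "f \<in> Lam n"
  shows "D (elist n ks) f = foldr (Dk n) ks f"
  using assms(2)
proof (induction ks)
  case Nil
  show ?case using D f by (simp add: is_Dhom_iff elist_def)
next
  case (Cons k ks)
  have k: "k \<in> {1..n}" and ks: "\<forall>k\<in>set ks. k \<le> n" using Cons.prems by auto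
  have "D (elem n k * elist n ks) f = D (elem n k) (D (elist n ks) f)"
    using D elem_Lam[of k n] k elist_Lam[OF ks] f unfolding is_Dhom_iff by auto
  moreover have "D (elist n ks) f = foldr (Dk n) ks f" using Cons by simp
  moreover have "D (elem n k) (foldr (Dk n) ks f) = Dk n k (foldr (Dk n) ks f)"
    using D k foldr_Dk_Lam[OF ks f] unfolding is_Dhom_iff by blast
  ultimately show ?case by (simp only: elist_Cons foldr.simps o_apply)
qed

lemma Lam_span_elist: "Lam n \<subseteq> fs.span ((\<lambda>la. elist n (cols n la)) ` Par n)"
  unfolding Lam_eq_msp by (rule unitriangular_span_subset) (auto simp: below_def elist_cols)

lemma cols_subset: "la \<in> Par n \<Longrightarrow> set (cols n la) \<subseteq> {1..n}"
  using cols_le by blast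

lemma is_Dhom_linear:
  assumes "is_Dhom n D" "f \<in> Lam n"
  shows "a \<in> Lam n \<Longrightarrow> b \<in> Lam n \<Longrightarrow> D (a + b) f = D a f + D b f"
    and "a \<in> Lam n \<Longrightarrow> D (scl c a) f = scl c (D a f)"
    and "a \<in> Lam n \<Longrightarrow> b \<in> Lam n \<Longrightarrow> D f (a + b) = D f a + D f b"
    and "a \<in> Lam n \<Longrightarrow> D f (scl c a) = scl c (D f a)"
  using assms unfolding is_Dhom_iff by blast+

text \<open>On a product of elementary polynomials the value is forced to be a composition of the
  D_k, and such products span \<open>Lam n\<close>.\<close>

lemma is_Dhom_unique:
  assumes n: "1 \<le> n" and D: "is_Dhom n D" and D': "is_Dhom n D'"
  shows "D = D'"
proof (intro ext)
  fix g f x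
  have "D g f = D' g f"
  proof (cases "g \<in> Lam n \<and> f \<in> Lam n")
    case True
    then have g: "g \<in> Lam n" and f: "f \<in> Lam n" by auto
    show ?thesis
    proof (rule Lam_linear_eqI[OF g, where ?L1.0 = "\<lambda>g. D g f" and ?L2.0 = "\<lambda>g. D' g f",
          OF is_Dhom_linear(1,2)[OF D f] is_Dhom_linear(1,2)[OF D' f] _ Lam_span_elist])
      fix m assume "m \<in> (\<lambda>la. elist n (cols n la)) ` Par n"
      then obtain la where la: "la \<in> Par n" "m = elist n (cols n la)" by blast
      have "m \<in> Lam n" unfolding la(2) using cols_le[OF la(1)] by (intro elist_Lam) auto
      then show "m \<in> Lam n \<and> D m f = D' m f"
        unfolding la(2) is_Dhom_elist[OF D cols_subset[OF la(1)] f] is_Dhom_elist[OF D' cols_subset[OF la(1)] f] by simp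
    qed
  next
    case False
    then show ?thesis using D D' unfolding is_Dhom_iff by metis
  qed
  then show "D g f x = D' g f x" by simp
qed

lemma Dop_eq: "1 \<le> n \<Longrightarrow> Dop n = diag n"
  unfolding Dop_def using diag_is_Dhom is_Dhom_unique by (blast intro: the_equality)

lemma Dop_is_Dhom: "1 \<le> n \<Longrightarrow> is_Dhom n (Dop n)"
  by (simp add: Dop_eq diag_is_Dhom)

lemma Dmu_foldr: "Dmu n mu f = foldr (Dk n) (cols n mu) f"
  by (simp add: Dmu_def cols_def foldr_map o_def)

lemma pairing_add_left: "1 \<le> n \<Longrightarrow> f \<in> Lam n \<Longrightarrow> g \<in> Lam n \<Longrightarrow> h \<in> Lam n \<Longrightarrow>
    pairing n (g + h) f = pairing n g f + pairing n h f"
  and pairing_scl_left: "1 \<le> n \<Longrightarrow> f \<in> Lam n \<Longrightarrow> g \<in> Lam n \<Longrightarrow>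
    pairing n (scl c g) f = c * pairing n g f"
  and pairing_add_right: "1 \<le> n \<Longrightarrow> f \<in> Lam n \<Longrightarrow> g \<in> Lam n \<Longrightarrow> h \<in> Lam n \<Longrightarrow>
    pairing n f (g + h) = pairing n f g + pairing n f h"
  and pairing_scl_right: "1 \<le> n \<Longrightarrow> f \<in> Lam n \<Longrightarrow> g \<in> Lam n \<Longrightarrow>
    pairing n f (scl c g) = c * pairing n f g"
  by (simp_all only: pairing_def is_Dhom_linear[OF Dop_is_Dhom] plus_fun_apply scl_apply)

lemma linear_functional_sum:
  assumes "finite F"
    and add: "\<And>g h. g \<in> Lam n \<Longrightarrow> h \<in> Lam n \<Longrightarrow> L (g + h) = L g + L h"
    and scale: "\<And>c g. g \<in> Lam n \<Longrightarrow> L (scl c g) = (c :: K) * L g"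
    and m: "\<And>la. la \<in> F \<Longrightarrow> m la \<in> Lam n"
  shows "L (\<Sum>la\<in>F. scl (c la) (m la)) = (\<Sum>la\<in>F. c la * L (m la))"
proof -
  have "(\<Sum>la\<in>F. scl (c la) (m la)) \<in> Lam n \<and> L (\<Sum>la\<in>F. scl (c la) (m la)) = (\<Sum>la\<in>F. c la * L (m la))"
    using assms(1) m
  proof (induction F)
    case empty
    have "L (scl 0 0) = 0 * L 0" by (rule scale[OF zero_Lam])
    then have "L 0 = 0" by (simp only: fs.scale_zero_left mult_zero_left)
    then show ?case by (simp only: sum.empty zero_Lam simp_thms)
  next
    case (insert a F)
    have a: "m a \<in> Lam n" using insert.prems by simp
    have s: "(\<Sum>la\<in>F. scl (c la) (m la)) \<in> Lam n" "L (\<Sum>la\<in>F. scl (c la) (m la)) = (\<Sum>la\<in>F. c la * L (m la))"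
      using insert by simp_all
    show ?case
      by (simp only: sum.insert[OF insert.hyps] add[OF Lam_scl[OF a] s(1)] scale[OF a] s(2)
          Lam_add[OF Lam_scl[OF a] s(1)] simp_thms)
  qed
  then show ?thesis ..
qed

lemma pairing_mac: "1 \<le> n \<Longrightarrow> g \<in> Lam n \<Longrightarrow> la \<in> Par n \<Longrightarrow>
    pairing n g (mac n la) = g (hat n la) * mac n la (hat n zero_part)"
  by (simp only: pairing_def Dop_eq diag_mac scl_apply)

lemma pairing_elist: "1 \<le> n \<Longrightarrow> f \<in> Lam n \<Longrightarrow> la \<in> Par n \<Longrightarrow>
    pairing n (elist n (cols n la)) f = Dmu n la f (hat n zero_part)"
  by (simp only: pairing_def Dmu_foldr is_Dhom_elist[OF Dop_is_Dhom] cols_subset)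

section \<open>The lattice property\<close>

text \<open>The factor \<open>t x (i+1) - x i\<close> vanishes at \<open>hat \<lambda>\<close> whenever \<open>\<lambda> + 1\<^sub>S\<close> fails to be a partition.\<close>

lemma Dcoef_zero:
  assumes la: "la \<in> Par n" and S: "S \<subseteq> {..<n}" and not: "shift la S \<notin> Par n"
  shows "Dcoef n S la = 0"
proof -
  have "shift la S i = 0" if "n \<le> i" for i using that S la by (auto simp: shift_def Par_zero)
  then obtain i j where ij: "i \<le> j" "shift la S j > shift la S i"
    using not by (auto simp: Par_def not_le)
  then have iS: "i \<notin> S" and jS: "j \<in> S" and eq: "la i = la j"
    using ParD[OF la ij(1)] by (auto simp: shift_def split: if_splits)
  \<comment> \<open>The parts from i to j are all equal, i is outside S and j inside; somewhere
    along this block a step enters S.\<close>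
  have "\<exists>a. i \<le> a \<and> a < j \<and> a \<notin> S \<and> Suc a \<in> S"
  proof (rule ccontr)
    assume no: "\<not> ?thesis"
    have "m \<notin> S" if "i \<le> m" "m \<le> j" for m
      using that by (induction m rule: dec_induct) (use iS no in \<open>auto simp: Suc_le_eq\<close>)
    then show False using ij jS by blast
  qed
  then obtain a where a: "i \<le> a" "a < j" "a \<notin> S" "Suc a \<in> S" by blast
  have "la a \<le> la i" "la (Suc a) \<le> la a" "la j \<le> la (Suc a)" using ParD[OF la] a by auto
  then have "la (Suc a) = la a" using eq by simp
  moreover have "Suc a < n" using a(4) S by auto
  \<comment> \<open>The exponents are truncated differences; \<open>Suc a < n\<close> makes that of
    a exactly one larger, so t times coordinate \<open>Suc a\<close> is coordinate a.\<close>
  moreover from this have "tt * tt ^ (n - 1 - Suc a) = tt ^ (n - 1 - a)"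
    by (simp add: Suc_diff_Suc flip: power_Suc)
  ultimately have z: "rfac tt (hat n la (Suc a)) (hat n la a) = 0"
    by (simp add: rfac_def hat_def mult.left_commute)
  have fin: "finite S" using S by (rule finite_subset) simp
  have "(\<Prod>j\<in>{..<n} - S. rfac tt (hat n la (Suc a)) (hat n la j)) = 0"
    by (rule prod_zero[OF _ bexI[of _ a]]) (use z a S \<open>Suc a < n\<close> in auto)
  then show ?thesis unfolding Dcoef_def
    by (intro prod_zero[OF fin] bexI[of _ "Suc a"]) (use a in auto)
qed

text \<open>An outer bound for the partitions obtained from \<open>la\<close> by adding vertical
  strips of the sizes in \<open>ks\<close>: a strip of size k adds at most \<open>min m k\<close> to
  the first m parts.\<close>

definition reach :: "nat \<Rightarrow> (nat \<Rightarrow> nat) \<Rightarrow> nat list \<Rightarrow> (nat \<Rightarrow> nat) set" where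
  "reach n la ks = {nu \<in> Par n. psize n nu = psize n la + sum_list ks \<and>
     (\<forall>m\<le>n. (\<Sum>i<m. nu i) \<le> (\<Sum>i<m. la i) + (\<Sum>k\<leftarrow>ks. min m k))}"

lemma finite_reach: "finite (reach n la ks)"
  by (rule finite_subset[OF _ finite_bounded_parts[of n "psize n la + sum_list ks"]]) (auto simp: reach_def)

lemma sum_shift: "finite S \<Longrightarrow> (\<Sum>i<m. shift la S i) = (\<Sum>i<m. la i) + card (S \<inter> {..<m})"
proof -
  assume "finite S"
  have "(\<Sum>i<m. shift la S i) = (\<Sum>i<m. la i + (if i \<in> S then 1 else 0))"
    by (intro sum.cong) (auto simp: shift_def)
  also have "\<dots> = (\<Sum>i<m. la i) + (\<Sum>i<m. if i \<in> S then 1 else 0)" by (rule sum.distrib)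
  also have "(\<Sum>i<m. if i \<in> S then 1 else 0) = card (S \<inter> {..<m})"
    by (simp add: sum.If_cases Int_commute)
  finally show ?thesis .
qed

lemma reach_shift:
  assumes "S \<in> ksub n k"
  shows "reach n (shift la S) ks \<subseteq> reach n la (k # ks)"
proof
  have S: "S \<subseteq> {..<n}" "card S = k" and fin: "finite S"
    using assms by (auto simp: ksub_def intro: finite_subset)
  fix nu assume nu: "nu \<in> reach n (shift la S) ks"
  have card: "card (S \<inter> {..<m}) \<le> min m k" for m
    using card_mono[of "{..<m}" "S \<inter> {..<m}"] card_mono[of S "S \<inter> {..<m}"] fin S(2) by simp
  have "S \<inter> {..<n} = S" using S(1) by auto
  then have size: "psize n (shift la S) = psize n la + k" by (simp add: psize_def sum_shift[OF fin] S(2))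
  show "nu \<in> reach n la (k # ks)"
    unfolding reach_def
  proof (intro CollectI conjI allI impI)
    show "nu \<in> Par n" "psize n nu = psize n la + sum_list (k # ks)"
      using nu size by (simp_all add: reach_def)
    fix m assume "m \<le> n"
    then have "(\<Sum>i<m. nu i) \<le> (\<Sum>i<m. la i) + card (S \<inter> {..<m}) + (\<Sum>k\<leftarrow>ks. min m k)"
      using nu by (simp add: reach_def sum_shift[OF fin])
    then show "(\<Sum>i<m. nu i) \<le> (\<Sum>i<m. la i) + (\<Sum>k\<leftarrow>k # ks. min m k)"
      using card[of m] unfolding list.map sum_list.Cons by linarith
  qed
qed

text \<open>\<open>Dcoef_zero\<close> discards every S that leads outside the partitions, so the
  induction hypothesis applies to all remaining shifts. The coefficients must be chosen before
  f.\<close>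

lemma foldr_Dk_hat:
  assumes "\<forall>k\<in>set ks. k \<le> n" "la \<in> Par n"
  shows "\<exists>c. \<forall>f\<in>Lam n. foldr (Dk n) ks f (hat n la) = (\<Sum>nu\<in>reach n la ks. c nu * f (hat n nu))"
  using assms
proof (induction ks arbitrary: la)
  case Nil
  have "la \<in> reach n la []" using Nil by (simp add: reach_def)
  then have "foldr (Dk n) [] f (hat n la) = (\<Sum>nu\<in>reach n la []. (if nu = la then 1 else 0) * f (hat n nu))" for f
  proof -
    have "(\<Sum>nu\<in>reach n la []. (if nu = la then 1 else 0) * f (hat n nu)) =
        (\<Sum>nu\<in>{la}. (if nu = la then 1 else 0) * f (hat n nu))"
      by (rule sum.mono_neutral_right[OF finite_reach]) (use \<open>la \<in> reach n la []\<close> in auto)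
    then show ?thesis by simp
  qed
  then show ?case by (intro exI[of _ "\<lambda>nu. if nu = la then 1 else 0"]) blast
next
  case (Cons k ks)
  have k: "k \<le> n" and ks: "\<forall>k\<in>set ks. k \<le> n" using Cons.prems(1) by auto
  define Q where "Q = {S \<in> ksub n k. shift la S \<in> Par n}"
  have "\<forall>S\<in>Q. \<exists>c. \<forall>f\<in>Lam n. foldr (Dk n) ks f (hat n (shift la S)) =
      (\<Sum>nu\<in>reach n (shift la S) ks. c nu * f (hat n nu))"
    using Cons.IH[OF ks] by (simp add: Q_def)
  from bchoice[OF this] obtain c where c: "\<And>S f. S \<in> Q \<Longrightarrow> f \<in> Lam n \<Longrightarrow>
      foldr (Dk n) ks f (hat n (shift la S)) = (\<Sum>nu\<in>reach n (shift la S) ks. c S nu * f (hat n nu))"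
    by blast
  \<comment> \<open>Extension by zero brings the sums for different S to a common index set, so that
    they can be interchanged.\<close>
  define c' where "c' S nu = (if nu \<in> reach n (shift la S) ks then c S nu else 0)" for S nu
  define t where "t = tt ^ (k * (k - 1) div 2)"
  have main: "foldr (Dk n) (k # ks) f (hat n la) =
      (\<Sum>nu\<in>reach n la (k # ks). (\<Sum>S\<in>Q. t * Dcoef n S la * c' S nu) * f (hat n nu))" if f: "f \<in> Lam n" for f
  proof -
    have "foldr (Dk n) (k # ks) f (hat n la) =
        t * (\<Sum>S\<in>ksub n k. Dcoef n S la * foldr (Dk n) ks f (hat n (shift la S)))"
      by (simp only: foldr.simps o_apply Dk_apply[OF foldr_Dk_Lam[OF ks f] k inj_hat] Dform_hat t_def)
    also have "(\<Sum>S\<in>ksub n k. Dcoef n S la * foldr (Dk n) ks f (hat n (shift la S))) =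
        (\<Sum>S\<in>Q. Dcoef n S la * foldr (Dk n) ks f (hat n (shift la S)))"
    proof (rule sum.mono_neutral_right[OF finite_ksub])
      show "\<forall>S\<in>ksub n k - Q. Dcoef n S la * foldr (Dk n) ks f (hat n (shift la S)) = 0"
        using Dcoef_zero[OF Cons.prems(2)] by (auto simp: Q_def ksub_def)
    qed (auto simp: Q_def)
    also have "\<dots> = (\<Sum>S\<in>Q. Dcoef n S la * (\<Sum>nu\<in>reach n la (k # ks). c' S nu * f (hat n nu)))"
    proof (rule sum.cong[OF refl])
      fix S assume S: "S \<in> Q"
      then have "reach n (shift la S) ks \<subseteq> reach n la (k # ks)" by (intro reach_shift) (simp add: Q_def)
      then have "(\<Sum>nu\<in>reach n (shift la S) ks. c S nu * f (hat n nu)) =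
          (\<Sum>nu\<in>reach n la (k # ks). c' S nu * f (hat n nu))"
        by (intro sum.mono_neutral_cong_left finite_reach) (auto simp: c'_def)
      then show "Dcoef n S la * foldr (Dk n) ks f (hat n (shift la S)) =
          Dcoef n S la * (\<Sum>nu\<in>reach n la (k # ks). c' S nu * f (hat n nu))"
        using c[OF S f] by simp
    qed
    also have "t * \<dots> = (\<Sum>S\<in>Q. \<Sum>nu\<in>reach n la (k # ks). t * Dcoef n S la * c' S nu * f (hat n nu))"
      by (simp only: sum_distrib_left mult.assoc)
    also have "\<dots> = (\<Sum>nu\<in>reach n la (k # ks). \<Sum>S\<in>Q. t * Dcoef n S la * c' S nu * f (hat n nu))"
      by (rule sum.swap)
    finally show ?thesis by (simp only: sum_distrib_right)
  qed
  show ?case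
    by (rule exI[of _ "\<lambda>nu. \<Sum>S\<in>Q. t * Dcoef n S la * c' S nu"], rule ballI, rule main)
qed

text \<open>For the columns of \<open>mu\<close> the bounds \<open>min m k\<close> add up to the
  partial sums of \<open>mu\<close>, so the outer bound starting from the empty partition is exactly
  the dominance ideal.\<close>

lemma reach_cols:
  assumes mu: "mu \<in> Par n"
  shows "reach n zero_part (cols n mu) = below n mu"
proof -
  have swap: "(\<Sum>k\<leftarrow>ks. \<Sum>i<m. epart k i) = (\<Sum>i<m. \<Sum>k\<leftarrow>ks. epart k i)" for ks m
    by (induction ks) (auto simp: sum.distrib)
  have min: "(\<Sum>k\<leftarrow>cols n mu. min m k) = (\<Sum>i<m. mu i)" for m
  proof -
    have "min m k = (\<Sum>i<m. epart k i)" for k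
    proof -
      have "(\<Sum>i<m. epart k i) = (\<Sum>i<min m k. 1)"
        by (intro sum.mono_neutral_cong_right) (auto simp: epart_def)
      then show ?thesis by simp
    qed
    then have "(\<Sum>k\<leftarrow>cols n mu. min m k) = (\<Sum>k\<leftarrow>cols n mu. \<Sum>i<m. epart k i)" by simp
    also have "\<dots> = (\<Sum>i<m. \<Sum>k\<leftarrow>cols n mu. epart k i)"
      by (rule swap)
    also have "\<dots> = (\<Sum>i<m. mu i)" using fun_cong[OF sum_cols[OF mu]] by simp
    finally show ?thesis .
  qed
  have "map (min n) (cols n mu) = cols n mu"
    using cols_le[OF mu] by (intro map_idI) auto
  then have "sum_list (cols n mu) = psize n mu" using min[of n] by (simp add: psize_def)
  then show ?thesis by (simp add: reach_def below_def dom_le_def min psize_def zero_part_def)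
qed

text \<open>Resolves the description in \<open>ccoef\<close>: existence is the lattice expansion
  started at \<open>zero_part\<close>, uniqueness is the transposed kernel statement tested on the
  m_la of the ideal.\<close>

lemma ccoef_expansion:
  assumes mu: "mu \<in> Par n" and f: "f \<in> Lam n"
  shows "Dmu n mu f (hat n zero_part) = (\<Sum>nu\<in>below n mu. ccoef n mu nu * f (hat n nu))"
proof -
  let ?Q = "\<lambda>c. (\<forall>nu. \<not> (nu \<in> Par n \<and> dom_le n nu mu) \<longrightarrow> c nu = 0) \<and>
      (\<forall>f\<in>Lam n. Dmu n mu f (hat n zero_part) = (\<Sum>nu\<in>{nu\<in>Par n. dom_le n nu mu}. c nu * f (hat n nu)))"
  have "\<exists>!c. ?Q c"
  proof (rule ex_ex1I)
    have "\<forall>k\<in>set (cols n mu). k \<le> n" using cols_le[OF mu] by auto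
    then obtain c where c: "\<forall>f\<in>Lam n. Dmu n mu f (hat n zero_part) = (\<Sum>nu\<in>below n mu. c nu * f (hat n nu))"
      using foldr_Dk_hat[OF _ zero_part_Par] unfolding Dmu_foldr reach_cols[OF mu, symmetric] by blast
    have "(\<Sum>nu\<in>below n mu. c nu * f (hat n nu)) =
        (\<Sum>nu\<in>below n mu. (if nu \<in> below n mu then c nu else 0) * f (hat n nu))" for f
      by (intro sum.cong) auto
    then have "?Q (\<lambda>nu. if nu \<in> below n mu then c nu else 0)"
      using c by (simp add: below_def)
    then show "\<exists>c. ?Q c" by (rule exI[where P = ?Q])
  next
    fix c d assume c: "?Q c" and d: "?Q d"
    have "(\<Sum>nu\<in>below n mu. (c nu - d nu) * mono n la (hat n nu)) = 0" if "la \<in> below n mu" for la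
    proof -
      have m: "mono n la \<in> Lam n" using that by (intro mono_Lam) (simp add: below_def)
      have "(\<Sum>nu\<in>below n mu. c nu * mono n la (hat n nu)) = Dmu n mu (mono n la) (hat n zero_part)"
        unfolding below_def by (rule c[THEN conjunct2, THEN bspec, OF m, symmetric])
      also have "\<dots> = (\<Sum>nu\<in>below n mu. d nu * mono n la (hat n nu))"
        unfolding below_def by (rule d[THEN conjunct2, THEN bspec, OF m])
      finally have "(\<Sum>nu\<in>below n mu. c nu * mono n la (hat n nu)) = (\<Sum>nu\<in>below n mu. d nu * mono n la (hat n nu))" .
      then show ?thesis by (simp add: left_diff_distrib sum_subtractf)
    qed
    then have z: "c nu - d nu = 0" if "nu \<in> below n mu" for nu
      by (rule mono_hat_kernel'[OF finite_below below_subset_Par, of n mu "\<lambda>nu. c nu - d nu"]) (use that in simp_all)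
    show "c = d"
    proof
      fix nu
      show "c nu = d nu"
      proof (cases "nu \<in> below n mu")
        case False
        then show ?thesis using c[THEN conjunct1] d[THEN conjunct1] by (simp add: below_def)
      qed (use z in simp)
    qed
  qed
  from theI'[OF this, THEN conjunct2, THEN bspec, OF f] show ?thesis unfolding ccoef_def below_def .
qed

section \<open>Interpolation polynomials\<close>

definition lower :: "nat \<Rightarrow> ((nat \<Rightarrow> nat) \<Rightarrow> (nat \<Rightarrow> nat) \<Rightarrow> bool) \<Rightarrow> (nat \<Rightarrow> nat) \<Rightarrow> (nat \<Rightarrow> nat) set" where
  "lower n lt mu = {la \<in> Par n. lt la mu}"

context
  fixes n :: nat and lt :: "(nat \<Rightarrow> nat) \<Rightarrow> (nat \<Rightarrow> nat) \<Rightarrow> bool"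
  assumes adm: "admissible_order n lt"
begin

lemma lt_irrefl: "la \<in> Par n \<Longrightarrow> \<not> lt la la"
  and lt_trans: "la \<in> Par n \<Longrightarrow> mu \<in> Par n \<Longrightarrow> nu \<in> Par n \<Longrightarrow> lt la mu \<Longrightarrow> lt mu nu \<Longrightarrow> lt la nu"
  and lt_total: "la \<in> Par n \<Longrightarrow> mu \<in> Par n \<Longrightarrow> la \<noteq> mu \<Longrightarrow> lt la mu \<or> lt mu la"
  and lt_size: "la \<in> Par n \<Longrightarrow> mu \<in> Par n \<Longrightarrow> psize n la < psize n mu \<Longrightarrow> lt la mu"
  and lt_dom: "la \<in> Par n \<Longrightarrow> mu \<in> Par n \<Longrightarrow> dom_le n la mu \<Longrightarrow> la \<noteq> mu \<Longrightarrow> lt la mu"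
  using adm unfolding admissible_order_def by blast+

lemma lower_subset_Par: "lower n lt mu \<subseteq> Par n"
  by (auto simp: lower_def)

text \<open>A partition of larger size than \<open>mu\<close> lies above it in the order, so a lower
  one has bounded size.\<close>

lemma finite_lower:
  assumes mu: "mu \<in> Par n"
  shows "finite (lower n lt mu)"
proof (rule finite_subset[OF _ finite_bounded_parts[of n "psize n mu"]])
  show "lower n lt mu \<subseteq> {la \<in> Par n. psize n la \<le> psize n mu}"
  proof
    fix la assume la: "la \<in> lower n lt mu"
    then have *: "la \<in> Par n" "lt la mu" by (auto simp: lower_def)
    then have "\<not> lt mu la" using lt_trans[OF mu *(1) mu] lt_irrefl[OF mu] by blast
    then show "la \<in> {la \<in> Par n. psize n la \<le> psize n mu}"
      using lt_size[OF mu *(1)] * by (cases "psize n la \<le> psize n mu") auto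
  qed
qed

lemma lower_trans: "mu \<in> Par n \<Longrightarrow> nu \<in> Par n \<Longrightarrow> lt mu nu \<Longrightarrow> lower n lt mu \<subseteq> lower n lt nu"
  unfolding lower_def using lt_trans by blast

lemma lower_down:
  assumes mu: "mu \<in> Par n" and la: "la \<in> lower n lt mu"
  shows "below n la \<subseteq> lower n lt mu"
proof
  fix ka assume "ka \<in> below n la"
  then have ka: "ka \<in> Par n" "dom_le n ka la" by (auto simp: below_def)
  have la': "la \<in> Par n" "lt la mu" using la by (auto simp: lower_def)
  then have "lt ka mu" using lt_dom[OF ka(1) la'(1) ka(2)] lt_trans[OF ka(1) la'(1) mu] by blast
  then show "ka \<in> lower n lt mu" using ka by (simp add: lower_def)
qed

lemma sbelow_lower: "mu \<in> Par n \<Longrightarrow> sbelow n mu \<subseteq> lower n lt mu"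
  unfolding sbelow_def lower_def using lt_dom by blast

text \<open>The vanishing conditions form a square linear system indexed by
  \<open>lower n lt mu\<close> on both sides; solvability and trivial kernel give existence and
  uniqueness.\<close>

lemma Iint_props:
  assumes mu: "mu \<in> Par n"
  shows "Iint n lt mu - mono n mu \<in> msp n (lower n lt mu)"
    and "\<And>la. la \<in> lower n lt mu \<Longrightarrow> Iint n lt mu (hat n la) = 0"
proof -
  let ?J = "lower n lt mu"
  let ?Q = "\<lambda>I. I \<in> Lam n \<and>
      (\<exists>a. I = (\<lambda>x. mono n mu x + (\<Sum>la\<in>{la\<in>Par n. lt la mu}. a la * mono n la x))) \<and>
      (\<forall>la\<in>Par n. lt la mu \<longrightarrow> I (hat n la) = 0)"
  have "\<exists>!I. ?Q I"
  proof (rule ex_ex1I)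
    obtain a where a: "\<And>nu. nu \<in> ?J \<Longrightarrow> (\<Sum>la\<in>?J. a la * mono n la (hat n nu)) = - mono n mu (hat n nu)"
      by (rule mono_hat_solvable[OF finite_lower[OF mu] lower_subset_Par, of "\<lambda>nu. - mono n mu (hat n nu)"]) blast
    define r where "r = (\<lambda>x. \<Sum>la\<in>?J. a la * mono n la x)"
    have "r \<in> Lam n" unfolding r_def Lam_eq_msp by (rule msp_sumI[OF lower_subset_Par])
    then have "mono n mu + r \<in> Lam n" by (intro Lam_add mono_Lam mu)
    moreover have "mono n mu + r = (\<lambda>x. mono n mu x + (\<Sum>la\<in>{la\<in>Par n. lt la mu}. a la * mono n la x))"
      by (simp add: r_def lower_def fun_eq_iff)
    moreover have "(mono n mu + r) (hat n la) = 0" if "la \<in> ?J" for la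
      using a[OF that] by (simp add: r_def)
    ultimately show "\<exists>I. ?Q I" by (intro exI[of _ "mono n mu + r"]) (auto simp only: lower_def mem_Collect_eq)
  next
    fix I I' assume I: "?Q I" and I': "?Q I'"
    obtain a where a: "I = (\<lambda>x. mono n mu x + (\<Sum>la\<in>?J. a la * mono n la x))" using I unfolding lower_def by blast
    obtain a' where a': "I' = (\<lambda>x. mono n mu x + (\<Sum>la\<in>?J. a' la * mono n la x))" using I' unfolding lower_def by blast
    have "(\<Sum>la\<in>?J. (a la - a' la) * mono n la (hat n nu)) = 0" if nu: "nu \<in> ?J" for nu
    proof -
      have "I (hat n nu) = I' (hat n nu)" using I I' nu by (simp add: lower_def)
      then show ?thesis unfolding a a' by (simp add: left_diff_distrib sum_subtractf)
    qed
    then have "a la - a' la = 0" if "la \<in> ?J" for la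
      using mono_hat_kernel[OF finite_lower[OF mu] lower_subset_Par, of "\<lambda>la. a la - a' la" la] that by blast
    then show "I = I'" unfolding a a' by (intro ext arg_cong2[where f = "(+)"] sum.cong refl) simp
  qed
  from theI'[OF this] have Q: "?Q (Iint n lt mu)" unfolding Iint_def .
  then obtain a where a: "Iint n lt mu = (\<lambda>x. mono n mu x + (\<Sum>la\<in>?J. a la * mono n la x))"
    unfolding lower_def by blast
  have "Iint n lt mu - mono n mu = (\<lambda>x. \<Sum>la\<in>?J. a la * mono n la x)" unfolding a by (simp add: fun_eq_iff)
  then show "Iint n lt mu - mono n mu \<in> msp n ?J" using msp_sumI[OF order_refl] by (simp only:)
  show "Iint n lt mu (hat n la) = 0" if "la \<in> ?J" for la using Q that by (simp add: lower_def)
qed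

lemma Iint_Lam: "mu \<in> Par n \<Longrightarrow> Iint n lt mu \<in> Lam n"
proof -
  assume mu: "mu \<in> Par n"
  have "Iint n lt mu - mono n mu \<in> Lam n" using Iint_props(1)[OF mu] msp_subset_Lam[OF lower_subset_Par] by blast
  then have "Iint n lt mu - mono n mu + mono n mu \<in> Lam n" by (rule Lam_add[OF _ mono_Lam[OF mu]])
  then show ?thesis by (simp only: diff_add_cancel)
qed

text \<open>The order refines dominance, so passing to a unitriangular family g keeps the lower
  terms inside the initial segment. It is used with g the Macdonald polynomials for the right
  argument and the column products for the left one.\<close>

lemma Iint_expansion:
  assumes mu: "mu \<in> Par n" and g: "\<And>la. la \<in> Par n \<Longrightarrow> g la - mono n la \<in> msp n (sbelow n la)"
  obtains c where "Iint n lt mu = g mu + (\<Sum>la\<in>lower n lt mu. scl (c la) (g la))"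
proof -
  have "g mu - mono n mu \<in> msp n (lower n lt mu)" using g[OF mu] msp_mono[OF sbelow_lower[OF mu]] by blast
  then have "(Iint n lt mu - mono n mu) - (g mu - mono n mu) \<in> msp n (lower n lt mu)"
    by (rule msp_diff[OF Iint_props(1)[OF mu]])
  then have "(Iint n lt mu - mono n mu) - (g mu - mono n mu) \<in> fs.span (g ` lower n lt mu)"
    using unitriangular_span_subset[OF g lower_subset_Par lower_down[OF mu]] by blast
  then obtain c where c: "(Iint n lt mu - mono n mu) - (g mu - mono n mu) = (\<Sum>la\<in>lower n lt mu. scl (c la) (g la))"
    by (rule span_image_finiteE[OF _ finite_lower[OF mu]])
  have "Iint n lt mu = g mu + ((Iint n lt mu - mono n mu) - (g mu - mono n mu))" by (simp add: fun_eq_iff)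
  then show thesis unfolding c by (rule that)
qed

lemma lt_imp_lower: "la \<in> lower n lt nu \<Longrightarrow> mu \<in> Par n \<Longrightarrow> nu \<in> Par n \<Longrightarrow> nu = mu \<or> lt nu mu \<Longrightarrow> la \<in> lower n lt mu"
  using lower_trans by blast

lemma pairing_Iint_spectral:
  assumes n: "1 \<le> n" and mu: "mu \<in> Par n" and nu: "nu \<in> Par n" and le: "nu = mu \<or> lt nu mu"
  shows "pairing n (Iint n lt mu) (Iint n lt nu) = Iint n lt mu (hat n nu) * mac n nu (hat n zero_part)"
proof -
  let ?I = "Iint n lt mu" and ?J = "lower n lt nu"
  have I: "?I \<in> Lam n" by (rule Iint_Lam[OF mu])
  have J: "la \<in> Par n" "mac n la \<in> Lam n" if "la \<in> ?J" for la
    using that mac_Lam[OF n] by (auto simp: lower_def)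
  obtain c where c: "Iint n lt nu = mac n nu + (\<Sum>la\<in>?J. scl (c la) (mac n la))"
    by (rule Iint_expansion[OF nu mac_leading[OF n]])
  have sL: "(\<Sum>la\<in>?J. scl (c la) (mac n la)) \<in> Lam n"
    using J(2) unfolding Lam_eq_msp by (intro msp_sum msp_scl)
  have "pairing n ?I (Iint n lt nu) = pairing n ?I (mac n nu) + pairing n ?I (\<Sum>la\<in>?J. scl (c la) (mac n la))"
    unfolding c by (rule pairing_add_right[OF n I mac_Lam[OF n nu] sL])
  also have "pairing n ?I (\<Sum>la\<in>?J. scl (c la) (mac n la)) = (\<Sum>la\<in>?J. c la * pairing n ?I (mac n la))"
    by (rule linear_functional_sum[OF finite_lower[OF nu] pairing_add_right[OF n I] pairing_scl_right[OF n I] J(2)])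
  also have "\<dots> = 0"
  proof (rule sum.neutral, rule ballI)
    fix la assume la: "la \<in> ?J"
    then have "?I (hat n la) = 0" by (intro Iint_props(2)[OF mu] lt_imp_lower[OF _ mu nu le])
    then show "c la * pairing n ?I (mac n la) = 0" by (simp add: pairing_mac[OF n I J(1)[OF la]])
  qed
  finally show ?thesis by (simp add: pairing_mac[OF n I nu])
qed

lemma pairing_Iint_lattice:
  assumes n: "1 \<le> n" and mu: "mu \<in> Par n" and nu: "nu \<in> Par n" and le: "mu = nu \<or> lt mu nu"
  shows "pairing n (Iint n lt mu) (Iint n lt nu) = ccoef n mu mu * Iint n lt nu (hat n mu)"
proof -
  let ?I = "Iint n lt nu" and ?J = "lower n lt mu" and ?e = "\<lambda>la. elist n (cols n la)"
  have I: "?I \<in> Lam n" by (rule Iint_Lam[OF nu])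
  have eL: "?e la \<in> Lam n" if "la \<in> Par n" for la using cols_le[OF that] by (intro elist_Lam) auto
  have J: "la \<in> Par n" "?e la \<in> Lam n" if "la \<in> ?J" for la
    using that eL by (auto simp: lower_def)
  have van: "?I (hat n la) = 0" if "la \<in> ?J" for la
    by (intro Iint_props(2)[OF nu] lt_imp_lower[OF that nu mu le])
  obtain c where c: "Iint n lt mu = ?e mu + (\<Sum>la\<in>?J. scl (c la) (?e la))"
    by (rule Iint_expansion[OF mu elist_cols])
  have sL: "(\<Sum>la\<in>?J. scl (c la) (?e la)) \<in> Lam n"
    using J(2) unfolding Lam_eq_msp by (intro msp_sum msp_scl)
  have "pairing n (Iint n lt mu) ?I = pairing n (?e mu) ?I + pairing n (\<Sum>la\<in>?J. scl (c la) (?e la)) ?I"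
    unfolding c by (rule pairing_add_left[OF n I eL[OF mu] sL])
  also have "pairing n (\<Sum>la\<in>?J. scl (c la) (?e la)) ?I = (\<Sum>la\<in>?J. c la * pairing n (?e la) ?I)"
    by (rule linear_functional_sum[where L = "\<lambda>g. pairing n g ?I", OF finite_lower[OF mu] pairing_add_left[OF n I] pairing_scl_left[OF n I] J(2)])
  also have "\<dots> = 0"
  proof (rule sum.neutral, rule ballI)
    fix la assume la: "la \<in> ?J"
    have "pairing n (?e la) ?I = (\<Sum>ka\<in>below n la. ccoef n la ka * ?I (hat n ka))"
      by (simp only: pairing_elist[OF n I J(1)[OF la]] ccoef_expansion[OF J(1)[OF la] I])
    \<comment> \<open>The whole dominance ideal of \<open>la\<close> lies inside
      \<open>lower n lt mu\<close>, where the interpolation polynomial of \<open>nu\<close>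
      vanishes.\<close>
    also have "\<dots> = 0" using van lower_down[OF mu la] by (intro sum.neutral) auto
    finally show "c la * pairing n (?e la) ?I = 0" by simp
  qed
  also have "pairing n (?e mu) ?I = (\<Sum>ka\<in>below n mu. ccoef n mu ka * ?I (hat n ka))"
    by (simp only: pairing_elist[OF n I mu] ccoef_expansion[OF mu I])
  also have "\<dots> = (\<Sum>ka\<in>{mu}. ccoef n mu ka * ?I (hat n ka))"
  proof (rule sum.mono_neutral_right[OF finite_below])
    show "\<forall>ka\<in>below n mu - {mu}. ccoef n mu ka * ?I (hat n ka) = 0"
      using van sbelow_lower[OF mu] unfolding below_eq_insert[OF mu] by auto
  qed (simp add: below_eq_insert[OF mu])
  finally show ?thesis by simp
qed

end

theorem theorem2:
  fixes n :: nat and lt :: "(nat \<Rightarrow> nat) \<Rightarrow> (nat \<Rightarrow> nat) \<Rightarrow> bool" and mu nu :: "nat \<Rightarrow> nat"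
  assumes "n \<ge> 1" and "admissible_order n lt" and "mu \<in> Par n" and "nu \<in> Par n"
  shows "pairing n (Iint n lt mu) (Iint n lt nu) =
           (if mu = nu then Iint n lt mu (hat n mu) * Pmac n mu (hat n zero_part) else 0)
       \<and> pairing n (Iint n lt mu) (Iint n lt nu) =
           (if mu = nu then ccoef n mu mu * Iint n lt mu (hat n mu) else 0)"
proof (cases "mu = nu")
  case True
  \<comment> \<open>Each evaluation covers the diagonal and supplies one of the two forms.\<close>
  then show ?thesis
    using pairing_Iint_spectral[OF assms(2,1,3,3)] pairing_Iint_lattice[OF assms(2,1,3,3)]
      Pmac_eq_mac[OF assms(1,3)] by simp
next
  case False
  have "pairing n (Iint n lt mu) (Iint n lt nu) = 0"
  \<comment> \<open>The lattice evaluation leaves a factor I_nu(hat mu) when mu is lower, the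
    spectral one a factor I_mu(hat nu) when nu is lower; in either case the factor is one of the
    prescribed zeros.\<close>
  proof (cases "lt mu nu")
    case True
    then have "Iint n lt nu (hat n mu) = 0"
      using assms(3) by (intro Iint_props(2)[OF assms(2,4)]) (simp add: lower_def)
    then show ?thesis using pairing_Iint_lattice[OF assms(2,1,3,4)] True by simp
  next
    case notlt: False
    then have lt: "lt nu mu" using lt_total[OF assms(2-4)] False by blast
    then have "Iint n lt mu (hat n nu) = 0"
      using assms(4) by (intro Iint_props(2)[OF assms(2,3)]) (simp add: lower_def)
    then show ?thesis using pairing_Iint_spectral[OF assms(2,1,3,4)] lt by simp
  qed
  then show ?thesis using False by simp
qed

end
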